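(* Let $(X,d,\mu)$ be a uniformly discrete, quasi-geodesic coarse median space with bounded geometry and $n$ be a natural number. The following are equivalent: (1) $(X,d,\mu)$ has rank at most $n$; (2) there is a function $p:\mathbb R^+\to\mathbb R^+$ with $p(r)=o(r^{n+\epsilon})$ (as $r\to\infty$) for all $\epsilon>0$, such that $\sharp[a,b]\le p(d(a,b))$ for any $a,b\in X$; (3) there is a function $p:\mathbb R^+\to\mathbb R^+$ with $p(r)/r^{n+1}\to 0$ as $r\to\infty$, such that $\sharp[a,b]\le p(d(a,b))$ for any $a,b\in X$.
   Context: Here $\mathbb R^+=[0,\infty)$ and $\sharp$ denotes cardinality. Coarse median space: a triple $(X,d,\mu)$ with $(X,d)$ a metric space and $\mu:X^3\to X$ satisfying: (M1) $\mu(a,a,b)=a$; (M2) $\mu$ is invariant under all permutations of its three arguments; (C1) there is an affine function $\rho:[0,\infty)\to[0,\infty)$ with $d(\mu(a,b,c),\mu(a',b,c))\le\rho(d(a,a'))$; (C2) there is a constant $\kappa_4>0$ with $d(\mu(\mu(a,b,c),b,d),\mu(a,b,\mu(c,b,d)))\le\kappa_4$ for all $a,b,c,d\in X$. It is known (equivalence with Bowditch's original definition) that such a space satisfies: (B2) there is $h:\mathbb N\to\mathbb R^+$ such that for every $A\subseteq X$ with $1\le|A|\le p<\infty$ there are a finite median algebra $(\Pi,\mu_\Pi)$ and maps $\pi:A\to\Pi$, $\lambda:\Pi\to X$ with $d(\lambda(\mu_\Pi(x,y,z)),\mu(\lambda(x),\lambda(y),\lambda(z)))\le h(p)$ for all $x,y,z\in\Pi$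 and $d(a,\lambda\pi(a))\le h(p)$ for all $a\in A$. A median algebra is a set with a ternary operation satisfying (M1), (M2) and $\mu(a,b,\mu(c,d,e))=\mu(\mu(a,b,c),\mu(a,b,d),e)$. The median $m$-cube $I^m$ is $\{0,1\}^m$ with coordinatewise majority vote; the rank of a median algebra is the supremum of the $m$ for which it contains a median subalgebra isomorphic to $I^m$. Rank: $X$ has rank at most $n$ if (B2) can be satisfied (for some $h$) with all the median algebras $\Pi$ of rank at most $n$. It is a known theorem (Niblo–Wright–Zhang) that this is equivalent to: for every $\lambda>0$ there is $C=C(\lambda)$ such that for any $a,b\in X$ and $e_1,\ldots,e_{n+1}\in[a,b]$ with $d(\mu(e_i,a,e_j),a)\le\lambda$ for all $i\ne j$, some $e_i$ satisfies $d(e_i,a)\le C$. Intervals: $[a,b]=\{\mu(a,x,b)\mid x\in X\}$. Uniformly discrete: there is $C>0$ with $d(x,y)>C$ for all $x\ne y$. Bounded geometry: for every $r>0$ there is $N\in\mathbb N$ such that every ball $B(x,r)$ has at most $N$ points. Quasi-geodesic: there are $L,C>0$ such that for any $x,y\in X$ there is $\gamma:[0,d(x,y)]\to X$ with $\gamma(0)=x$, $\gamma(d(x,y))=y$ and $L^{-1}|s-t|-C\le d(\gamma(s),\gamma(t))\le L|s-t|+C$ for all $s,t$. *)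

theory Defs
  imports "HOL-Analysis.Analysis" "HOL-Library.Landau_Symbols" "HOL-Library.Extended_Nat"
begin

section \<open>Median algebras and their rank\<close>

locale median_algebra =
  fixes P :: "'b set" and m :: "'b \<Rightarrow> 'b \<Rightarrow> 'b \<Rightarrow> 'b"
  assumes closed: "\<lbrakk>a \<in> P; b \<in> P; c \<in> P\<rbrakk> \<Longrightarrow> m a b c \<in> P"
    and M1: "\<lbrakk>a \<in> P; b \<in> P\<rbrakk> \<Longrightarrow> m a a b = a"
    and M2: "\<lbrakk>a \<in> P; b \<in> P; c \<in> P\<rbrakk> \<Longrightarrow>
      m a c b = m a b c \<and> m b a c = m a b c \<and> m b c a = m a b c \<and>
      m c a b = m a b c \<and> m c b a = m a b c"
    and M3: "\<lbrakk>a \<in> P; b \<in> P; c \<in> P; d \<in> P; e \<in> P\<rbrakk> \<Longrightarrow>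
      m a b (m c d e) = m (m a b c) (m a b d) e"

definition median_subalgebra :: "'b set \<Rightarrow> 'b set \<Rightarrow> ('b \<Rightarrow> 'b \<Rightarrow> 'b \<Rightarrow> 'b) \<Rightarrow> bool" where
  "median_subalgebra S P m \<longleftrightarrow>
     S \<subseteq> P \<and> (\<forall>a\<in>S. \<forall>b\<in>S. \<forall>c\<in>S. m a b c \<in> S)"

definition median_iso ::
  "('b \<Rightarrow> 'c) \<Rightarrow> 'b set \<Rightarrow> ('b \<Rightarrow> 'b \<Rightarrow> 'b \<Rightarrow> 'b) \<Rightarrow> 'c set \<Rightarrow> ('c \<Rightarrow> 'c \<Rightarrow> 'c \<Rightarrow> 'c) \<Rightarrow> bool" where
  "median_iso f P m Q m' \<longleftrightarrow> bij_betw f P Q \<and>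
     (\<forall>x\<in>P. \<forall>y\<in>P. \<forall>z\<in>P. f (m x y z) = m' (f x) (f y) (f z))"

text \<open>
  The median cube $I^k$, with \<open>bool\<close> in the role of $\{0,1\}$. Its points are the extensional
  functions on \<open>{..<k}\<close>, so there are exactly $2^k$ of them.
\<close>

definition median_cube :: "nat \<Rightarrow> (nat \<Rightarrow> bool) set" where
  "median_cube k = {..<k} \<rightarrow>\<^sub>E UNIV"

definition majority :: "bool \<Rightarrow> bool \<Rightarrow> bool \<Rightarrow> bool" where
  "majority x y z \<longleftrightarrow> (x \<and> y) \<or> (y \<and> z) \<or> (x \<and> z)"

definition cube_median ::
  "nat \<Rightarrow> (nat \<Rightarrow> bool) \<Rightarrow> (nat \<Rightarrow> bool) \<Rightarrow> (nat \<Rightarrow> bool) \<Rightarrow> (nat \<Rightarrow> bool)" where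
  "cube_median k f g h = (\<lambda>i\<in>{..<k}. majority (f i) (g i) (h i))"

definition median_rank :: "'b set \<Rightarrow> ('b \<Rightarrow> 'b \<Rightarrow> 'b \<Rightarrow> 'b) \<Rightarrow> enat" where
  "median_rank P m =
     Sup {enat k | k. \<exists>S f. median_subalgebra S P m \<and>
                            median_iso f (median_cube k) (cube_median k) S m}"

section \<open>Coarse median spaces\<close>

text \<open>
  The underlying metric space is a whole type. The pair \<open>K\<close>, \<open>H\<close> in \<open>C1\<close> gives the affine function
  $\rho(t) = K t + H$; the first conjunct says that $\rho$ maps $[0,\infty)$ to $[0,\infty)$.
\<close>

locale coarse_median_space =
  fixes \<mu> :: "'a::metric_space \<Rightarrow> 'a \<Rightarrow> 'a \<Rightarrow> 'a"
  assumes M1: "\<mu> a a b = a"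
    and M2: "\<mu> a c b = \<mu> a b c \<and> \<mu> b a c = \<mu> a b c \<and> \<mu> b c a = \<mu> a b c \<and>
      \<mu> c a b = \<mu> a b c \<and> \<mu> c b a = \<mu> a b c"
    and C1: "\<exists>K H::real. (\<forall>t\<ge>0. 0 \<le> K * t + H) \<and>
      (\<forall>a a' b c. dist (\<mu> a b c) (\<mu> a' b c) \<le> K * dist a a' + H)"
    and C2: "\<exists>\<kappa>>0. \<forall>a b c d. dist (\<mu> (\<mu> a b c) b d) (\<mu> a b (\<mu> c b d)) \<le> \<kappa>"

definition interval :: "('a \<Rightarrow> 'a \<Rightarrow> 'a \<Rightarrow> 'a) \<Rightarrow> 'a \<Rightarrow> 'a \<Rightarrow> 'a set" where
  "interval \<mu> a b = {\<mu> a x b | x. True}"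

text \<open>
  The finite median algebras approximating a finite subset are taken with carrier a set of natural
  numbers. This is no restriction, since every finite median algebra is isomorphic to such a one.
\<close>

definition coarse_rank_at_most ::
  "('a::metric_space \<Rightarrow> 'a \<Rightarrow> 'a \<Rightarrow> 'a) \<Rightarrow> nat \<Rightarrow> bool" where
  "coarse_rank_at_most \<mu> n \<longleftrightarrow>
     (\<exists>h::nat \<Rightarrow> real. (\<forall>p. 0 \<le> h p) \<and>
       (\<forall>p. \<forall>A::'a set. finite A \<and> 1 \<le> card A \<and> card A \<le> p \<longrightarrow>
         (\<exists>(P::nat set) m \<pi> l.
            finite P \<and> median_algebra P m \<and> median_rank P m \<le> enat n \<and> \<pi> ` A \<subseteq> P \<and>
            (\<forall>x\<in>P. \<forall>y\<in>P. \<forall>z\<in>P. dist (l (m x y z)) (\<mu> (l x) (l y) (l z)) \<le> h p) \<and>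
            (\<forall>a\<in>A. dist a (l (\<pi> a)) \<le> h p))))"

section \<open>Conditions on the metric\<close>

definition bounded_geometry :: "'a::metric_space set \<Rightarrow> bool" where
  "bounded_geometry X \<longleftrightarrow>
     (\<forall>r>0. \<exists>N::nat. \<forall>x\<in>X. finite (cball x r \<inter> X) \<and> card (cball x r \<inter> X) \<le> N)"

definition quasi_geodesic :: "'a::metric_space set \<Rightarrow> bool" where
  "quasi_geodesic X \<longleftrightarrow>
     (\<exists>L C::real. L > 0 \<and> C > 0 \<and>
       (\<forall>x\<in>X. \<forall>y\<in>X. \<exists>\<gamma>. \<gamma> ` {0..dist x y} \<subseteq> X \<and> \<gamma> 0 = x \<and> \<gamma> (dist x y) = y \<and>
         (\<forall>s\<in>{0..dist x y}. \<forall>t\<in>{0..dist x y}.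
            inverse L * \<bar>s - t\<bar> - C \<le> dist (\<gamma> s) (\<gamma> t) \<and>
            dist (\<gamma> s) (\<gamma> t) \<le> L * \<bar>s - t\<bar> + C)))"

section \<open>Growth of intervals\<close>

text \<open>
  Finiteness is stated separately because \<open>card\<close> is 0 on infinite sets. A function
  $p : [0,\infty) \to [0,\infty)$ is a function on \<open>real\<close> that is nonnegative on $[0,\infty)$.
\<close>

definition interval_growth_le ::
  "('a::metric_space \<Rightarrow> 'a \<Rightarrow> 'a \<Rightarrow> 'a) \<Rightarrow> (real \<Rightarrow> real) \<Rightarrow> bool" where
  "interval_growth_le \<mu> p \<longleftrightarrow>
     (\<forall>r\<ge>0. 0 \<le> p r) \<and>
     (\<forall>a b. finite (interval \<mu> a b) \<and> real (card (interval \<mu> a b)) \<le> p (dist a b))"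

end

theory Submission
  imports Defs
begin

text \<open>
  Bounded rank implies growth with every exponent above \<open>n\<close>; this is in particular growth of smaller order than
  \<open>r ^ (n + 1)\<close>, which in turn implies bounded rank. The common tool is that median algebras are algebras of truth values: half-spaces, that
  is, homomorphisms to the two-element median algebra, separate points (\<open>halfspace_separation\<close>). This
  passes to coarse medians. Families of points of \<open>X\<close> modulo uniformly bounded distance satisfy the
  median laws exactly, so a relation between families that holds for truth values holds in \<open>X\<close> up to
  a uniform constant (\<open>coarse_identity\<close>). In particular \<open>p\<close> points of \<open>X\<close> are approximated by the free
  median algebra on \<open>p\<close> generators (\<open>finite_approximation\<close>).

  Slow growth implies bounded rank. If there were arbitrarily long corners, that is, points \<open>e 0, \<dots>, e n\<close> far from \<open>a\<close> whose
  pairwise medians with \<open>a\<close> are close to \<open>a\<close>, then they would span coarse \<open>(n + 1)\<close>-cubes of side \<open>R\<close> in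
  intervals of length of order \<open>R\<close>. In a quasi-geodesic space such a cube has at least of the order of \<open>R ^ (n + 1)\<close> points,
  which slow growth excludes (\<open>corner_condition_of_slow_growth\<close>). When there are no long corners, the walls of the free
  median algebra that are crossed by pairs of nearby points of \<open>X\<close> can be collapsed with bounded error, and
  a cube of dimension \<open>n + 1\<close> left in the quotient would give a long corner. So the rank is at most \<open>n\<close>
  (\<open>rank_at_most_of_corner_condition\<close>).

  Bounded rank implies slow growth. In a median algebra of rank at most \<open>n\<close> the half-spaces between two points form an
  order without antichains of \<open>n + 1\<close> elements, which decomposes into \<open>n\<close> chains. Each chain is a coordinate. A path of
  \<open>T\<close> short steps passes only about \<open>T\<close> levels of a chain at the scale of a step, and points with the same
  level in all \<open>n\<close> chains are close (\<open>pigeonhole_in_interval\<close>). Hence the part of an interval in a ball of radius \<open>D\<close>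
  contains at most \<open>(c * s) ^ n\<close> points with mutual distances above \<open>D / s\<close>, provided that \<open>D\<close> is large in terms of \<open>s\<close>
  (\<open>card_separated_le\<close>). Iterating this from scale \<open>D\<close> down to bounded scale, where bounded geometry takes over,
  gives growth of order \<open>D powr \<alpha>\<close> for each \<open>\<alpha> > n\<close> (\<open>growth_of_bounded_rank\<close>).
\<close>

section \<open>Half-spaces separate points\<close>

text \<open>
  The idempotence and symmetry of a median with the exact form of the coarse four-point law. This is
  what survives of a coarse median when bounded errors are divided out, so half-space separation is
  developed from it directly; the five-point law of a median algebra then comes out as a consequence.
\<close>

locale four_point_algebra =
  fixes P :: "'b set" and m :: "'b \<Rightarrow> 'b \<Rightarrow> 'b \<Rightarrow> 'b"
  assumes cl [intro]: "\<lbrakk>a \<in> P; b \<in> P; c \<in> P\<rbrakk> \<Longrightarrow> m a b c \<in> P"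
    and idem: "\<lbrakk>a \<in> P; b \<in> P\<rbrakk> \<Longrightarrow> m a a b = a"
    and sym12: "\<lbrakk>a \<in> P; b \<in> P; c \<in> P\<rbrakk> \<Longrightarrow> m a b c = m b a c"
    and sym23: "\<lbrakk>a \<in> P; b \<in> P; c \<in> P\<rbrakk> \<Longrightarrow> m a b c = m a c b"
    and four: "\<lbrakk>a \<in> P; b \<in> P; c \<in> P; d \<in> P\<rbrakk> \<Longrightarrow> m (m a b c) b d = m a b (m c b d)"
begin

text \<open>
  Membership of \<open>x\<close> in the interval from \<open>a\<close> to \<open>b\<close>. For a fixed base point \<open>a\<close> the four-point
  law makes \<open>(y, z) \<mapsto> m y a z\<close> a semilattice operation, and \<open>btw a x b\<close> is its order \<open>x \<le> b\<close>; the next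
  lemmas are order axioms for varying base points.
\<close>

definition btw where "btw a x b \<longleftrightarrow> m a x b = x"

lemma btw_sym: "\<lbrakk>a \<in> P; x \<in> P; b \<in> P\<rbrakk> \<Longrightarrow> btw a x b \<Longrightarrow> btw b x a"
  unfolding btw_def by (metis sym12 sym23)

lemma btw_med: "\<lbrakk>a \<in> P; x \<in> P; b \<in> P\<rbrakk> \<Longrightarrow> btw a (m a x b) b"
  unfolding btw_def by (metis cl idem sym12 sym23 four)

lemma btw_trans:
  assumes P: "a \<in> P" "b \<in> P" "c \<in> P" "d \<in> P" and 1: "btw a b c" and 2: "btw a c d"
  shows "btw a b d"
proof -
  have "m b a c = b" using 1 P by (metis btw_def sym12)
  then have "m b a d = m (m b a c) a d" by simp
  also have "\<dots> = m b a (m c a d)" using P by (metis four)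
  also have "\<dots> = b" using 1 2 P by (metis btw_def sym12)
  finally show ?thesis using P by (metis btw_def sym12)
qed

lemma btw_shift:
  assumes P: "a \<in> P" "b \<in> P" "c \<in> P" "d \<in> P" and 1: "btw a b c" and 2: "btw a c d"
  shows "btw b c d"
proof -
  have "m b c a = b" using 1 P by (metis btw_def sym12 sym23)
  then have "m b c d = m (m b c a) c d" by simp
  also have "\<dots> = m b c (m a c d)" using P by (metis four)
  also have "\<dots> = c" using 2 P by (metis btw_def idem sym12 sym23)
  finally show ?thesis by (simp add: btw_def)
qed

lemma btw_antisym: "\<lbrakk>a \<in> P; b \<in> P; c \<in> P\<rbrakk> \<Longrightarrow> btw a b c \<Longrightarrow> btw a c b \<Longrightarrow> b = c"
  unfolding btw_def by (metis sym23)

lemma btw_meet: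
  assumes P: "a \<in> P" "b \<in> P" "c \<in> P" "z \<in> P" and 1: "btw a z b" and 2: "btw a z c"
  shows "btw a z (m a b c)"
proof -
  have "m z a (m b a c) = m (m z a b) a c" using P by (metis four)
  also have "\<dots> = z" using P 1 2 unfolding btw_def by (metis sym12)
  finally show ?thesis using P unfolding btw_def by (metis cl sym12 sym23)
qed

lemma btw_unique:
  assumes P: "a \<in> P" "b \<in> P" "c \<in> P" "z \<in> P"
    and z: "btw a z b" "btw a z c" "btw b z c"
  shows "z = m a b c"
proof -
  let ?w = "m a b c"
  have w: "?w \<in> P" using P by auto
  have a: "btw a z ?w" using P z by (intro btw_meet)
  have "btw b z (m b a c)" using P z by (intro btw_meet) (auto intro: btw_sym)
  then have b: "btw b z ?w" using P by (metis sym12)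
  have "btw a ?w b" using P w by (metis btw_med sym23)
  then have "btw z ?w b" using P w a btw_shift[of a z ?w b] by simp
  then have "btw b ?w z" using P w btw_sym[of z ?w b] by simp
  then show ?thesis using P w b btw_antisym[of b z ?w] by simp
qed

text \<open>
  If \<open>s\<close> lies between \<open>t\<close> and both ends of an interval through \<open>s\<close>, then \<open>s\<close> is the projection of
  \<open>t\<close> to that interval. A geodesic from \<open>s\<close> to another point \<open>w\<close> of the interval cannot pass
  through \<open>t\<close> unless \<open>t = s\<close>. Indeed, \<open>m s u w\<close> and \<open>m t u w\<close> are the same point \<open>q\<close>, and \<open>m t s q\<close> equals
  both \<open>s\<close> and \<open>t\<close>.
\<close>

lemma btw_opposite:
  assumes P: "t \<in> P" "u \<in> P" "v \<in> P" "w \<in> P" "s \<in> P"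
    and uv: "btw u w v" "btw u s v" and t: "btw t s u" "btw t s v" and w: "btw s t w"
  shows "t = s"
proof -
  let ?q = "m t u w"
  have s: "s = m t u v" using P uv t by (intro btw_unique)
  have q: "?q \<in> P" using P by auto
  have "m s u w = m t u (m v u w)" using P s by (metis four)
  also have "m v u w = w" using P uv by (metis btw_def sym12 sym23)
  finally have usw: "m u s w = ?q" using P by (metis sym12)
  have "m (m t s u) s w = m t s (m u s w)" using P by (metis four)
  then have 1: "m t s ?q = s" using P usw t(1) by (metis btw_def idem)
  have "m s t (m w t u) = m (m s t w) t u" using P by (metis four)
  also have "\<dots> = t" using P w by (metis btw_def idem)
  also have "m w t u = ?q" using P by (metis sym12 sym23)
  finally show ?thesis using 1 P q by (metis sym12)
qed

text \<open>
  Intervals are gated: \<open>m u x v\<close> is passed on the way from \<open>x\<close> to any point of the interval.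
\<close>

lemma btw_gate:
  assumes P: "x \<in> P" "u \<in> P" "v \<in> P" "w \<in> P" and w: "btw u w v"
  shows "btw x (m u x v) w"
proof -
  let ?s = "m u x v" let ?t = "m x ?s w"
  have s: "?s \<in> P" and t: "?t \<in> P" using P by auto
  have 1: "btw ?s ?t x" "btw ?s ?t w"
    using P s t by (metis btw_med sym12 sym23)+
  have 2: "btw u ?s x" "btw v ?s x" "btw u ?s v"
    using P s by (metis btw_med sym12 sym23)+
  have "btw ?t ?s u" "btw ?t ?s v"
    using P s t 1(1) 2 by (metis btw_shift btw_sym)+
  then have "?t = ?s"
    using P s t w 1 2 by (intro btw_opposite[of ?t u v w ?s])
  then show ?thesis using P by (simp add: btw_def)
qed

lemma btw_collapse:
  assumes P: "t \<in> P" "u \<in> P" "v \<in> P" "w \<in> P" "y \<in> P"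
    and y: "btw t y u" "btw t y v" and t: "btw y t w" and w: "btw u w v"
  shows "t = y"
proof -
  let ?s = "m u t v"
  have s: "?s \<in> P" using P by auto
  have "btw t y (m t u v)" using P y by (intro btw_meet)
  then have y: "btw t y ?s" using P by (metis sym12)
  have "btw t ?s w" using P w by (intro btw_gate)
  then have "btw t y w" using P s y by (metis btw_trans)
  then show ?thesis using P t by (metis btw_sym btw_antisym)
qed

text \<open>
  The two-point case of the join theorem, which makes cones over convex sets convex. On truth
  values: if \<open>z\<close> differs from \<open>u\<close> and from \<open>m c d z\<close>, then \<open>c\<close> and \<open>d\<close> agree with \<open>u\<close>, hence so
  do \<open>p\<close>, \<open>q\<close> and finally \<open>z\<close>. As long as half-spaces are not known to separate points, this is replaced
  by the observation that the median of \<open>z\<close>, \<open>m c d z\<close> and \<open>u\<close> lies between \<open>z\<close> and \<open>p\<close> as well as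
  between \<open>z\<close> and \<open>q\<close>, so that it is \<open>z\<close>.
\<close>

lemma btw_join:
  assumes P: "p \<in> P" "q \<in> P" "c \<in> P" "d \<in> P" "u \<in> P" "z \<in> P"
    and p: "btw c p u" and q: "btw d q u" and z: "btw p z q"
  shows "btw (m c d z) z u"
proof -
  let ?e = "m c d z" let ?t = "m ?e z u"
  have e: "?e \<in> P" and t: "?t \<in> P" using P by auto
  have te: "btw z ?t ?e" and tu: "btw z ?t u" using P e t by (metis btw_med sym12 sym23)+
  have ec: "btw z ?e c" and ed: "btw z ?e d" using P e by (metis btw_med sym12 sym23)+
  have tp: "btw z ?t p'" if "btw c' p' u" "btw z ?e c'" "c' \<in> P" "p' \<in> P" for c' p'
  proof -
    have tc: "btw z ?t c'" using that P e t te by (metis btw_trans)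
    have "btw z ?t (m z c' u)" using that P t tc tu by (intro btw_meet)
    moreover have "btw z (m c' z u) p'" using that P by (intro btw_gate)
    moreover have "m c' z u = m z c' u" using that P by (metis sym12)
    ultimately show ?thesis using that P t btw_trans[of z ?t "m z c' u" p'] by auto
  qed
  have "btw z ?t (m z p q)" using P t tp[OF p ec] tp[OF q ed] by (intro btw_meet) auto
  then have "btw z ?t z" using P z by (metis btw_def sym12)
  then show ?thesis using P t unfolding btw_def by (metis idem sym23)
qed

text \<open>
  This identity keeps the complement of a maximal convex set convex: it expresses \<open>y\<close> through \<open>w\<close>,
  \<open>c\<close> and \<open>d\<close>, so \<open>y\<close> lies in every convex set that contains these three.
\<close>

lemma btw_meet_opposite:
  assumes P: "y \<in> P" "c \<in> P" "d \<in> P" "u \<in> P" "v \<in> P" "w \<in> P"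
    and y: "btw c y u" "btw d y v" and w: "btw u w v"
  shows "m y w (m c y d) = y"
proof -
  let ?e = "m c y d" let ?t = "m y w ?e"
  have e: "?e \<in> P" and t: "?t \<in> P" using P by auto
  have tw: "btw y ?t w" and te: "btw y ?t ?e" using P e t by (metis btw_med sym12 sym23)+
  have ec: "btw y ?e c" and ed: "btw y ?e d" using P e by (metis btw_med sym12 sym23)+
  have tc: "btw y ?t c" and td: "btw y ?t d" using P e t te ec ed by (metis btw_trans)+
  have "btw ?t y u" "btw ?t y v" using P t tc td y by (metis btw_shift btw_sym)+
  then show ?thesis using P t tw w by (intro btw_collapse[of ?t u v w y])
qed

definition median_convex where "median_convex C \<longleftrightarrow> C \<subseteq> P \<and> (\<forall>a\<in>C. \<forall>b\<in>C. \<forall>z\<in>P. m a z b \<in> C)"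

lemma median_convex_cone:
  assumes C: "median_convex C" and u: "u \<in> P"
  shows "median_convex {z \<in> P. \<exists>c\<in>C. btw c z u}"
  unfolding median_convex_def
proof (intro conjI ballI)
  fix p q z assume p: "p \<in> {z \<in> P. \<exists>c\<in>C. btw c z u}" and q: "q \<in> {z \<in> P. \<exists>c\<in>C. btw c z u}"
    and z: "z \<in> P"
  obtain c d where c: "c \<in> C" "btw c p u" and d: "d \<in> C" "btw d q u" using p q by auto
  have pq: "p \<in> P" "q \<in> P" using p q by auto
  have cd: "c \<in> P" "d \<in> P" using c d C by (auto simp: median_convex_def)
  let ?z = "m p z q"
  have z': "?z \<in> P" "btw p ?z q" using pq z by (auto intro: btw_med)
  have "m c d ?z \<in> C" using c d C cd z' unfolding median_convex_def by (metis sym23)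
  moreover have "btw (m c d ?z) ?z u" using pq cd z' u c d by (intro btw_join)
  ultimately show "?z \<in> {z \<in> P. \<exists>c\<in>C. btw c z u}" using z' by auto
qed auto

end

text \<open>
  A half-space is the preimage of \<open>True\<close> under a homomorphism to the two-element median algebra.
  The empty set and all of \<open>P\<close> are included; they never separate two points.
\<close>

definition halfspace :: "'b set \<Rightarrow> ('b \<Rightarrow> 'b \<Rightarrow> 'b \<Rightarrow> 'b) \<Rightarrow> 'b set \<Rightarrow> bool" where
  "halfspace P m H \<longleftrightarrow> H \<subseteq> P \<and>
     (\<forall>x\<in>P. \<forall>y\<in>P. \<forall>z\<in>P. m x y z \<in> H \<longleftrightarrow> majority (x \<in> H) (y \<in> H) (z \<in> H))"

lemma halfspaceD:
  "halfspace P m H \<Longrightarrow> x \<in> P \<Longrightarrow> y \<in> P \<Longrightarrow> z \<in> P \<Longrightarrow>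
   m x y z \<in> H \<longleftrightarrow> majority (x \<in> H) (y \<in> H) (z \<in> H)"
  by (auto simp: halfspace_def)

context four_point_algebra begin

text \<open>
  By Zorn's lemma there is a convex set \<open>M\<close> that is maximal among those containing \<open>x\<close> but not \<open>y\<close>.
  For \<open>u\<close> outside \<open>M\<close> the cone over \<open>M\<close> with apex \<open>u\<close> is convex and larger than \<open>M\<close>, so it contains
  \<open>y\<close>. If an interval with both ends outside \<open>M\<close> met \<open>M\<close>, this would push \<open>y\<close> into \<open>M\<close>. So the complement
  is convex as well, and \<open>M\<close> is a half-space.

  As a consequence, an identity between median expressions may be checked on truth values.
\<close>

theorem halfspace_separation:
  assumes x: "x \<in> P" and y: "y \<in> P" and xy: "x \<noteq> y"
  obtains H where "halfspace P m H" "x \<in> H" "y \<notin> H"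
proof -
  let ?A = "{C. median_convex C \<and> x \<in> C \<and> y \<notin> C}"
  have "\<exists>M\<in>?A. \<forall>X\<in>?A. M \<subseteq> X \<longrightarrow> X = M"
  proof (rule subset_Zorn_nonempty)
    have "m x z x = x" if "z \<in> P" for z using that x by (metis idem sym23)
    then have "{x} \<in> ?A" using x xy by (auto simp: median_convex_def)
    then show "?A \<noteq> {}" by blast
  next
    fix CC assume ne: "CC \<noteq> {}" and ch: "subset.chain ?A CC"
    have mem: "\<And>C. C \<in> CC \<Longrightarrow> median_convex C \<and> x \<in> C \<and> y \<notin> C"
      using ch by (auto simp: subset.chain_def)
    have "median_convex (\<Union>CC)" unfolding median_convex_def
    proof (intro conjI ballI)
      show "\<Union>CC \<subseteq> P" using mem unfolding median_convex_def by blast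
      fix a b z assume a: "a \<in> \<Union>CC" and b: "b \<in> \<Union>CC" and z: "z \<in> P"
      then obtain A B where AB: "A \<in> CC" "a \<in> A" "B \<in> CC" "b \<in> B" by auto
      then have "A \<subseteq> B \<or> B \<subseteq> A" using ch unfolding subset.chain_def by blast
      then obtain D where D: "D \<in> CC" "a \<in> D" "b \<in> D" using AB by blast
      then have "m a z b \<in> D" using mem z by (auto simp: median_convex_def)
      then show "m a z b \<in> \<Union>CC" using D by auto
    qed
    then show "\<Union>CC \<in> ?A" using ne mem by auto
  qed
  then obtain M where M: "median_convex M" "x \<in> M" "y \<notin> M"
    and max: "\<And>C. median_convex C \<Longrightarrow> x \<in> C \<Longrightarrow> y \<notin> C \<Longrightarrow> M \<subseteq> C \<Longrightarrow> C = M" by blast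
  have MP: "M \<subseteq> P" using M(1) by (auto simp: median_convex_def)
  \<comment> \<open>by maximality the cone over \<open>M\<close> with any apex outside \<open>M\<close> reaches \<open>y\<close>\<close>
  have reach: "\<exists>c\<in>M. btw c y u" if u: "u \<in> P" "u \<notin> M" for u
  proof (rule ccontr)
    assume no: "\<not> ?thesis"
    let ?C = "{z \<in> P. \<exists>c\<in>M. btw c z u}"
    have bs: "btw c c u" "btw c u u" if "c \<in> M" for c
      using that u MP by (metis btw_def idem sym12 sym23 subsetD)+
    have "?C = M"
    proof (rule max)
      show "median_convex ?C" using M u by (intro median_convex_cone)
      show "x \<in> ?C" using bs M x by auto
      show "y \<notin> ?C" using no by auto
      show "M \<subseteq> ?C" using bs MP by auto
    qed
    moreover have "u \<in> ?C" using bs M u by auto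
    ultimately show False using u by auto
  qed
  have co: "m u z v \<notin> M" if uv: "u \<in> P" "v \<in> P" "z \<in> P" "u \<notin> M" "v \<notin> M" for u v z
  proof
    let ?w = "m u z v"
    assume wM: "?w \<in> M"
    obtain c where c: "c \<in> M" "btw c y u" using reach uv by auto
    obtain d where d: "d \<in> M" "btw d y v" using reach uv by auto
    have cd: "c \<in> P" "d \<in> P" using c d MP by auto
    have w: "?w \<in> P" "btw u ?w v" using uv by (auto intro: btw_med)
    have e: "m c y d \<in> M" using M c d y by (auto simp: median_convex_def)
    have "m y ?w (m c y d) = y" using c d cd w uv y by (intro btw_meet_opposite)
    then have "m ?w y (m c y d) = y" using w y cd e MP by (metis sym12 subsetD)
    moreover have "m ?w y (m c y d) \<in> M" using M(1) wM e y by (auto simp: median_convex_def)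
    ultimately show False using M by simp
  qed
  have "halfspace P m M" unfolding halfspace_def
  proof (intro conjI ballI MP)
    fix a b c assume P: "a \<in> P" "b \<in> P" "c \<in> P"
    have eq: "m a b c = m a c b" "m a b c = m b a c" using P by (metis sym12 sym23)+
    have in_M: "\<And>p q z. p \<in> M \<Longrightarrow> q \<in> M \<Longrightarrow> z \<in> P \<Longrightarrow> m p z q \<in> M"
      using M by (auto simp: median_convex_def)
    have "m a b c \<in> M" if "a \<in> M \<and> c \<in> M \<or> a \<in> M \<and> b \<in> M \<or> b \<in> M \<and> c \<in> M"
      using that in_M[of a c b] in_M[of a b c] in_M[of b c a] P eq by auto
    moreover have "m a b c \<notin> M" if "a \<notin> M \<and> c \<notin> M \<or> a \<notin> M \<and> b \<notin> M \<or> b \<notin> M \<and> c \<notin> M"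
      using that co[of a c b] co[of a b c] co[of b c a] P eq by auto
    ultimately show "m a b c \<in> M \<longleftrightarrow> majority (a \<in> M) (b \<in> M) (c \<in> M)"
      unfolding majority_def by blast
  qed
  then show thesis using that M by blast
qed

corollary halfspace_ext:
  assumes "x \<in> P" "y \<in> P" "\<And>H. halfspace P m H \<Longrightarrow> x \<in> H \<longleftrightarrow> y \<in> H"
  shows "x = y"
  using assms halfspace_separation by metis

end

sublocale median_algebra \<subseteq> four_point_algebra
proof
  fix a b c d assume P: "a \<in> P" "b \<in> P" "c \<in> P" "d \<in> P"
  have "m a b (m c b d) = m (m a b c) (m a b b) d" using P by (intro M3)
  also have "m a b b = b" using P M1 M2 by metis
  finally show "m (m a b c) b d = m a b (m c b d)" by simp
qed (use closed M1 M2 in blast)+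

section \<open>Joins, quotients and cubes\<close>

text \<open>
  The join of the \<open>y j\<close> in the interval from \<open>a\<close> to \<open>b\<close>, ordered from \<open>a\<close>. It is described by the
  half-spaces separating it from \<open>a\<close>, which determine it and are what the later arguments evaluate.
\<close>

definition is_join where
  "is_join P m a b J y v \<longleftrightarrow> v \<in> P \<and> (\<forall>H. halfspace P m H \<longrightarrow>
    ((v \<in> H) \<noteq> (a \<in> H) \<longleftrightarrow> (a \<in> H) \<noteq> (b \<in> H) \<and> (\<exists>j\<in>J. (y j \<in> H) \<noteq> (a \<in> H))))"

lemma is_joinD:
  assumes "is_join P m a b J y v"
  shows "v \<in> P"
    and "halfspace P m H \<Longrightarrow>
    (v \<in> H) \<noteq> (a \<in> H) \<longleftrightarrow> (a \<in> H) \<noteq> (b \<in> H) \<and> (\<exists>j\<in>J. (y j \<in> H) \<noteq> (a \<in> H))"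
  using assms unfolding is_join_def by simp_all

text \<open>
  The join of all pairwise meets of the \<open>x i\<close>. Relative to it the \<open>x i\<close> become pairwise disjoint, and
  pairwise disjoint elements of an interval span a cube.
\<close>

definition is_overlap where
  "is_overlap P m a b J x c \<longleftrightarrow> c \<in> P \<and> (\<forall>H. halfspace P m H \<longrightarrow>
    ((c \<in> H) \<noteq> (a \<in> H) \<longleftrightarrow> (a \<in> H) \<noteq> (b \<in> H) \<and>
       (\<exists>i\<in>J. \<exists>j\<in>J. i \<noteq> j \<and> (x i \<in> H) \<noteq> (a \<in> H) \<and> (x j \<in> H) \<noteq> (a \<in> H))))"

lemma is_overlapD:
  assumes "is_overlap P m a b J x c"
  shows "c \<in> P"
    and "halfspace P m H \<Longrightarrow> (c \<in> H) \<noteq> (a \<in> H) \<longleftrightarrow> (a \<in> H) \<noteq> (b \<in> H) \<and>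
       (\<exists>i\<in>J. \<exists>j\<in>J. i \<noteq> j \<and> (x i \<in> H) \<noteq> (a \<in> H) \<and> (x j \<in> H) \<noteq> (a \<in> H))"
  using assms unfolding is_overlap_def by simp_all

context four_point_algebra begin

lemma join_exists:
  assumes ab: "a \<in> P" "b \<in> P" and "finite J" and "y ` J \<subseteq> P"
  shows "\<exists>v. is_join P m a b J y v"
  using assms(3,4)
proof (induction J rule: finite_induct)
  case empty
  then show ?case using ab by (auto simp: is_join_def)
next
  case (insert j J)
  then obtain v where "is_join P m a b J y v" by auto
  note v = is_joinD[OF this]
  have yj: "y j \<in> P" using insert by auto
  have "m v (y j) b \<in> P" using v yj ab by auto
  moreover have "(m v (y j) b \<in> H) \<noteq> (a \<in> H) \<longleftrightarrow>
      (a \<in> H) \<noteq> (b \<in> H) \<and> (\<exists>j\<in>insert j J. (y j \<in> H) \<noteq> (a \<in> H))" if "halfspace P m H" for H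
    using v(2)[OF that] halfspaceD[OF that v(1) yj ab(2)] by (auto simp: majority_def)
  ultimately show ?case unfolding is_join_def by blast
qed

lemma overlap_exists:
  assumes ab: "a \<in> P" "b \<in> P" and J: "finite J" and x: "x ` J \<subseteq> P"
  shows "\<exists>c. is_overlap P m a b J x c"
proof -
  let ?J = "{(i,j). i \<in> J \<and> j \<in> J \<and> i \<noteq> j}"
  let ?y = "\<lambda>(i,j). m (x i) a (x j)"
  have "finite ?J" by (rule finite_subset[of _ "J \<times> J"]) (use J in auto)
  moreover have "?y ` ?J \<subseteq> P" using x ab by auto
  ultimately obtain c where "is_join P m a b ?J ?y c" using join_exists[OF ab] by blast
  note c = is_joinD[OF this]
  have "(\<exists>p\<in>?J. (?y p \<in> H) \<noteq> (a \<in> H)) \<longleftrightarrow>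
    (\<exists>i\<in>J. \<exists>j\<in>J. i \<noteq> j \<and> (x i \<in> H) \<noteq> (a \<in> H) \<and> (x j \<in> H) \<noteq> (a \<in> H))"
    if H: "halfspace P m H" for H
  proof -
    have "(m (x i) a (x j) \<in> H) \<noteq> (a \<in> H) \<longleftrightarrow> (x i \<in> H) \<noteq> (a \<in> H) \<and> (x j \<in> H) \<noteq> (a \<in> H)"
      if "i \<in> J" "j \<in> J" for i j
      using halfspaceD[OF H, of "x i" a "x j"] that x ab by (auto simp: majority_def)
    then show ?thesis by auto
  qed
  then show ?thesis using c by (intro exI[of _ c]) (simp add: is_overlap_def)
qed

lemma is_median_algebra: "median_algebra P m"
proof
  fix a b c d e assume P: "a \<in> P" "b \<in> P" "c \<in> P" "d \<in> P" "e \<in> P"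
  show "m a b (m c d e) = m (m a b c) (m a b d) e"
  proof (rule halfspace_ext)
    fix H assume H: "halfspace P m H"
    show "m a b (m c d e) \<in> H \<longleftrightarrow> m (m a b c) (m a b d) e \<in> H"
      using P by (simp add: halfspaceD[OF H] cl) (auto simp: majority_def)
  qed (use P in auto)
next
  fix a b c assume P: "a \<in> P" "b \<in> P" "c \<in> P"
  show "m a c b = m a b c \<and> m b a c = m a b c \<and> m b c a = m a b c \<and> m c a b = m a b c \<and> m c b a = m a b c"
    using P sym12 sym23 by metis
qed (use idem cl in auto)

end

text \<open>
  Quotients by a congruence are realised on a set of representatives, with \<open>r\<close> choosing the
  representative of a class. The laws are needed only up to the congruence.
\<close>

lemma four_point_algebra_quotient:
  assumes cl: "\<And>a b c. a \<in> P \<Longrightarrow> b \<in> P \<Longrightarrow> c \<in> P \<Longrightarrow> m a b c \<in> P"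
    and rP: "\<And>a. a \<in> P \<Longrightarrow> r a \<in> P"
    and rr: "\<And>a. a \<in> P \<Longrightarrow> r (r a) = r a"
    and cong: "\<And>a b c. a \<in> P \<Longrightarrow> b \<in> P \<Longrightarrow> c \<in> P \<Longrightarrow> r (m (r a) b c) = r (m a b c)"
    and idem: "\<And>a b. a \<in> P \<Longrightarrow> b \<in> P \<Longrightarrow> r (m a a b) = r a"
    and s12: "\<And>a b c. a \<in> P \<Longrightarrow> b \<in> P \<Longrightarrow> c \<in> P \<Longrightarrow> r (m a b c) = r (m b a c)"
    and s23: "\<And>a b c. a \<in> P \<Longrightarrow> b \<in> P \<Longrightarrow> c \<in> P \<Longrightarrow> r (m a b c) = r (m a c b)"
    and four: "\<And>a b c d. a \<in> P \<Longrightarrow> b \<in> P \<Longrightarrow> c \<in> P \<Longrightarrow> d \<in> P \<Longrightarrow>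
       r (m (m a b c) b d) = r (m a b (m c b d))"
  shows "four_point_algebra (r ` P) (\<lambda>a b c. r (m a b c))"
proof
  have PP: "a \<in> P" "r a = a" if "a \<in> r ` P" for a using that rP rr by auto
  fix a b c d assume A: "a \<in> r ` P" and B: "b \<in> r ` P"
  note ab = PP[OF A] PP[OF B]
  show "r (m a a b) = a" using idem ab by auto
  assume C: "c \<in> r ` P"
  note abc = ab PP[OF C]
  show "r (m a b c) \<in> r ` P" using abc cl by auto
  show "r (m a b c) = r (m b a c)" "r (m a b c) = r (m a c b)" using abc s12 s23 by auto
  assume D: "d \<in> r ` P"
  note abcd = abc PP[OF D]
  have "r (m a b (r (m c b d))) = r (m (r (m c b d)) a b)" using abcd rP cl s12 s23 by metis
  also have "\<dots> = r (m (m c b d) a b)" using abcd cl cong by auto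
  also have "\<dots> = r (m a b (m c b d))" using abcd cl s12 s23 by metis
  finally show "r (m (r (m a b c)) b d) = r (m a b (r (m c b d)))"
    using abcd cl four cong by auto
qed

text \<open>
  Half-spaces between \<open>a\<close> and \<open>b\<close> none of which contains another are pairwise transverse, and \<open>k\<close>
  pairwise transverse walls span a \<open>k\<close>-cube. Meets of points of \<open>H i\<close> outside the \<open>H j\<close> give points
  \<open>x i\<close> lying in \<open>H i\<close> only; joining them to their overlap \<open>c\<close> makes them disjoint over \<open>c\<close>, and the
  vertex \<open>\<sigma>\<close> of the cube is the join of \<open>c\<close> and the \<open>x i\<close> with \<open>\<sigma> i\<close>.
\<close>

lemma rank_ge_of_crossing:
  assumes "median_algebra P m" and ab: "a \<in> P" "b \<in> P"
    and H: "\<And>i. i < k \<Longrightarrow> halfspace P m (H i) \<and> a \<notin> H i \<and> b \<in> H i"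
    and cross: "\<And>i j. i < k \<Longrightarrow> j < k \<Longrightarrow> i \<noteq> j \<Longrightarrow> \<not> H i \<subseteq> H j"
  shows "enat k \<le> median_rank P m"
proof -
  interpret median_algebra P m by fact
  have HP: "H i \<subseteq> P" if "i < k" for i using H[OF that] by (auto simp: halfspace_def)
  have "\<forall>i j. \<exists>z. i < k \<and> j < k \<and> i \<noteq> j \<longrightarrow> z \<in> H i \<and> z \<notin> H j" using cross by blast
  then obtain z where z: "\<And>i j. i < k \<Longrightarrow> j < k \<Longrightarrow> i \<noteq> j \<Longrightarrow> z i j \<in> H i \<and> z i j \<notin> H j"
    by metis
  have "\<exists>x. is_join P m b a ({..<k}-{i}) (z i) x" if i: "i < k" for i
  proof (rule join_exists)
    show "z i ` ({..<k}-{i}) \<subseteq> P" using i z HP by fastforce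
  qed (use ab in auto)
  then obtain x where xj: "\<And>i. i < k \<Longrightarrow> is_join P m b a ({..<k}-{i}) (z i) (x i)" by metis
  note xP = is_joinD(1)[OF xj] and x = is_joinD(2)[OF xj]
  have xH: "x i \<in> H j \<longleftrightarrow> i = j" if ij: "i < k" "j < k" for i j
  proof -
    have "(x i \<in> H j) \<noteq> (b \<in> H j) \<longleftrightarrow> (\<exists>l\<in>{..<k}-{i}. z i l \<notin> H j)"
      using x[OF ij(1), of "H j"] H[OF ij(2)] by simp
    moreover have "(\<exists>l\<in>{..<k}-{i}. z i l \<notin> H j) \<longleftrightarrow> i \<noteq> j"
      using z[OF ij(1)] ij by (metis DiffE DiffI lessThan_iff singletonD singletonI)
    ultimately show ?thesis using H[OF ij(2)] by simp
  qed
  have xP': "x ` {..<k} \<subseteq> P" using xP by auto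
  obtain c where "is_overlap P m a b {..<k} x c" using overlap_exists[OF ab _ xP'] by blast
  note cP = is_overlapD(1)[OF this] and c = is_overlapD(2)[OF this]
  define y where "y \<sigma> j = (if j < k then (if \<sigma> j then x j else a) else c)" for \<sigma> and j :: nat
  have "y \<sigma> ` {..k} \<subseteq> P" for \<sigma> using xP ab cP by (auto simp: y_def)
  then have "\<exists>v. is_join P m a b {..k} (y \<sigma>) v" for \<sigma> using join_exists[OF ab, of "{..k}" "y \<sigma>"] by simp
  then obtain f where fj: "\<And>\<sigma>. is_join P m a b {..k} (y \<sigma>) (f \<sigma>)" by metis
  note fP = is_joinD(1)[OF fj]
  have f: "(f \<sigma> \<in> H) \<noteq> (a \<in> H) \<longleftrightarrow>
     (a \<in> H) \<noteq> (b \<in> H) \<and> ((c \<in> H) \<noteq> (a \<in> H) \<or> (\<exists>i<k. \<sigma> i \<and> (x i \<in> H) \<noteq> (a \<in> H)))"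
    if "halfspace P m H" for \<sigma> H
  proof -
    have "(\<exists>j\<in>{..k}. (y \<sigma> j \<in> H) \<noteq> (a \<in> H)) \<longleftrightarrow>
      (c \<in> H) \<noteq> (a \<in> H) \<or> (\<exists>i<k. \<sigma> i \<and> (x i \<in> H) \<noteq> (a \<in> H))"
      unfolding lessThan_Suc_atMost[symmetric] lessThan_Suc y_def by auto
    then show ?thesis using is_joinD(2)[OF fj that] by simp
  qed
  have hom: "f (cube_median k \<sigma> \<tau> \<rho>) = m (f \<sigma>) (f \<tau>) (f \<rho>)" for \<sigma> \<tau> \<rho>
  proof (rule halfspace_ext)
    fix U assume U: "halfspace P m U"
    have *: "m (f \<sigma>) (f \<tau>) (f \<rho>) \<in> U \<longleftrightarrow> majority (f \<sigma> \<in> U) (f \<tau> \<in> U) (f \<rho> \<in> U)"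
      using halfspaceD[OF U fP fP fP] .
    have memb: "f \<upsilon> \<in> U \<longleftrightarrow> ((a \<in> U) \<noteq> ((a \<in> U) \<noteq> (b \<in> U) \<and> ((c \<in> U) \<noteq> (a \<in> U) \<or> (\<exists>i<k. \<upsilon> i \<and> (x i \<in> U) \<noteq> (a \<in> U)))))" for \<upsilon>
      using f[OF U, of \<upsilon>] by blast
    show "f (cube_median k \<sigma> \<tau> \<rho>) \<in> U \<longleftrightarrow> m (f \<sigma>) (f \<tau>) (f \<rho>) \<in> U"
    proof (cases "(a \<in> U) \<noteq> (b \<in> U) \<and> (c \<in> U) = (a \<in> U)")
      case True
      have uniq: "i = j" if "i < k" "j < k" "(x i \<in> U) \<noteq> (a \<in> U)" "(x j \<in> U) \<noteq> (a \<in> U)" for i j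
        using c[OF U] that True by blast
      show ?thesis
      proof (cases "\<exists>i<k. (x i \<in> U) \<noteq> (a \<in> U)")
        case ex: True
        then obtain i where i: "i < k" "(x i \<in> U) \<noteq> (a \<in> U)" by blast
        have "(\<exists>j<k. \<upsilon> j \<and> (x j \<in> U) \<noteq> (a \<in> U)) \<longleftrightarrow> \<upsilon> i" for \<upsilon> using i uniq by blast
        then have "f \<upsilon> \<in> U \<longleftrightarrow> ((a \<in> U) \<noteq> \<upsilon> i)" for \<upsilon> using memb True by simp
        then show ?thesis using * i by (auto simp: cube_median_def majority_def)
      next
        case nex: False
        then have "f \<upsilon> \<in> U \<longleftrightarrow> a \<in> U" for \<upsilon> using memb[of \<upsilon>] True by auto
        then show ?thesis using * by (auto simp: majority_def)
      qed
    next
      case False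
      then have "f \<upsilon> \<in> U \<longleftrightarrow> b \<in> U" for \<upsilon> using memb[of \<upsilon>] by auto
      then show ?thesis using * by (auto simp: majority_def)
    qed
  qed (use fP in auto)
  have cH: "c \<notin> H i" if i: "i < k" for i
  proof -
    have "\<not> (\<exists>p\<in>{..<k}. \<exists>q\<in>{..<k}. p \<noteq> q \<and> (x p \<in> H i) \<noteq> (a \<in> H i) \<and> (x q \<in> H i) \<noteq> (a \<in> H i))"
      using H[OF i] xH[OF _ i] by blast
    then show ?thesis using c[of "H i"] H[OF i] by blast
  qed
  have fH: "f \<sigma> \<in> H i \<longleftrightarrow> \<sigma> i" if i: "i < k" for \<sigma> i
  proof -
    have "(\<exists>j<k. \<sigma> j \<and> (x j \<in> H i) \<noteq> (a \<in> H i)) \<longleftrightarrow> \<sigma> i"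
      using H[OF i] xH[OF _ i] i by blast
    then show ?thesis using f[of "H i" \<sigma>] H[OF i] cH[OF i] by blast
  qed
  have inj: "inj_on f (median_cube k)"
  proof (rule inj_onI)
    fix \<sigma> \<tau> assume st: "\<sigma> \<in> median_cube k" "\<tau> \<in> median_cube k" "f \<sigma> = f \<tau>"
    then have "\<sigma> i = \<tau> i" if "i < k" for i using fH[OF that] by metis
    then show "\<sigma> = \<tau>" using st unfolding median_cube_def by (intro PiE_ext) auto
  qed
  have clc: "cube_median k \<sigma> \<tau> \<rho> \<in> median_cube k" for \<sigma> \<tau> \<rho>
    by (auto simp: cube_median_def median_cube_def)
  have "median_subalgebra (f ` median_cube k) P m"
    unfolding median_subalgebra_def using fP hom[symmetric] clc by auto
  moreover have "median_iso f (median_cube k) (cube_median k) (f ` median_cube k) m"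
    unfolding median_iso_def using inj hom by (auto simp: bij_betw_def)
  ultimately show ?thesis unfolding median_rank_def by (intro Sup_upper) blast
qed

text \<open>
  Let \<open>r\<close> be the quotient that only remembers the half-spaces in \<open>W\<close>. A cube in the quotient need
  not lift to a cube, but its lowest corner \<open>a\<close>, the neighbours \<open>e i\<close> of that corner and the opposite corner
  \<open>b\<close> do lift with the median relations between them: take arbitrary lifts and join them to their
  overlap. Only this corner of the cube is needed below.
\<close>

lemma cube_lift:
  assumes "median_algebra P m"
    and W: "\<And>H. H \<in> W \<Longrightarrow> halfspace P m H"
    and rP: "\<And>x. x \<in> P \<Longrightarrow> r x \<in> P"
    and r_iff: "\<And>x y. x \<in> P \<Longrightarrow> y \<in> P \<Longrightarrow> r x = r y \<longleftrightarrow> (\<forall>H\<in>W. x \<in> H \<longleftrightarrow> y \<in> H)"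
    and rr: "\<And>x. x \<in> P \<Longrightarrow> r (r x) = r x"
    and rank: "\<not> median_rank (r ` P) (\<lambda>x y z. r (m x y z)) \<le> enat n"
  shows "\<exists>a b e. a \<in> P \<and> b \<in> P \<and> (\<forall>i\<le>n. e i \<in> P \<and> m a (e i) b = e i) \<and>
    (\<forall>i\<le>n. \<forall>j\<le>n. i \<noteq> j \<longrightarrow> m (e i) a (e j) = a) \<and>
    (\<forall>i\<le>n. \<exists>H\<in>W. (a \<in> H) \<noteq> (e i \<in> H))"
proof -
  interpret median_algebra P m by fact
  let ?m = "\<lambda>x y z. r (m x y z)"
  obtain k S f where k: "k > n" and S: "median_subalgebra S (r ` P) ?m"
    and f: "median_iso f (median_cube k) (cube_median k) S ?m"
    using rank unfolding median_rank_def Sup_le_iff by (auto simp: not_le)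
  have SP: "s \<in> P" "r s = s" if "s \<in> S" for s
    using that S rr rP by (auto simp: median_subalgebra_def)
  have fS: "f \<sigma> \<in> S" if "\<sigma> \<in> median_cube k" for \<sigma>
    using f that by (auto simp: median_iso_def bij_betw_def)
  define o0 where "o0 = (\<lambda>i\<in>{..<k}. False)"
  define o1 where "o1 = (\<lambda>i\<in>{..<k}. True)"
  define u where "u j = (\<lambda>i\<in>{..<k}. i = j)" for j
  have mem: "o0 \<in> median_cube k" "o1 \<in> median_cube k" "u j \<in> median_cube k" for j
    by (auto simp: o0_def o1_def u_def median_cube_def)
  have H3: "f (cube_median k \<sigma> \<tau> \<rho>) \<in> H \<longleftrightarrow> majority (f \<sigma> \<in> H) (f \<tau> \<in> H) (f \<rho> \<in> H)"
    if H: "H \<in> W" and c: "\<sigma> \<in> median_cube k" "\<tau> \<in> median_cube k" "\<rho> \<in> median_cube k" for H \<sigma> \<tau> \<rho>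
  proof -
    have P: "f \<sigma> \<in> P" "f \<tau> \<in> P" "f \<rho> \<in> P" using c fS SP by auto
    have mP: "m (f \<sigma>) (f \<tau>) (f \<rho>) \<in> P" using P by auto
    have "f (cube_median k \<sigma> \<tau> \<rho>) = r (m (f \<sigma>) (f \<tau>) (f \<rho>))" using f c by (simp add: median_iso_def)
    moreover have "r (m (f \<sigma>) (f \<tau>) (f \<rho>)) \<in> H \<longleftrightarrow> m (f \<sigma>) (f \<tau>) (f \<rho>) \<in> H"
      using r_iff[of "r (m (f \<sigma>) (f \<tau>) (f \<rho>))" "m (f \<sigma>) (f \<tau>) (f \<rho>)"] rr[OF mP] rP[OF mP] mP H by auto
    ultimately show ?thesis using halfspaceD[OF W[OF H] P] by simp
  qed
  let ?ta = "f o0" and ?tb = "f o1" and ?tu = "\<lambda>i. f (u i)"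
  have tP: "?ta \<in> P" "?tb \<in> P" "?tu i \<in> P" for i :: nat using mem fS SP by auto
  have "\<exists>H\<in>W. (?tu i \<in> H) \<noteq> (?ta \<in> H)" if i: "i < k" for i
  proof (rule ccontr)
    assume "\<not> ?thesis"
    then have "?tu i = ?ta" using r_iff[of "?tu i" ?ta] SP(2)[OF fS] mem tP by auto
    then have "u i = o0" using f mem by (auto simp: median_iso_def bij_betw_def dest: inj_onD)
    then have "u i i = o0 i" by simp
    then show False using i by (auto simp: u_def o0_def)
  qed
  then obtain H where HW: "\<And>i. i < k \<Longrightarrow> H i \<in> W" and H: "\<And>i. i < k \<Longrightarrow> (?tu i \<in> H i) \<noteq> (?ta \<in> H i)"
    by metis
  \<comment> \<open>On the cube the half-space \<open>H i\<close>, which separates \<open>o0\<close> from \<open>u i\<close>, is the \<open>i\<close>-th coordinate up to complement.\<close>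
  have Hj: "(?tu j \<in> H i) = (?ta \<in> H i)" if ij: "i < k" "j < k" "i \<noteq> j" for i j
  proof -
    have "cube_median k (u i) o0 (u j) = o0" using ij
      by (auto simp: cube_median_def u_def o0_def majority_def fun_eq_iff)
    then have "?ta \<in> H i \<longleftrightarrow> majority (?tu i \<in> H i) (?ta \<in> H i) (?tu j \<in> H i)"
      using H3[OF HW[OF ij(1)] mem(3) mem(1) mem(3), of i j] by simp
    then show ?thesis using H[OF ij(1)] by (auto simp: majority_def)
  qed
  have H1: "(?tb \<in> H i) \<noteq> (?ta \<in> H i)" if i: "i < k" for i
  proof -
    have "cube_median k o0 (u i) o1 = u i" using i
      by (auto simp: cube_median_def u_def o0_def o1_def majority_def fun_eq_iff)
    then have "?tu i \<in> H i \<longleftrightarrow> majority (?ta \<in> H i) (?tu i \<in> H i) (?tb \<in> H i)"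
      using H3[OF HW[OF i] mem(1) mem(3) mem(2), of i] by simp
    then show ?thesis using H[OF i] by (auto simp: majority_def)
  qed
  have tP': "?tu ` {..n} \<subseteq> P" using tP by auto
  obtain c where "is_overlap P m ?ta ?tb {..n} ?tu c" using overlap_exists[OF tP(1,2) _ tP'] by blast
  note cP = is_overlapD(1)[OF this] and c = is_overlapD(2)[OF this]
  have "\<exists>v. is_join P m ?ta ?tb {False, True} (\<lambda>b. if b then ?tu i else c) v" for i
    by (rule join_exists) (use tP cP in auto)
  then obtain e where ej: "\<And>i. is_join P m ?ta ?tb {False, True} (\<lambda>b. if b then ?tu i else c) (e i)" by metis
  note eP = is_joinD(1)[OF ej]
  have e: "(e i \<in> H) \<noteq> (?ta \<in> H) \<longleftrightarrow>
     (?ta \<in> H) \<noteq> (?tb \<in> H) \<and> ((?tu i \<in> H) \<noteq> (?ta \<in> H) \<or> (c \<in> H) \<noteq> (?ta \<in> H))"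
    if "halfspace P m H" for i H
    using is_joinD(2)[OF ej that, of i] by auto
  have "m c (e i) ?tb = e i" for i
  proof (rule halfspace_ext)
    fix U assume U: "halfspace P m U"
    show "m c (e i) ?tb \<in> U \<longleftrightarrow> e i \<in> U"
      using halfspaceD[OF U cP eP tP(2)] e[OF U, of i] c[OF U] unfolding majority_def by blast
  qed (use cP eP tP in auto)
  moreover have "m (e i) c (e j) = c" if ij: "i \<le> n" "j \<le> n" "i \<noteq> j" for i j
  proof (rule halfspace_ext)
    fix U assume U: "halfspace P m U"
    show "m (e i) c (e j) \<in> U \<longleftrightarrow> c \<in> U"
    proof (cases "(c \<in> U) \<noteq> (?ta \<in> U)")
      case True
      then have "(e i \<in> U) \<noteq> (?ta \<in> U)" using e[OF U, of i] c[OF U] by blast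
      then show ?thesis using halfspaceD[OF U eP cP eP] True unfolding majority_def by blast
    next
      case False
      have ij': "i \<in> {..n}" "j \<in> {..n}" using ij by auto
      then have "(e i \<in> U) = (?ta \<in> U) \<or> (e j \<in> U) = (?ta \<in> U)"
        using False e[OF U, of i] e[OF U, of j] c[OF U] ij(3) by metis
      then show ?thesis using halfspaceD[OF U eP cP eP] False unfolding majority_def by blast
    qed
  qed (use cP eP tP in auto)
  moreover have "\<exists>U\<in>W. (c \<in> U) \<noteq> (e i \<in> U)" if i: "i \<le> n" for i
  proof -
    have ik: "i < k" using i k by simp
    have "\<not> (\<exists>p\<in>{..n}. \<exists>q\<in>{..n}. p \<noteq> q \<and> (?tu p \<in> H i) \<noteq> (?ta \<in> H i) \<and> (?tu q \<in> H i) \<noteq> (?ta \<in> H i))"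
      using Hj[OF ik] k by (metis atMost_iff le_less_trans)
    then have "(c \<in> H i) = (?ta \<in> H i)" using c[OF W[OF HW[OF ik]]] by blast
    moreover have "(e i \<in> H i) \<noteq> (?ta \<in> H i)" using e[OF W[OF HW[OF ik]], of i] H[OF ik] H1[OF ik] by blast
    ultimately show ?thesis using HW[OF ik] by blast
  qed
  ultimately show ?thesis using cP eP tP by (intro exI[of _ c] exI[of _ ?tb] exI[of _ e]) auto
qed

section \<open>Coarse identities\<close>

text \<open>
  A coarse median with its constants fixed. Enlarging the Lipschitz factor to \<open>K \<ge> 1\<close> costs nothing and
  lets error terms be absorbed.
\<close>

locale coarse_constants =
  fixes \<mu> :: "'a::metric_space \<Rightarrow> 'a \<Rightarrow> 'a \<Rightarrow> 'a" and K H \<kappa> :: real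
  assumes K: "K \<ge> 1" and H: "H \<ge> 0" and \<kappa>: "\<kappa> \<ge> 0"
    and mu_idem: "\<mu> a a b = a"
    and mu12: "\<mu> a b c = \<mu> b a c" and mu23: "\<mu> a b c = \<mu> a c b"
    and lip: "dist (\<mu> a b c) (\<mu> a' b c) \<le> K * dist a a' + H"
    and four: "dist (\<mu> (\<mu> a b c) b d) (\<mu> a b (\<mu> c b d)) \<le> \<kappa>"

lemma coarse_median_space_constants:
  fixes \<mu> :: "'a::metric_space \<Rightarrow> 'a \<Rightarrow> 'a \<Rightarrow> 'a"
  assumes "coarse_median_space \<mu>"
  obtains K H \<kappa> where "coarse_constants \<mu> K H \<kappa>"
proof -
  interpret coarse_median_space \<mu> by fact
  obtain K H where KH: "\<forall>t\<ge>0::real. 0 \<le> K * t + H"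
    "\<And>a a' b c. dist (\<mu> a b c) (\<mu> a' b c) \<le> K * dist a a' + H" using C1 by blast
  obtain \<kappa> where k: "\<kappa> > 0" "\<And>a b c d. dist (\<mu> (\<mu> a b c) b d) (\<mu> a b (\<mu> c b d)) \<le> \<kappa>"
    using C2 by blast
  have H: "H \<ge> 0" using KH(1) by (metis mult_zero_right add_0 order_refl)
  have "coarse_constants \<mu> (max K 1) H \<kappa>"
  proof
    fix a b c a' :: 'a
    have "K * dist a a' \<le> max K 1 * dist a a'" by (intro mult_right_mono) auto
    then show "dist (\<mu> a b c) (\<mu> a' b c) \<le> max K 1 * dist a a' + H"
      using KH(2)[of a b c a'] by linarith
    show "\<mu> a b c = \<mu> b a c" "\<mu> a b c = \<mu> a c b" using M2 by metis+
  qed (use H k M1 in auto)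
  then show thesis by (rule that)
qed

text \<open>
  Two families of points, indexed by configurations in \<open>S\<close>, are identified when their distance is
  bounded uniformly over \<open>S\<close>. Working with families replaces the bookkeeping of constants.
\<close>

definition near :: "'i set \<Rightarrow> ('i \<Rightarrow> 'a::metric_space) \<Rightarrow> ('i \<Rightarrow> 'a) \<Rightarrow> bool" where
  "near S x y \<longleftrightarrow> (\<exists>C. \<forall>i\<in>S. dist (x i) (y i) \<le> C)"

lemma nearI: "(\<And>i. i \<in> S \<Longrightarrow> dist (x i) (y i) \<le> C) \<Longrightarrow> near S x y"
  by (auto simp: near_def)

lemma near_refl: "near S x x"
  by (rule nearI[of _ _ _ 0]) simp

lemma near_sym: "near S x y \<Longrightarrow> near S y x"
  by (simp add: near_def dist_commute)

lemma near_trans: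
  assumes "near S x y" "near S y z" shows "near S x z"
proof -
  obtain C D where C: "\<forall>i\<in>S. dist (x i) (y i) \<le> C" and D: "\<forall>i\<in>S. dist (y i) (z i) \<le> D"
    using assms unfolding near_def by blast
  show ?thesis
  proof (rule nearI[of _ _ _ "C + D"])
    fix i assume "i \<in> S"
    then show "dist (x i) (z i) \<le> C + D"
      using C D dist_triangle[of "x i" "z i" "y i"] by fastforce
  qed
qed

context coarse_constants begin

lemma lip3: "dist (\<mu> a b c) (\<mu> a' b' c') \<le> K * (dist a a' + dist b b' + dist c c') + 3 * H"
proof -
  have 1: "dist (\<mu> a b c) (\<mu> a' b c) \<le> K * dist a a' + H" by (rule lip)
  have 2: "dist (\<mu> a' b c) (\<mu> a' b' c) \<le> K * dist b b' + H" by (metis lip mu12)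
  have 3: "dist (\<mu> a' b' c) (\<mu> a' b' c') \<le> K * dist c c' + H" by (metis lip mu12 mu23)
  have "dist (\<mu> a b c) (\<mu> a' b' c') \<le> dist (\<mu> a b c) (\<mu> a' b c) + dist (\<mu> a' b c) (\<mu> a' b' c')"
    by (rule dist_triangle)
  moreover have "dist (\<mu> a' b c) (\<mu> a' b' c') \<le> dist (\<mu> a' b c) (\<mu> a' b' c) + dist (\<mu> a' b' c) (\<mu> a' b' c')"
    by (rule dist_triangle)
  ultimately show ?thesis using 1 2 3 by (simp add: distrib_left)
qed

lemma near_cong:
  assumes "near S x x'"
  shows "near S (\<lambda>i. \<mu> (x i) (y i) (z i)) (\<lambda>i. \<mu> (x' i) (y i) (z i))"
proof -
  obtain C where C: "\<forall>i\<in>S. dist (x i) (x' i) \<le> C" using assms by (auto simp: near_def)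
  have "dist (\<mu> (x i) (y i) (z i)) (\<mu> (x' i) (y i) (z i)) \<le> K * C + H" if "i \<in> S" for i
  proof -
    have "K * dist (x i) (x' i) \<le> K * C" using C that K by (intro mult_left_mono) auto
    then show ?thesis using lip[of "x i" "y i" "z i" "x' i"] by linarith
  qed
  then show ?thesis by (rule nearI)
qed

definition hom_on :: "'i set \<Rightarrow> (('i \<Rightarrow> 'a) \<Rightarrow> bool) \<Rightarrow> bool" where
  "hom_on S \<phi> \<longleftrightarrow> (\<forall>x y. near S x y \<longrightarrow> \<phi> x = \<phi> y) \<and>
     (\<forall>x y z. \<phi> (\<lambda>i. \<mu> (x i) (y i) (z i)) = majority (\<phi> x) (\<phi> y) (\<phi> z))"

lemma hom_onD:
  assumes "hom_on S \<phi>"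
  shows "near S x y \<Longrightarrow> \<phi> x = \<phi> y"
    and "\<phi> (\<lambda>i. \<mu> (x i) (y i) (z i)) = majority (\<phi> x) (\<phi> y) (\<phi> z)"
  using assms unfolding hom_on_def by auto

text \<open>
  Modulo bounded distance, families of points of \<open>X\<close> satisfy the laws of a four-point algebra
  exactly. So half-spaces separate them, and a relation between families holds up to a uniform
  constant as soon as it holds under all homomorphisms to truth values. In this way every
  (conditional) identity of median algebras has a coarse version, with no constant to compute.
\<close>

theorem coarse_identity:
  fixes x y :: "'i \<Rightarrow> 'a"
  assumes "\<And>\<phi>. hom_on S \<phi> \<Longrightarrow> \<phi> x = \<phi> y"
  shows "near S x y"
proof (rule ccontr)
  assume xy: "\<not> near S x y"
  define r :: "('i \<Rightarrow> 'a) \<Rightarrow> 'i \<Rightarrow> 'a" where "r = (\<lambda>u. SOME v. near S u v)"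
  have r: "near S u (r u)" for u unfolding r_def by (rule someI[of "near S u" u]) (rule near_refl)
  have r_iff: "r u = r v \<longleftrightarrow> near S u v" for u v
  proof
    assume "r u = r v" then show "near S u v" using r near_trans near_sym by metis
  next
    assume "near S u v"
    then have "near S u = near S v" by (intro ext) (blast intro: near_trans near_sym)
    then show "r u = r v" by (simp add: r_def)
  qed
  let ?M = "\<lambda>u v w i. \<mu> (u i) (v i) (w i)"
  have M12: "?M u v w = ?M v u w" for u v w by (rule ext) (rule mu12)
  have M23: "?M u v w = ?M u w v" for u v w by (rule ext) (rule mu23)
  have M13: "?M u v w = ?M w u v" for u v w using M12[of u w v] M23[of u v w] by simp
  interpret Q: four_point_algebra "range r" "\<lambda>u v w. r (?M u v w)"
  proof (rule four_point_algebra_quotient)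
    fix u v w z :: "'i \<Rightarrow> 'a"
    show "r (r u) = r u" using r near_sym by (auto simp: r_iff)
    show "r (?M (r u) v w) = r (?M u v w)" using near_cong[OF near_sym[OF r]] by (simp add: r_iff)
    show "r (?M u u v) = r u" by (simp add: mu_idem)
    show "r (?M u v w) = r (?M v u w)" using M12[of u v w] by simp
    show "r (?M u v w) = r (?M u w v)" using M23[of u v w] by simp
    show "r (?M (?M u v w) v z) = r (?M u v (?M w v z))"
      unfolding r_iff by (rule nearI) (rule four)
  qed auto
  have "r x \<noteq> r y" using xy by (simp add: r_iff)
  then obtain U where U: "halfspace (range r) (\<lambda>u v w. r (?M u v w)) U" "r x \<in> U" "r y \<notin> U"
    using Q.halfspace_separation[of "r x" "r y"] by blast
  \<comment> \<open>The congruence property is stated for the first argument; rotate to reach the other two.\<close>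
  have M: "r (?M u v w) = r (?M (r u) (r v) (r w))" for u v w
  proof -
    have R: "r (?M u' v' w') = r (?M (r u') v' w')" for u' v' w'
      using near_cong[OF r] by (simp add: r_iff)
    have "r (?M u v w) = r (?M (r u) v w)" by (rule R)
    also have "\<dots> = r (?M w (r u) v)" by (simp only: M13[of "r u" v w])
    also have "\<dots> = r (?M (r w) (r u) v)" by (rule R)
    also have "\<dots> = r (?M v (r w) (r u))" by (simp only: M13[of "r w" "r u" v])
    also have "\<dots> = r (?M (r v) (r w) (r u))" by (rule R)
    also have "\<dots> = r (?M (r u) (r v) (r w))" by (simp only: M13[of "r v" "r w" "r u"])
    finally show ?thesis .
  qed
  have "hom_on S (\<lambda>u. r u \<in> U)" unfolding hom_on_def
  proof (intro conjI allI impI)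
    show "(r (?M u v w) \<in> U) = majority (r u \<in> U) (r v \<in> U) (r w \<in> U)" for u v w
      using halfspaceD[OF U(1), of "r u" "r v" "r w"] M by auto
    show "near S u v \<Longrightarrow> (r u \<in> U) = (r v \<in> U)" for u v using r_iff by metis
  qed
  from assms[OF this] show False using U by simp
qed

end

section \<open>Approximation by finite median algebras\<close>

text \<open>
  The terms of the language with one ternary operation. They serve twice: modulo equality as
  Boolean functions they form the free median algebra, and evaluated in \<open>X\<close> they give its
  map to \<open>X\<close>.
\<close>

datatype med_term = Var nat | Med med_term med_term med_term

primrec term_value :: "('b \<Rightarrow> 'b \<Rightarrow> 'b \<Rightarrow> 'b) \<Rightarrow> (nat \<Rightarrow> 'b) \<Rightarrow> med_term \<Rightarrow> 'b" where
  "term_value m v (Var i) = v i"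
| "term_value m v (Med s t u) = m (term_value m v s) (term_value m v t) (term_value m v u)"

primrec term_vars :: "med_term \<Rightarrow> nat set" where
  "term_vars (Var i) = {i}"
| "term_vars (Med s t u) = term_vars s \<union> term_vars t \<union> term_vars u"

lemma term_value_cong: "(\<And>i. i \<in> term_vars t \<Longrightarrow> v i = w i) \<Longrightarrow> term_value m v t = term_value m w t"
  by (induction t) auto

lemma (in coarse_constants) term_identity:
  assumes "\<And>w. term_value majority w s = term_value majority w t"
  shows "\<exists>C. \<forall>v. dist (term_value \<mu> v s) (term_value \<mu> v t) \<le> C"
proof -
  have "near UNIV (\<lambda>v. term_value \<mu> v s) (\<lambda>v. term_value \<mu> v t)"
  proof (rule coarse_identity)
    fix \<phi> :: "((nat \<Rightarrow> 'a) \<Rightarrow> 'a) \<Rightarrow> bool" assume \<phi>: "hom_on UNIV \<phi>"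
    have "\<phi> (\<lambda>v. term_value \<mu> v u) = term_value majority (\<lambda>i. \<phi> (\<lambda>v. v i)) u" for u
      by (induction u) (auto simp: hom_onD(2)[OF \<phi>])
    then show "\<phi> (\<lambda>v. term_value \<mu> v s) = \<phi> (\<lambda>v. term_value \<mu> v t)" using assms by simp
  qed
  then show ?thesis by (simp add: near_def)
qed

text \<open>
  Terms in \<open>p\<close> variables modulo equality under majority vote. There are finitely many classes because the
  class of a term in \<open>p\<close> variables is determined by its values on the subsets of \<open>{..<p}\<close>. The map \<open>r\<close> picks one
  term in each class.
\<close>

lemma free_median_algebra:
  obtains r :: "med_term \<Rightarrow> med_term" and T where
    "T = {t. term_vars t \<subseteq> {..<p}}" "finite (r ` T)" "r ` T \<subseteq> T"
    "median_algebra (r ` T) (\<lambda>x y z. r (Med x y z))"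
    "\<And>t w. t \<in> T \<Longrightarrow> term_value majority w (r t) = term_value majority w t"
proof -
  define T where "T = {t. term_vars t \<subseteq> {..<p}}"
  define eqv where "eqv s t \<longleftrightarrow> (\<forall>w. term_value majority w s = term_value majority w t)" for s t
  define r where "r t = (SOME s. s \<in> T \<and> eqv t s)" for t
  have r: "r t \<in> T \<and> eqv t (r t)" if "t \<in> T" for t
    unfolding r_def by (rule someI[of _ t]) (use that in \<open>auto simp: eqv_def\<close>)
  have rT: "r t \<in> T" if "t \<in> T" for t using r that by blast
  have ev: "term_value majority w (r t) = term_value majority w t" if "t \<in> T" for t w
    using r[OF that] by (auto simp: eqv_def)
  have r_eq: "r s = r t" if "eqv s t" for s t
  proof -
    have "eqv s u \<longleftrightarrow> eqv t u" for u using that by (auto simp: eqv_def)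
    then show ?thesis by (simp add: r_def)
  qed
  have fpa: "four_point_algebra (r ` T) (\<lambda>x y z. r (Med x y z))"
  proof (rule four_point_algebra_quotient)
    fix a b c d assume a: "a \<in> T"
    show "r a \<in> T" using a rT by simp
    show "r (r a) = r a" by (rule r_eq) (auto simp: eqv_def ev a)
    show "r (Med (r a) b c) = r (Med a b c)" by (rule r_eq) (auto simp: eqv_def ev a)
    show "r (Med a a b) = r a" by (rule r_eq) (auto simp: eqv_def majority_def)
    show "r (Med a b c) = r (Med b a c)" by (rule r_eq) (auto simp: eqv_def majority_def)
    show "r (Med a b c) = r (Med a c b)" by (rule r_eq) (auto simp: eqv_def majority_def)
    show "r (Med (Med a b c) b d) = r (Med a b (Med c b d))"
      by (rule r_eq) (auto simp: eqv_def majority_def)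
    assume "b \<in> T" "c \<in> T"
    then show "Med a b c \<in> T" using a by (auto simp: T_def)
  qed
  have "finite (r ` T)"
  proof (rule inj_on_finite)
    let ?g = "\<lambda>t. {A. A \<subseteq> {..<p} \<and> term_value majority (\<lambda>i. i \<in> A) t}"
    show "inj_on ?g (r ` T)"
    proof (rule inj_onI)
      fix s t assume s: "s \<in> r ` T" and t: "t \<in> r ` T" and eq: "?g s = ?g t"
      have sT: "s \<in> T" "r s = s" and tT: "t \<in> T" "r t = t"
        using s t rT r_eq ev by (auto simp: eqv_def)
      have "term_value majority w s = term_value majority w t" for w
      proof -
        let ?A = "{i. i < p \<and> w i}"
        have "?A \<subseteq> {..<p}" by auto
        then have "term_value majority (\<lambda>i. i \<in> ?A) s = term_value majority (\<lambda>i. i \<in> ?A) t" using eq by blast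
        moreover have "term_value majority (\<lambda>i. i \<in> ?A) u = term_value majority w u" if "u \<in> T" for u
          by (rule term_value_cong) (use that in \<open>auto simp: T_def\<close>)
        ultimately show ?thesis using sT tT by simp
      qed
      then have "r s = r t" by (intro r_eq) (auto simp: eqv_def)
      then show "s = t" using sT tT by simp
    qed
    show "?g ` r ` T \<subseteq> Pow (Pow {..<p})" by auto
  qed auto
  then show thesis
    using that[OF T_def, of r] rT ev four_point_algebra.is_median_algebra[OF fpa] by auto
qed

lemma median_algebra_transport:
  assumes "median_algebra P m" and e: "\<And>x. x \<in> P \<Longrightarrow> d (e x) = x"
  shows "median_algebra (e ` P) (\<lambda>x y z. e (m (d x) (d y) (d z)))"
proof -
  interpret median_algebra P m by fact
  show ?thesis
  proof
    fix a b c f g assume "a \<in> e ` P" "b \<in> e ` P" "c \<in> e ` P" "f \<in> e ` P" "g \<in> e ` P"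
    then show "e (m (d a) (d b) (d (e (m (d c) (d f) (d g))))) =
       e (m (d (e (m (d a) (d b) (d c)))) (d (e (m (d a) (d b) (d f)))) (d g))"
      using M3 closed by (auto simp: e)
  next
    fix a b c assume "a \<in> e ` P" "b \<in> e ` P" "c \<in> e ` P"
    then obtain x y z where P: "x \<in> P" "y \<in> P" "z \<in> P" and eq: "a = e x" "b = e y" "c = e z" by blast
    show "e (m (d a) (d c) (d b)) = e (m (d a) (d b) (d c)) \<and>
       e (m (d b) (d a) (d c)) = e (m (d a) (d b) (d c)) \<and>
       e (m (d b) (d c) (d a)) = e (m (d a) (d b) (d c)) \<and>
       e (m (d c) (d a) (d b)) = e (m (d a) (d b) (d c)) \<and>
       e (m (d c) (d b) (d a)) = e (m (d a) (d b) (d c))"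
      using M2[OF P] P by (simp add: eq e)
  qed (auto simp: e M1 closed)
qed

text \<open>
  Bowditch's approximation by finite median algebras, with an algebra that depends on the number of points only. It is the
  free median algebra on \<open>p\<close> generators; a \<open>p\<close>-tuple \<open>v\<close> of points gives the map \<open>l v\<close> by evaluation of the
  chosen terms. The error \<open>h\<close> is finite since only finitely many coarse identities are involved.
\<close>

proposition (in coarse_constants) finite_approximation:
  obtains P :: "nat set" and m h and g :: "nat \<Rightarrow> nat" and l :: "(nat \<Rightarrow> 'a) \<Rightarrow> nat \<Rightarrow> 'a" where
    "finite P" "median_algebra P m" "h \<ge> 0" "\<And>i. i < p \<Longrightarrow> g i \<in> P"
    "\<And>v x y z. x \<in> P \<Longrightarrow> y \<in> P \<Longrightarrow> z \<in> P \<Longrightarrow> dist (l v (m x y z)) (\<mu> (l v x) (l v y) (l v z)) \<le> h"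
    "\<And>v i. i < p \<Longrightarrow> dist (v i) (l v (g i)) \<le> h"
proof -
  obtain r T where T: "T = {t. term_vars t \<subseteq> {..<p}}" and fin: "finite (r ` T)" and rT: "r ` T \<subseteq> T"
    and ma: "median_algebra (r ` T) (\<lambda>x y z. r (Med x y z))"
    and ev: "\<And>t w. t \<in> T \<Longrightarrow> term_value majority w (r t) = term_value majority w t"
    by (rule free_median_algebra[of p]) blast
  have "\<exists>C. \<forall>v. dist (term_value \<mu> v (r t)) (term_value \<mu> v t) \<le> C" if "t \<in> T" for t
    using ev[OF that] by (intro term_identity) auto
  then obtain C where C: "\<And>t v. t \<in> T \<Longrightarrow> dist (term_value \<mu> v (r t)) (term_value \<mu> v t) \<le> C t" by metis
  let ?S = "Var ` {..<p} \<union> (\<lambda>(x,y,z). Med x y z) ` (r ` T \<times> r ` T \<times> r ` T)"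
  have finS: "finite ?S" using fin by auto
  define h where "h = Max (insert 0 (C ` ?S))"
  have h: "C s \<le> h" if "s \<in> ?S" for s unfolding h_def using that finS by (intro Max_ge) auto
  have h0: "h \<ge> 0" unfolding h_def using finS by (intro Max_ge) auto
  obtain e :: "med_term \<Rightarrow> nat" where e: "inj_on e (r ` T)"
    using ex_bij_betw_finite_nat[OF fin] by (auto simp: bij_betw_def)
  define d where "d = inv_into (r ` T) e"
  have d: "d (e x) = x" if "x \<in> r ` T" for x using e that by (simp add: d_def)
  let ?m = "\<lambda>x y z. e (r (Med (d x) (d y) (d z)))"
  have VT: "Var i \<in> T" if "i < p" for i using that by (simp add: T)
  show thesis
  proof (rule that[of "e ` r ` T" ?m h "\<lambda>i. e (r (Var i))" "\<lambda>v x. term_value \<mu> v (d x)"])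
    show "finite (e ` r ` T)" using fin by simp
    show "median_algebra (e ` r ` T) ?m" by (rule median_algebra_transport[of "r ` T" "\<lambda>x y z. r (Med x y z)" d e, OF ma d])
    show "e (r (Var i)) \<in> e ` r ` T" if "i < p" for i using VT[OF that] by blast
    show "dist (v i) (term_value \<mu> v (d (e (r (Var i))))) \<le> h" if "i < p" for v i
      using C[OF VT[OF that], of v] VT[OF that] h[of "Var i"] that by (simp add: d dist_commute)
  next
    fix v x y z assume "x \<in> e ` r ` T" "y \<in> e ` r ` T" "z \<in> e ` r ` T"
    then obtain a b c where abc: "a \<in> r ` T" "b \<in> r ` T" "c \<in> r ` T" "x = e a" "y = e b" "z = e c" by blast
    have "Med a b c \<in> T" using abc rT unfolding T by auto
    moreover have "Med a b c \<in> ?S"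
      by (rule UnI2, rule image_eqI[of _ _ "(a, b, c)"]) (use abc in auto)
    ultimately have "dist (term_value \<mu> v (r (Med a b c))) (term_value \<mu> v (Med a b c)) \<le> h" "r (Med a b c) \<in> r ` T"
      using C[of "Med a b c" v] h[of "Med a b c"] by auto
    then show "dist (term_value \<mu> v (d (?m x y z))) (\<mu> (term_value \<mu> v (d x)) (term_value \<mu> v (d y)) (term_value \<mu> v (d z))) \<le> h"
      using abc by (simp add: d)
  qed (rule h0)
qed

section \<open>Bounded rank from the corner condition\<close>

definition quasi_morphism where
  "quasi_morphism P m \<mu> h l \<longleftrightarrow>
     (\<forall>x\<in>P. \<forall>y\<in>P. \<forall>z\<in>P. dist (l (m x y z)) (\<mu> (l x) (l y) (l z)) \<le> (h::real))"

lemma quasi_morphismD: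
  "quasi_morphism P m \<mu> h l \<Longrightarrow> x \<in> P \<Longrightarrow> y \<in> P \<Longrightarrow> z \<in> P \<Longrightarrow>
     dist (l (m x y z)) (\<mu> (l x) (l y) (l z)) \<le> h"
  by (simp add: quasi_morphism_def)

lemma (in coarse_constants) dist_quasi_morphism:
  assumes "quasi_morphism P m \<mu> h l" and P: "x \<in> P" "y \<in> P" "u \<in> P" "v \<in> P"
    and uv: "dist (l u) (l v) \<le> \<theta>"
  shows "dist (l (m x u y)) (l (m x v y)) \<le> K * \<theta> + H + 2 * h"
proof -
  have 1: "dist (l (m x u y)) (\<mu> (l x) (l u) (l y)) \<le> h" "dist (l (m x v y)) (\<mu> (l x) (l v) (l y)) \<le> h"
    using quasi_morphismD[OF assms(1)] P by auto
  have 2: "dist (\<mu> (l x) (l u) (l y)) (\<mu> (l x) (l v) (l y)) \<le> K * dist (l u) (l v) + H"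
    by (metis lip mu12)
  have 3: "K * dist (l u) (l v) \<le> K * \<theta>" using uv K by (intro mult_left_mono) auto
  have 4: "dist (l (m x u y)) (l (m x v y)) \<le> dist (l (m x u y)) (\<mu> (l x) (l u) (l y)) +
      dist (\<mu> (l x) (l u) (l y)) (l (m x v y))" by (rule dist_triangle)
  have 5: "dist (\<mu> (l x) (l u) (l y)) (l (m x v y)) \<le> dist (\<mu> (l x) (l u) (l y)) (\<mu> (l x) (l v) (l y)) +
      dist (\<mu> (l x) (l v) (l y)) (l (m x v y))" by (rule dist_triangle)
  show ?thesis using 1 2 3 4 5 by (simp add: dist_commute)
qed

text \<open>
  If every wall between \<open>x\<close> and \<open>y\<close> is crossed by one of the short pairs \<open>(u j, v j)\<close>, in the same
  direction, then \<open>x\<close> and \<open>y\<close> are close. Project one pair to the interval from \<open>x\<close> to \<open>y\<close>: the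
  path via \<open>m x (u j) y\<close> and \<open>m x (v j) y\<close> has a short middle part, and the walls crossed
  by the pair \<open>j\<close> are absent from the two outer parts. These are treated by induction on
  the number of pairs, which doubles the bound and adds one step.
\<close>

lemma (in coarse_constants) detour_bound:
  assumes "median_algebra P m" and l: "quasi_morphism P m \<mu> h l" and "finite J"
    and "\<And>j. j \<in> J \<Longrightarrow> u j \<in> P \<and> v j \<in> P \<and> dist (l (u j)) (l (v j)) \<le> \<theta>"
    and "x \<in> P" "y \<in> P"
    and "\<And>U. halfspace P m U \<Longrightarrow> (x \<in> U) \<noteq> (y \<in> U) \<Longrightarrow>
      \<exists>j\<in>J. (u j \<in> U) = (x \<in> U) \<and> (v j \<in> U) = (y \<in> U)"
  shows "dist (l x) (l y) \<le> (2 ^ card J - 1) * (K * \<theta> + H + 2 * h)"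
proof -
  interpret median_algebra P m by fact
  let ?c = "K * \<theta> + H + 2 * h"
  show ?thesis
    using assms(3-)
  proof (induction J arbitrary: x y rule: finite_induct)
    case empty
    then have "x = y" by (intro halfspace_ext) auto
    then show ?case by simp
  next
    case (insert j J)
    have P: "x \<in> P" "y \<in> P" "u j \<in> P" "v j \<in> P" using insert.prems by auto
    let ?x = "m x (u j) y" and ?y = "m x (v j) y"
    have xy: "?x \<in> P" "?y \<in> P" using P by auto
    have "dist (l x) (l ?x) \<le> (2 ^ card J - 1) * ?c"
    proof (rule insert.IH)
      fix U assume U: "halfspace P m U" "(x \<in> U) \<noteq> (?x \<in> U)"
      then have s: "(x \<in> U) \<noteq> (y \<in> U)" "(u j \<in> U) \<noteq> (x \<in> U)" "(?x \<in> U) = (y \<in> U)"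
        using halfspaceD[OF U(1) P(1,3,2)] by (auto simp: majority_def)
      obtain i where "i \<in> insert j J" "(u i \<in> U) = (x \<in> U)" "(v i \<in> U) = (y \<in> U)"
        using insert.prems(4)[OF U(1) s(1)] by blast
      then show "\<exists>i\<in>J. (u i \<in> U) = (x \<in> U) \<and> (v i \<in> U) = (?x \<in> U)" using s by blast
    qed (use insert.prems xy in auto)
    moreover have "dist (l ?y) (l y) \<le> (2 ^ card J - 1) * ?c"
    proof (rule insert.IH)
      fix U assume U: "halfspace P m U" "(?y \<in> U) \<noteq> (y \<in> U)"
      then have s: "(x \<in> U) \<noteq> (y \<in> U)" "(v j \<in> U) \<noteq> (y \<in> U)" "(?y \<in> U) = (x \<in> U)"
        using halfspaceD[OF U(1) P(1,4,2)] by (auto simp: majority_def)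
      obtain i where "i \<in> insert j J" "(u i \<in> U) = (x \<in> U)" "(v i \<in> U) = (y \<in> U)"
        using insert.prems(4)[OF U(1) s(1)] by blast
      then show "\<exists>i\<in>J. (u i \<in> U) = (?y \<in> U) \<and> (v i \<in> U) = (y \<in> U)" using s by blast
    qed (use insert.prems xy in auto)
    moreover have "dist (l ?x) (l ?y) \<le> ?c"
      using insert.prems by (intro dist_quasi_morphism[OF l]) auto
    moreover have "dist (l x) (l y) \<le> dist (l x) (l ?x) + dist (l ?x) (l y)"
      "dist (l ?x) (l y) \<le> dist (l ?x) (l ?y) + dist (l ?y) (l y)" by (rule dist_triangle)+
    ultimately have "dist (l x) (l y) \<le> 2 * ((2 ^ card J - 1) * ?c) + ?c" by linarith
    also have "\<dots> = (2 ^ card (insert j J) - 1) * ?c"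
      using insert.hyps by (simp add: algebra_simps)
    finally show ?case .
  qed
qed

text \<open>
  Among \<open>n + 1\<close> directions at \<open>a\<close> that are pairwise almost disjoint, not all are long. This excludes large
  coarse cubes of dimension \<open>n + 1\<close> through their corners.
\<close>

definition corner_condition :: "('a::metric_space \<Rightarrow> 'a \<Rightarrow> 'a \<Rightarrow> 'a) \<Rightarrow> nat \<Rightarrow> bool" where
  "corner_condition \<mu> n \<longleftrightarrow> (\<forall>s. \<exists>C. \<forall>a b (e :: nat \<Rightarrow> 'a).
     (\<forall>i\<le>n. e i \<in> interval \<mu> a b) \<and>
     (\<forall>i\<le>n. \<forall>j\<le>n. i \<noteq> j \<longrightarrow> dist (\<mu> (e i) a (e j)) a \<le> s) \<longrightarrow>
     (\<exists>i\<le>n. dist (e i) a \<le> C))"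

text \<open>
  Call a wall of \<open>P\<close> short if it separates two points whose images in \<open>X\<close> have distance at most \<open>D\<close>,
  and collapse all short walls. By \<open>detour_bound\<close> this moves points of \<open>X\<close> by a bounded
  amount. A cube of dimension above \<open>n\<close> in the quotient would give a corner in \<open>X\<close> with \<open>n + 1\<close> pairwise
  almost disjoint edges; by the corner condition one of them is short, but it crosses a
  wall that has not been collapsed.
\<close>

lemma (in coarse_constants) collapse_short_walls:
  assumes cc: "corner_condition \<mu> n" and h: "h \<ge> 0"
    and fin: "finite P" and ma: "median_algebra P m"
  shows "\<exists>E\<ge>0. \<forall>l. quasi_morphism P m \<mu> h l \<longrightarrow>
    (\<exists>r. r ` P \<subseteq> P \<and> median_algebra (r ` P) (\<lambda>x y z. r (m x y z)) \<and>
      median_rank (r ` P) (\<lambda>x y z. r (m x y z)) \<le> enat n \<and>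
      (\<forall>x\<in>P. dist (l (r x)) (l x) \<le> E))"
proof -
  interpret median_algebra P m by fact
  \<comment> \<open>The error with which the relation \<open>m (e i) a (e j) = a\<close> is seen in \<open>X\<close>, where the images of the
    \<open>e i\<close> have first been moved into the interval, by at most \<open>h\<close>.\<close>
  define s where "s = K * (2 * h) + 3 * H + h"
  obtain C where C: "\<forall>a b (e :: nat \<Rightarrow> 'a). (\<forall>i\<le>n. e i \<in> interval \<mu> a b) \<and>
     (\<forall>i\<le>n. \<forall>j\<le>n. i \<noteq> j \<longrightarrow> dist (\<mu> (e i) a (e j)) a \<le> s) \<longrightarrow> (\<exists>i\<le>n. dist (e i) a \<le> C)"
    using spec[OF cc[unfolded corner_condition_def], of s] by (rule exE)
  define D where "D = max C 0 + h"
  have D: "D \<ge> 0" "C + h \<le> D" using h by (auto simp: D_def)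
  define E where "E = (2 ^ card (Pow P) - 1) * (K * D + H + 2 * h)"
  have c0: "K * D + H + 2 * h \<ge> 0" using K H h D by simp
  have E0: "E \<ge> 0" unfolding E_def using c0 by (intro mult_nonneg_nonneg) auto
  show ?thesis
  proof (rule exI[of _ E], intro conjI allI impI E0)
    fix l assume l: "quasi_morphism P m \<mu> h l"
    define W where "W = {U. halfspace P m U \<and> (\<forall>x\<in>U. \<forall>y\<in>P - U. dist (l x) (l y) > D)}"
    define r where "r x = (SOME y. y \<in> P \<and> (\<forall>U\<in>W. y \<in> U \<longleftrightarrow> x \<in> U))" for x
    have r: "r x \<in> P \<and> (\<forall>U\<in>W. r x \<in> U \<longleftrightarrow> x \<in> U)" if "x \<in> P" for x
      unfolding r_def by (rule someI[of _ x]) (use that in auto)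
    have rP: "r x \<in> P" if "x \<in> P" for x using r[OF that] by blast
    have rU: "r x \<in> U \<longleftrightarrow> x \<in> U" if "x \<in> P" "U \<in> W" for x U using r[OF that(1)] that(2) by blast
    have r_iff: "r x = r y \<longleftrightarrow> (\<forall>U\<in>W. x \<in> U \<longleftrightarrow> y \<in> U)" if "x \<in> P" "y \<in> P" for x y
    proof
      assume "r x = r y" then show "\<forall>U\<in>W. x \<in> U \<longleftrightarrow> y \<in> U" using rU that by metis
    next
      assume "\<forall>U\<in>W. x \<in> U \<longleftrightarrow> y \<in> U"
      then have "(\<lambda>z. z \<in> P \<and> (\<forall>U\<in>W. z \<in> U \<longleftrightarrow> x \<in> U)) = (\<lambda>z. z \<in> P \<and> (\<forall>U\<in>W. z \<in> U \<longleftrightarrow> y \<in> U))"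
        by auto
      then show "r x = r y" by (simp add: r_def)
    qed
    have WH: "halfspace P m U" if "U \<in> W" for U using that by (simp add: W_def)
    have rr: "r (r x) = r x" if "x \<in> P" for x using that rP rU by (simp add: r_iff)
    have "four_point_algebra (r ` P) (\<lambda>x y z. r (m x y z))"
    proof (rule four_point_algebra_quotient)
      fix a b c d assume P: "a \<in> P" "b \<in> P"
      show "r (m a a b) = r a" using P by (simp add: M1)
      assume P': "c \<in> P"
      show "r (m (r a) b c) = r (m a b c)"
        using P P' by (simp add: r_iff rP rU closed halfspaceD[OF WH])
      show "r (m a b c) = r (m b a c)" "r (m a b c) = r (m a c b)" using P P' M2 by metis+
      show "m a b c \<in> P" using P P' by auto
      assume "d \<in> P"
      then show "r (m (m a b c) b d) = r (m a b (m c b d))" using P P' four by simp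
    qed (use rP rr in auto)
    then have "median_algebra (r ` P) (\<lambda>x y z. r (m x y z))" by (rule four_point_algebra.is_median_algebra)
    moreover have "median_rank (r ` P) (\<lambda>x y z. r (m x y z)) \<le> enat n"
    proof (rule ccontr)
      assume rank: "\<not> ?thesis"
      have "\<exists>a b e. a \<in> P \<and> b \<in> P \<and> (\<forall>i\<le>n. e i \<in> P \<and> m a (e i) b = e i) \<and>
        (\<forall>i\<le>n. \<forall>j\<le>n. i \<noteq> j \<longrightarrow> m (e i) a (e j) = a) \<and> (\<forall>i\<le>n. \<exists>U\<in>W. (a \<in> U) \<noteq> (e i \<in> U))"
        using cube_lift[OF ma WH rP r_iff rr rank] by simp
      then obtain a b e where abe: "a \<in> P" "b \<in> P" "\<forall>i\<le>n. e i \<in> P \<and> m a (e i) b = e i"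
        "\<forall>i\<le>n. \<forall>j\<le>n. i \<noteq> j \<longrightarrow> m (e i) a (e j) = a"
        "\<forall>i\<le>n. \<exists>U\<in>W. (a \<in> U) \<noteq> (e i \<in> U)"
        by (elim exE conjE) (rule that)
      let ?e = "\<lambda>i. \<mu> (l a) (l (e i)) (l b)"
      have e_near: "dist (?e i) (l (e i)) \<le> h" if "i \<le> n" for i
        using quasi_morphismD[OF l abe(1) _ abe(2), of "e i"] abe(3) that by (simp add: dist_commute)
      have "\<forall>i\<le>n. ?e i \<in> interval \<mu> (l a) (l b)" by (auto simp: interval_def)
      moreover have "\<forall>i\<le>n. \<forall>j\<le>n. i \<noteq> j \<longrightarrow> dist (\<mu> (?e i) (l a) (?e j)) (l a) \<le> s"
      proof (intro allI impI)
        fix i j assume ij: "i \<le> n" "j \<le> n" "i \<noteq> j"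
        have "dist (\<mu> (?e i) (l a) (?e j)) (\<mu> (l (e i)) (l a) (l (e j))) \<le>
          K * (dist (?e i) (l (e i)) + dist (l a) (l a) + dist (?e j) (l (e j))) + 3 * H" by (rule lip3)
        also have "\<dots> \<le> K * (2 * h) + 3 * H"
          using e_near[OF ij(1)] e_near[OF ij(2)] K by (intro add_right_mono mult_left_mono) auto
        finally have 1: "dist (\<mu> (?e i) (l a) (?e j)) (\<mu> (l (e i)) (l a) (l (e j))) \<le> K * (2 * h) + 3 * H" .
        have 2: "dist (\<mu> (l (e i)) (l a) (l (e j))) (l a) \<le> h"
          using quasi_morphismD[OF l, of "e i" a "e j"] abe ij by (simp add: dist_commute)
        show "dist (\<mu> (?e i) (l a) (?e j)) (l a) \<le> s"
          using 1 2 dist_triangle[of "\<mu> (?e i) (l a) (?e j)" "l a" "\<mu> (l (e i)) (l a) (l (e j))"]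
          by (simp add: s_def)
      qed
      ultimately obtain i where i: "i \<le> n" "dist (?e i) (l a) \<le> C" using C[rule_format, of ?e "l a" "l b"] by blast
      have close: "dist (l (e i)) (l a) \<le> D"
        using i e_near[OF i(1)] D dist_triangle[of "l (e i)" "l a" "?e i"] by (simp add: dist_commute)
      obtain U where U: "U \<in> W" "(a \<in> U) \<noteq> (e i \<in> U)" using abe(5) i by blast
      have "dist (l a) (l (e i)) > D"
      proof (cases "a \<in> U")
        case True
        then show ?thesis using U abe i by (auto simp: W_def)
      next
        case False
        then have "dist (l (e i)) (l a) > D" using U abe i by (auto simp: W_def)
        then show ?thesis by (simp add: dist_commute)
      qed
      then show False using close by (simp add: dist_commute)
    qed
    moreover have "dist (l (r x)) (l x) \<le> E" if x: "x \<in> P" for x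
    proof -
      let ?J = "{U. halfspace P m U \<and> U \<notin> W}"
      have J: "?J \<subseteq> Pow P" by (auto simp: halfspace_def)
      then have finJ: "finite ?J" using fin by (meson finite_Pow_iff finite_subset)
      have "\<exists>p q. p \<in> U \<and> p \<in> P \<and> q \<in> P \<and> q \<notin> U \<and> dist (l p) (l q) \<le> D" if U: "U \<in> ?J" for U
      proof -
        have "U \<subseteq> P" using U by (auto simp: halfspace_def)
        moreover obtain p q where "p \<in> U" "q \<in> P - U" "\<not> dist (l p) (l q) > D"
          using U by (auto simp: W_def)
        ultimately show ?thesis by (intro exI[of _ p] exI[of _ q]) auto
      qed
      then obtain p q where pq: "\<And>U. U \<in> ?J \<Longrightarrow> p U \<in> U \<and> p U \<in> P \<and> q U \<in> P \<and> q U \<notin> U \<and> dist (l (p U)) (l (q U)) \<le> D"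
        by metis
      have "dist (l (r x)) (l x) \<le> (2 ^ card ?J - 1) * (K * D + H + 2 * h)"
      proof (rule detour_bound[OF ma l finJ])
        fix U assume "U \<in> ?J"
        then show "(if r x \<in> U then p U else q U) \<in> P \<and> (if r x \<in> U then q U else p U) \<in> P \<and>
          dist (l (if r x \<in> U then p U else q U)) (l (if r x \<in> U then q U else p U)) \<le> D"
          using pq by (auto simp: dist_commute)
      next
        fix U assume U: "halfspace P m U" "(r x \<in> U) \<noteq> (x \<in> U)"
        then have "U \<in> ?J" using rU x by auto
        then show "\<exists>V\<in>?J. ((if r x \<in> V then p V else q V) \<in> U) = (r x \<in> U) \<and>
           ((if r x \<in> V then q V else p V) \<in> U) = (x \<in> U)"
          using pq U(2) by (intro bexI[of _ U]) auto
      qed (use x rP in auto)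
      also have "\<dots> \<le> E" unfolding E_def
      proof (rule mult_right_mono[OF _ c0])
        have "card ?J \<le> card (Pow P)" using J fin by (intro card_mono) auto
        then show "(2::real) ^ card ?J - 1 \<le> 2 ^ card (Pow P) - 1" by simp
      qed
      finally show ?thesis .
    qed
    ultimately show "\<exists>r. r ` P \<subseteq> P \<and> median_algebra (r ` P) (\<lambda>x y z. r (m x y z)) \<and>
      median_rank (r ` P) (\<lambda>x y z. r (m x y z)) \<le> enat n \<and> (\<forall>x\<in>P. dist (l (r x)) (l x) \<le> E)"
      using rP by (intro exI[of _ r]) auto
  qed
qed

proposition (in coarse_constants) rank_at_most_of_corner_condition:
  assumes cc: "corner_condition \<mu> n"
  shows "coarse_rank_at_most \<mu> n"
proof -
  let ?Q = "\<lambda>(p::nat) h. 0 \<le> h \<and> (\<forall>A::'a set. finite A \<and> 1 \<le> card A \<and> card A \<le> p \<longrightarrow>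
         (\<exists>(P::nat set) m \<pi> l.
            finite P \<and> median_algebra P m \<and> median_rank P m \<le> enat n \<and> \<pi> ` A \<subseteq> P \<and>
            (\<forall>x\<in>P. \<forall>y\<in>P. \<forall>z\<in>P. dist (l (m x y z)) (\<mu> (l x) (l y) (l z)) \<le> h) \<and>
            (\<forall>a\<in>A. dist a (l (\<pi> a)) \<le> h)))"
  have "\<exists>h. ?Q p h" for p
  proof -
    obtain P :: "nat set" and m h0 and g :: "nat \<Rightarrow> nat" and l :: "(nat \<Rightarrow> 'a) \<Rightarrow> nat \<Rightarrow> 'a" where
      fin: "finite P" and ma: "median_algebra P m" and h0: "h0 \<ge> 0" and g: "\<And>i. i < p \<Longrightarrow> g i \<in> P"
      and l: "\<And>v x y z. x \<in> P \<Longrightarrow> y \<in> P \<Longrightarrow> z \<in> P \<Longrightarrow> dist (l v (m x y z)) (\<mu> (l v x) (l v y) (l v z)) \<le> h0"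
      and gl: "\<And>v i. i < p \<Longrightarrow> dist (v i) (l v (g i)) \<le> h0"
      by (rule finite_approximation[of p]) (rule that)
    interpret median_algebra P m by (rule ma)
    have qm: "quasi_morphism P m \<mu> h0 (l v)" for v using l by (simp add: quasi_morphism_def)
    obtain E where E: "E \<ge> 0" and Eq: "\<forall>l. quasi_morphism P m \<mu> h0 l \<longrightarrow>
      (\<exists>r. r ` P \<subseteq> P \<and> median_algebra (r ` P) (\<lambda>x y z. r (m x y z)) \<and>
      median_rank (r ` P) (\<lambda>x y z. r (m x y z)) \<le> enat n \<and> (\<forall>x\<in>P. dist (l (r x)) (l x) \<le> E))"
      using collapse_short_walls[OF cc h0 fin ma] by (elim exE conjE) (rule that)
    note Er = Eq[rule_format, OF qm]
    have "?Q p (E + h0)"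
    proof (intro conjI allI impI)
      show "0 \<le> E + h0" using E h0 by simp
      fix A :: "'a set" assume A: "finite A \<and> 1 \<le> card A \<and> card A \<le> p"
      obtain v where v: "bij_betw v {0..<card A} A" using A ex_bij_betw_nat_finite by blast
      define idx where "idx = inv_into {0..<card A} v"
      have vA: "v ` {0..<card A} = A" using v by (simp add: bij_betw_def)
      have idx: "idx a < p" "v (idx a) = a" if "a \<in> A" for a
      proof -
        have a: "a \<in> v ` {0..<card A}" using that vA by simp
        have "idx a \<in> {0..<card A}" unfolding idx_def by (rule inv_into_into[OF a])
        then show "idx a < p" using A by simp
        show "v (idx a) = a" unfolding idx_def by (rule f_inv_into_f[OF a])
      qed
      obtain r where r: "r ` P \<subseteq> P" "median_algebra (r ` P) (\<lambda>x y z. r (m x y z))"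
        "median_rank (r ` P) (\<lambda>x y z. r (m x y z)) \<le> enat n"
        and rE: "\<And>x. x \<in> P \<Longrightarrow> dist (l v (r x)) (l v x) \<le> E" using Er[of v] by blast
      show "\<exists>(P::nat set) m \<pi> l.
            finite P \<and> median_algebra P m \<and> median_rank P m \<le> enat n \<and> \<pi> ` A \<subseteq> P \<and>
            (\<forall>x\<in>P. \<forall>y\<in>P. \<forall>z\<in>P. dist (l (m x y z)) (\<mu> (l x) (l y) (l z)) \<le> E + h0) \<and>
            (\<forall>a\<in>A. dist a (l (\<pi> a)) \<le> E + h0)"
      proof (intro exI conjI ballI)
        show "finite (r ` P)" using fin by simp
        show "median_algebra (r ` P) (\<lambda>x y z. r (m x y z))" "median_rank (r ` P) (\<lambda>x y z. r (m x y z)) \<le> enat n"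
          by (rule r)+
        show "(\<lambda>a. r (g (idx a))) ` A \<subseteq> r ` P" using g idx by auto
        show "dist a (l v (r (g (idx a)))) \<le> E + h0" if "a \<in> A" for a
        proof -
          have "dist a (l v (g (idx a))) \<le> h0" using gl[OF idx(1)[OF that], of v] idx(2)[OF that] by simp
          moreover have "dist (l v (r (g (idx a)))) (l v (g (idx a))) \<le> E" by (rule rE[OF g[OF idx(1)[OF that]]])
          ultimately show ?thesis
            using dist_triangle[of a "l v (r (g (idx a)))" "l v (g (idx a))"] by (simp add: dist_commute)
        qed
        fix x y z assume "x \<in> r ` P" "y \<in> r ` P" "z \<in> r ` P"
        then have P: "x \<in> P" "y \<in> P" "z \<in> P" using r(1) by auto
        show "dist (l v (r (m x y z))) (\<mu> (l v x) (l v y) (l v z)) \<le> E + h0"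
          using rE[OF closed[OF P]] l[OF P, of v]
            dist_triangle[of "l v (r (m x y z))" "\<mu> (l v x) (l v y) (l v z)" "l v (m x y z)"] by simp
      qed
    qed
    then show ?thesis by (rule exI)
  qed
  then have "\<forall>p. \<exists>h. ?Q p h" by (rule allI)
  from choice[OF this] obtain h where h: "\<forall>p. ?Q p (h p)" by (rule exE)
  show ?thesis unfolding coarse_rank_at_most_def
  proof (rule exI[of _ h], rule conjI)
    show "\<forall>p. 0 \<le> h p" using h by (intro allI) (drule spec, erule conjunct1)
    show "\<forall>p. \<forall>A::'a set. finite A \<and> 1 \<le> card A \<and> card A \<le> p \<longrightarrow>
         (\<exists>(P::nat set) m \<pi> l.
            finite P \<and> median_algebra P m \<and> median_rank P m \<le> enat n \<and> \<pi> ` A \<subseteq> P \<and>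
            (\<forall>x\<in>P. \<forall>y\<in>P. \<forall>z\<in>P. dist (l (m x y z)) (\<mu> (l x) (l y) (l z)) \<le> h p) \<and>
            (\<forall>a\<in>A. dist a (l (\<pi> a)) \<le> h p))"
      using h by (intro allI[of "\<lambda>p. \<forall>A. _ p A"]) (drule spec, erule conjunct2)
  qed
qed

section \<open>Slow growth of intervals forces the corner condition\<close>

text \<open>
  The upper bound of the quasi-geodesic condition, with quasi-geodesics cut into \<open>N\<close> equal steps.
\<close>

definition coarse_paths :: "'a::metric_space itself \<Rightarrow> real \<Rightarrow> real \<Rightarrow> bool" where
  "coarse_paths _ L Q \<longleftrightarrow> L > 0 \<and> Q > 0 \<and> (\<forall>(x::'a) y N. N \<ge> 1 \<longrightarrow>
     (\<exists>v::nat \<Rightarrow> 'a. v 0 = x \<and> v N = y \<and>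
        (\<forall>k<N. dist (v k) (v (Suc k)) \<le> L * dist x y / real N + Q)))"

lemma quasi_geodesic_coarse_paths:
  assumes "quasi_geodesic (UNIV :: 'a::metric_space set)"
  obtains L Q where "coarse_paths TYPE('a) L Q"
proof -
  obtain L Q :: real where LQ: "L > 0" "Q > 0" and \<gamma>: "\<forall>x\<in>(UNIV::'a set). \<forall>y\<in>UNIV. \<exists>\<gamma>. \<gamma> ` {0..dist x y} \<subseteq> UNIV \<and> \<gamma> 0 = x \<and> \<gamma> (dist x y) = y \<and>
         (\<forall>s\<in>{0..dist x y}. \<forall>t\<in>{0..dist x y}.
            inverse L * \<bar>s - t\<bar> - Q \<le> dist (\<gamma> s) (\<gamma> t) \<and>
            dist (\<gamma> s) (\<gamma> t) \<le> L * \<bar>s - t\<bar> + Q)"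
    using assms unfolding quasi_geodesic_def by (elim exE conjE) (rule that)
  have "\<exists>v::nat \<Rightarrow> 'a. v 0 = x \<and> v N = y \<and>
        (\<forall>k<N. dist (v k) (v (Suc k)) \<le> L * dist x y / real N + Q)" if N: "N \<ge> 1" for x y :: 'a and N
  proof -
    have "\<exists>\<gamma>. \<gamma> ` {0..dist x y} \<subseteq> UNIV \<and> \<gamma> 0 = x \<and> \<gamma> (dist x y) = y \<and>
       (\<forall>s\<in>{0..dist x y}. \<forall>t\<in>{0..dist x y}.
          inverse L * \<bar>s - t\<bar> - Q \<le> dist (\<gamma> s) (\<gamma> t) \<and> dist (\<gamma> s) (\<gamma> t) \<le> L * \<bar>s - t\<bar> + Q)"
      using \<gamma> by simp
    then obtain \<gamma> where g: "\<gamma> 0 = x" "\<gamma> (dist x y) = y"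
      and gl': "\<forall>s\<in>{0..dist x y}. \<forall>t\<in>{0..dist x y}.
        inverse L * \<bar>s - t\<bar> - Q \<le> dist (\<gamma> s) (\<gamma> t) \<and> dist (\<gamma> s) (\<gamma> t) \<le> L * \<bar>s - t\<bar> + Q"
      by (elim exE conjE) (rule that)
    have gl: "dist (\<gamma> s) (\<gamma> t) \<le> L * \<bar>s - t\<bar> + Q" if "s \<in> {0..dist x y}" "t \<in> {0..dist x y}" for s t
      using gl' that by blast
    let ?d = "dist x y / real N"
    have "dist (\<gamma> (real k * ?d)) (\<gamma> (real (Suc k) * ?d)) \<le> L * dist x y / real N + Q" if k: "k < N" for k
    proof -
      have le: "real j * ?d \<in> {0..dist x y}" if "j \<le> N" for j
      proof -
        have "real j * ?d \<le> real N * ?d" using that by (intro mult_right_mono) auto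
        then show ?thesis using N by auto
      qed
      have "real (Suc k) * ?d = real k * ?d + ?d" by (simp only: of_nat_Suc distrib_right mult_1 add.commute)
      then have "\<bar>real k * ?d - real (Suc k) * ?d\<bar> = ?d" by simp
      then show ?thesis using gl[OF le[of k] le[of "Suc k"]] k by simp
    qed
    then show ?thesis using N g by (intro exI[of _ "\<lambda>k. \<gamma> (real k * ?d)"]) auto
  qed
  then show thesis using LQ by (intro that[of L Q]) (simp add: coarse_paths_def)
qed

lemma (in coarse_constants) interval_idem: "dist (\<mu> a x b) (\<mu> a (\<mu> a x b) b) \<le> \<kappa>"
proof -
  have "\<mu> b a b = b" by (metis mu12 mu23 mu_idem)
  then have "\<mu> x a (\<mu> b a b) = \<mu> a x b" by (metis mu12)
  moreover have "\<mu> (\<mu> x a b) a b = \<mu> a (\<mu> a x b) b" by (metis mu12)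
  ultimately show ?thesis using four[of x a b b] by (simp add: dist_commute)
qed

text \<open>
  A discrete intermediate value theorem: a quasi-geodesic from \<open>a\<close> to \<open>e\<close>, projected to the interval
  between them, makes bounded steps, so its distance from \<open>a\<close> takes every value between 0 and \<open>dist a e\<close>
  up to a bounded error.
\<close>

lemma (in coarse_constants) interval_intermediate:
  assumes "coarse_paths TYPE('a) L Q" and \<rho>: "0 \<le> \<rho>" "\<rho> \<le> dist a e"
  shows "\<exists>f\<in>interval \<mu> a e. \<rho> \<le> dist a f \<and> dist a f \<le> \<rho> + (K * (L + Q) + H)"
proof -
  define N where "N = nat \<lceil>dist a e\<rceil> + 1"
  have N: "N \<ge> 1" "dist a e \<le> real N" unfolding N_def by linarith+
  have L: "L > 0" using assms(1) by (simp add: coarse_paths_def)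
  obtain v where v: "v 0 = a" "v N = e" "\<And>k. k < N \<Longrightarrow> dist (v k) (v (Suc k)) \<le> L * dist a e / real N + Q"
    using assms(1) N(1) unfolding coarse_paths_def by metis
  let ?f = "\<lambda>k. \<mu> a (v k) e"
  have f0: "?f 0 = a" using v by (simp add: mu_idem)
  have fN: "?f N = e" using v by (metis mu12 mu23 mu_idem)
  have step: "dist (?f k) (?f (Suc k)) \<le> K * (L + Q) + H" if k: "k < N" for k
  proof -
    have "L * dist a e / real N \<le> L" using N L by (simp add: field_simps)
    then have 1: "dist (v k) (v (Suc k)) \<le> L + Q" using v(3)[OF k] by linarith
    have "dist (?f k) (?f (Suc k)) \<le> K * dist (v k) (v (Suc k)) + H" by (metis lip mu12)
    moreover have "K * dist (v k) (v (Suc k)) \<le> K * (L + Q)" using 1 K by (intro mult_left_mono) auto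
    ultimately show ?thesis by linarith
  qed
  define k where "k = (LEAST k. \<rho> \<le> dist a (?f k))"
  have ex: "\<rho> \<le> dist a (?f N)" using fN \<rho> by simp
  have k: "\<rho> \<le> dist a (?f k)" unfolding k_def using ex by (rule LeastI)
  have kN: "k \<le> N" unfolding k_def using ex by (rule Least_le)
  have s0: "K * (L + Q) + H \<ge> 0" using K H assms(1) by (simp add: coarse_paths_def)
  have "dist a (?f k) \<le> \<rho> + (K * (L + Q) + H)"
  proof (cases k)
    case 0
    then have "dist a (?f k) = 0" using f0 by simp
    then show ?thesis using \<rho> s0 by linarith
  next
    case (Suc j)
    then have "\<not> \<rho> \<le> dist a (?f j)" unfolding k_def by (metis lessI not_less_Least)
    moreover have "dist a (?f k) \<le> dist a (?f j) + dist (?f j) (?f k)" by (rule dist_triangle)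
    ultimately show ?thesis using step[of j] Suc kN by simp
  qed
  then show ?thesis using k by (intro bexI[of _ "?f k"]) (auto simp: interval_def)
qed

text \<open>The join of \<open>x 0, \<dots>, x (k - 1)\<close> in the order from \<open>a\<close> to \<open>b\<close>.\<close>

primrec join_upto :: "('b \<Rightarrow> 'b \<Rightarrow> 'b \<Rightarrow> 'b) \<Rightarrow> 'b \<Rightarrow> 'b \<Rightarrow> (nat \<Rightarrow> 'b) \<Rightarrow> nat \<Rightarrow> 'b" where
  "join_upto m a b x 0 = a"
| "join_upto m a b x (Suc k) = m (x k) (join_upto m a b x k) b"

lemma join_upto_majority:
  assumes "A \<noteq> B"
  shows "join_upto majority A B F k \<noteq> A \<longleftrightarrow> (\<exists>i<k. F i \<noteq> A)"
proof (induction k)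
  case (Suc k)
  have "join_upto majority A B F (Suc k) \<noteq> A \<longleftrightarrow> F k \<noteq> A \<or> join_upto majority A B F k \<noteq> A"
    using assms by (auto simp: majority_def)
  then show ?case using Suc by (auto simp: less_Suc_eq)
qed auto

lemma join_upto_majority_const: "join_upto majority A A F k = A" if "\<And>i. i < k \<Longrightarrow> F i = A"
  using that by (induction k) (auto simp: majority_def)

text \<open>
  The configurations over which constants are uniform: directions \<open>e i\<close> at \<open>a\<close> towards \<open>b\<close>,
  pairwise disjoint up to \<open>t\<close>, and a point \<open>f i\<close> on each of them. Membership in intervals is also
  relaxed to an error \<open>t\<close>, so that the points produced by one application of the next lemma
  are admitted in another.
\<close>

definition corner_config ::
  "('a::metric_space \<Rightarrow> 'a \<Rightarrow> 'a \<Rightarrow> 'a) \<Rightarrow> nat \<Rightarrow> real \<Rightarrow> ('a \<times> 'a \<times> (nat \<Rightarrow> 'a) \<times> (nat \<Rightarrow> 'a)) set" where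
  "corner_config \<mu> n t = {(a, b, e, f).
     (\<forall>i\<le>n. dist (e i) (\<mu> a (e i) b) \<le> t \<and> dist (f i) (\<mu> a (f i) (e i)) \<le> t) \<and>
     (\<forall>i\<le>n. \<forall>j\<le>n. i \<noteq> j \<longrightarrow> dist (\<mu> (e i) a (e j)) a \<le> t)}"

text \<open>
  In a median algebra the \<open>f i\<close> are coordinates: the join of the \<open>f i\<close> projects to \<open>f i\<close> on the \<open>i\<close>-th
  edge, and it lies below the join of the \<open>e i\<close>. By \<open>coarse_identity\<close> it suffices to
  see this on truth values, where at most one \<open>e i\<close> differs from \<open>a\<close>.
\<close>

lemma (in coarse_constants) corner_config_identities:
  obtains C where "C \<ge> 0" "\<And>a b e f i j. (a, b, e, f) \<in> corner_config \<mu> n t \<Longrightarrow> i \<le> n \<Longrightarrow> j \<le> n \<Longrightarrow>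
    dist (f i) (\<mu> a (f i) b) \<le> C \<and>
    (i \<noteq> j \<longrightarrow> dist (\<mu> (f i) a (f j)) a \<le> C) \<and>
    dist (\<mu> a (join_upto \<mu> a b f (Suc n)) (e i)) (f i) \<le> C \<and>
    dist (\<mu> a (join_upto \<mu> a b f (Suc n)) (join_upto \<mu> a b e (Suc n))) (join_upto \<mu> a b f (Suc n)) \<le> C"
proof -
  let ?S = "corner_config \<mu> n t"
  define A :: "'a \<times> 'a \<times> (nat \<Rightarrow> 'a) \<times> (nat \<Rightarrow> 'a) \<Rightarrow> 'a" where "A c = fst c" for c
  define B :: "'a \<times> 'a \<times> (nat \<Rightarrow> 'a) \<times> (nat \<Rightarrow> 'a) \<Rightarrow> 'a" where "B c = fst (snd c)" for c
  define E :: "nat \<Rightarrow> 'a \<times> 'a \<times> (nat \<Rightarrow> 'a) \<times> (nat \<Rightarrow> 'a) \<Rightarrow> 'a" where "E i c = fst (snd (snd c)) i" for i c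
  define F :: "nat \<Rightarrow> 'a \<times> 'a \<times> (nat \<Rightarrow> 'a) \<times> (nat \<Rightarrow> 'a) \<Rightarrow> 'a" where "F i c = snd (snd (snd c)) i" for i c
  note defs = A_def B_def E_def F_def
  define JE where "JE c = join_upto \<mu> (A c) (B c) (\<lambda>i. E i c) (Suc n)" for c
  define JF where "JF c = join_upto \<mu> (A c) (B c) (\<lambda>i. F i c) (Suc n)" for c
  have n1: "near ?S (E i) (\<lambda>c. \<mu> (A c) (E i c) (B c))" if "i \<le> n" for i
    by (rule nearI[of _ _ _ t]) (use that in \<open>auto simp: corner_config_def defs\<close>)
  have n2: "near ?S (F i) (\<lambda>c. \<mu> (A c) (F i c) (E i c))" if "i \<le> n" for i
    by (rule nearI[of _ _ _ t]) (use that in \<open>auto simp: corner_config_def defs\<close>)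
  have n3: "near ?S (\<lambda>c. \<mu> (E i c) (A c) (E j c)) A" if "i \<le> n" "j \<le> n" "i \<noteq> j" for i j
    by (rule nearI[of _ _ _ t]) (use that in \<open>auto simp: corner_config_def defs\<close>)
  have main: "near ?S (F i) (\<lambda>c. \<mu> (A c) (F i c) (B c))"
    "i \<noteq> j \<Longrightarrow> near ?S (\<lambda>c. \<mu> (F i c) (A c) (F j c)) A"
    "near ?S (\<lambda>c. \<mu> (A c) (JF c) (E i c)) (F i)"
    "near ?S (\<lambda>c. \<mu> (A c) (JF c) (JE c)) JF" if ij: "i \<le> n" "j \<le> n" for i j
  proof -
    have hom: "(\<phi> (F i) = majority (\<phi> A) (\<phi> (F i)) (\<phi> B)) \<and>
       (i \<noteq> j \<longrightarrow> majority (\<phi> (F i)) (\<phi> A) (\<phi> (F j)) = \<phi> A) \<and>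
       majority (\<phi> A) (\<phi> JF) (\<phi> (E i)) = \<phi> (F i) \<and> majority (\<phi> A) (\<phi> JF) (\<phi> JE) = \<phi> JF"
      if \<phi>: "hom_on ?S \<phi>" for \<phi>
    proof -
      note med = hom_onD(2)[OF \<phi>]
      have e: "\<phi> (E i) = majority (\<phi> A) (\<phi> (E i)) (\<phi> B)" if "i \<le> n" for i
        by (rule trans[OF hom_onD(1)[OF \<phi> n1[OF that]] med])
      have f: "\<phi> (F i) = majority (\<phi> A) (\<phi> (F i)) (\<phi> (E i))" if "i \<le> n" for i
        by (rule trans[OF hom_onD(1)[OF \<phi> n2[OF that]] med])
      have ee: "majority (\<phi> (E i)) (\<phi> A) (\<phi> (E j)) = \<phi> A" if "i \<le> n" "j \<le> n" "i \<noteq> j" for i j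
        by (rule trans[OF med[symmetric] hom_onD(1)[OF \<phi> n3[OF that]]])
      have J: "\<phi> (\<lambda>c. join_upto \<mu> (A c) (B c) (\<lambda>i. G i c) k) = join_upto majority (\<phi> A) (\<phi> B) (\<lambda>i. \<phi> (G i)) k" for G k
        by (induction k) (auto simp: med)
      have JE: "\<phi> JE = join_upto majority (\<phi> A) (\<phi> B) (\<lambda>i. \<phi> (E i)) (Suc n)"
        unfolding JE_def by (rule J)
      have JF: "\<phi> JF = join_upto majority (\<phi> A) (\<phi> B) (\<lambda>i. \<phi> (F i)) (Suc n)"
        unfolding JF_def by (rule J)
      show ?thesis
      proof (cases "\<phi> A = \<phi> B")
        case True
        have eA: "\<phi> (E i) = \<phi> A" if "i \<le> n" for i using e[OF that] True by (auto simp: majority_def)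
        have fA: "\<phi> (F i) = \<phi> A" if "i \<le> n" for i using f[OF that] eA[OF that] by (auto simp: majority_def)
        have "\<phi> JE = \<phi> A" "\<phi> JF = \<phi> A"
          unfolding JE JF True[symmetric] by (rule join_upto_majority_const; simp add: eA fA less_Suc_eq_le)+
        then show ?thesis using eA fA ij True by (auto simp: majority_def)
      next
        case False
        have JE': "\<phi> JE \<noteq> \<phi> A \<longleftrightarrow> (\<exists>i\<le>n. \<phi> (E i) \<noteq> \<phi> A)"
          unfolding JE join_upto_majority[OF False] less_Suc_eq_le ..
        have JF': "\<phi> JF \<noteq> \<phi> A \<longleftrightarrow> (\<exists>i\<le>n. \<phi> (F i) \<noteq> \<phi> A)"
          unfolding JF join_upto_majority[OF False] less_Suc_eq_le ..
        have fe: "\<phi> (F i) \<noteq> \<phi> A \<Longrightarrow> \<phi> (E i) \<noteq> \<phi> A" if "i \<le> n" for i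
          using f[OF that] by (auto simp: majority_def)
        have uniq: "i = j" if "i \<le> n" "j \<le> n" "\<phi> (E i) \<noteq> \<phi> A" "\<phi> (E j) \<noteq> \<phi> A" for i j
          using ee[OF that(1,2)] that(3,4) by (auto simp: majority_def)
        have c1: "\<phi> (F i) = majority (\<phi> A) (\<phi> (F i)) (\<phi> B)"
          using False by (auto simp: majority_def)
        have c2: "i \<noteq> j \<longrightarrow> majority (\<phi> (F i)) (\<phi> A) (\<phi> (F j)) = \<phi> A"
          using uniq[OF ij] fe[OF ij(1)] fe[OF ij(2)] by (auto simp: majority_def)
        have "(\<phi> JF \<noteq> \<phi> A \<and> \<phi> (E i) \<noteq> \<phi> A) \<longleftrightarrow> \<phi> (F i) \<noteq> \<phi> A"
          using JF' fe uniq ij(1) by metis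
        then have c3: "majority (\<phi> A) (\<phi> JF) (\<phi> (E i)) = \<phi> (F i)"
          by (auto simp: majority_def)
        have "\<phi> JF \<noteq> \<phi> A \<Longrightarrow> \<phi> JE \<noteq> \<phi> A" using JE' JF' fe by metis
        then have c4: "majority (\<phi> A) (\<phi> JF) (\<phi> JE) = \<phi> JF" by (auto simp: majority_def)
        show ?thesis using c1 c2 c3 c4 by blast
      qed
    qed
    show "near ?S (F i) (\<lambda>c. \<mu> (A c) (F i c) (B c))"
    proof (rule coarse_identity)
      fix \<phi> assume \<phi>: "hom_on ?S \<phi>"
      show "\<phi> (F i) = \<phi> (\<lambda>c. \<mu> (A c) (F i c) (B c))"
        using hom[OF \<phi>] unfolding hom_onD(2)[OF \<phi>] by (elim conjE)
    qed
    show "near ?S (\<lambda>c. \<mu> (F i c) (A c) (F j c)) A" if "i \<noteq> j"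
    proof (rule coarse_identity)
      fix \<phi> assume \<phi>: "hom_on ?S \<phi>"
      show "\<phi> (\<lambda>c. \<mu> (F i c) (A c) (F j c)) = \<phi> A"
        using hom[OF \<phi>] that unfolding hom_onD(2)[OF \<phi>] by blast
    qed
    show "near ?S (\<lambda>c. \<mu> (A c) (JF c) (E i c)) (F i)"
    proof (rule coarse_identity)
      fix \<phi> assume \<phi>: "hom_on ?S \<phi>"
      show "\<phi> (\<lambda>c. \<mu> (A c) (JF c) (E i c)) = \<phi> (F i)"
        using hom[OF \<phi>] unfolding hom_onD(2)[OF \<phi>] by (elim conjE)
    qed
    show "near ?S (\<lambda>c. \<mu> (A c) (JF c) (JE c)) JF"
    proof (rule coarse_identity)
      fix \<phi> assume \<phi>: "hom_on ?S \<phi>"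
      show "\<phi> (\<lambda>c. \<mu> (A c) (JF c) (JE c)) = \<phi> JF"
        using hom[OF \<phi>] unfolding hom_onD(2)[OF \<phi>] by (elim conjE)
    qed
  qed
  obtain C1 where C1: "\<And>i. i \<le> n \<Longrightarrow> \<forall>c\<in>?S. dist (F i c) (\<mu> (A c) (F i c) (B c)) \<le> C1 i"
    using main(1)[OF _ le0] unfolding near_def by metis
  obtain C2 where C2: "\<And>i j. i \<le> n \<Longrightarrow> j \<le> n \<Longrightarrow> i \<noteq> j \<Longrightarrow> \<forall>c\<in>?S. dist (\<mu> (F i c) (A c) (F j c)) (A c) \<le> C2 i j"
    using main(2) unfolding near_def by metis
  obtain C3 where C3: "\<And>i. i \<le> n \<Longrightarrow> \<forall>c\<in>?S. dist (\<mu> (A c) (JF c) (E i c)) (F i c) \<le> C3 i"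
    using main(3)[OF _ le0] unfolding near_def by metis
  obtain C4 where C4: "\<forall>c\<in>?S. dist (\<mu> (A c) (JF c) (JE c)) (JF c) \<le> C4"
    using main(4)[OF le0 le0] unfolding near_def by metis
  let ?X = "{0, C4} \<union> C1 ` {..n} \<union> (\<lambda>(i,j). C2 i j) ` ({..n} \<times> {..n}) \<union> C3 ` {..n}"
  have X: "finite ?X" by auto
  define C where "C = Max ?X"
  have C: "x \<le> C" if "x \<in> ?X" for x unfolding C_def using X that by (rule Max_ge)
  show thesis
  proof (rule that[of C])
    show "C \<ge> 0" by (rule C) auto
    fix a b e f i j assume c: "(a, b, e, f) \<in> ?S" and ij: "i \<le> n" "j \<le> n"
    have "C1 i \<le> C" "C2 i j \<le> C" "C3 i \<le> C" "C4 \<le> C" using ij by (auto intro!: C)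
    moreover have "dist (f i) (\<mu> a (f i) b) \<le> C1 i" using C1[OF ij(1)] c by (force simp: defs)
    moreover have "dist (\<mu> (f i) a (f j)) a \<le> C2 i j" if "i \<noteq> j" using C2[OF ij that] c by (force simp: defs)
    moreover have "dist (\<mu> a (join_upto \<mu> a b f (Suc n)) (e i)) (f i) \<le> C3 i"
      using bspec[OF C3[OF ij(1)] c] by (simp add: defs JF_def)
    moreover have "dist (\<mu> a (join_upto \<mu> a b f (Suc n)) (join_upto \<mu> a b e (Suc n))) (join_upto \<mu> a b f (Suc n)) \<le> C4"
      using bspec[OF C4 c] by (simp add: defs JF_def JE_def)
    ultimately show "dist (f i) (\<mu> a (f i) b) \<le> C \<and>
      (i \<noteq> j \<longrightarrow> dist (\<mu> (f i) a (f j)) a \<le> C) \<and>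
      dist (\<mu> a (join_upto \<mu> a b f (Suc n)) (e i)) (f i) \<le> C \<and>
      dist (\<mu> a (join_upto \<mu> a b f (Suc n)) (join_upto \<mu> a b e (Suc n))) (join_upto \<mu> a b f (Suc n)) \<le> C"
      by (meson order_trans)
  qed
qed

lemma (in coarse_constants) dist_join_upto:
  assumes M: "\<And>i. i < k \<Longrightarrow> dist (x i) (\<mu> a (x i) b) + dist a (x i) + H \<le> M" and M0: "M \<ge> 0"
  shows "dist a (join_upto \<mu> a b x k) \<le> M * real k * K ^ k"
  using M
proof (induction k)
  case 0
  then show ?case by simp
next
  case (Suc k)
  let ?J = "join_upto \<mu> a b x k"
  have IH: "dist a ?J \<le> M * real k * K ^ k" using Suc by simp
  have "dist (\<mu> (x k) ?J b) (\<mu> a (x k) b) \<le> K * dist a ?J + H"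
    using lip[of ?J "x k" b a] mu12[of ?J "x k" b] by (simp add: dist_commute)
  moreover have "dist (x k) (\<mu> a (x k) b) + dist a (x k) + H \<le> M" using Suc.prems by simp
  moreover have "dist a (\<mu> (x k) ?J b) \<le> dist a (x k) + dist (x k) (\<mu> (x k) ?J b)"
    "dist (x k) (\<mu> (x k) ?J b) \<le> dist (x k) (\<mu> a (x k) b) + dist (\<mu> a (x k) b) (\<mu> (x k) ?J b)"
    by (rule dist_triangle)+
  ultimately have "dist a (\<mu> (x k) ?J b) \<le> M + K * dist a ?J" by (simp add: dist_commute)
  also have "\<dots> \<le> M * K ^ Suc k + K * (M * real k * K ^ k)"
  proof (intro add_mono mult_left_mono IH)
    have "1 \<le> K ^ Suc k" using K by (rule one_le_power)
    then show "M \<le> M * K ^ Suc k" using M0 by (metis mult.right_neutral mult_left_mono)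
  qed (use K in auto)
  also have "\<dots> = M * real (Suc k) * K ^ Suc k" by (simp add: algebra_simps)
  finally show ?case by simp
qed

text \<open>
  If the corner condition fails, there are corners with \<open>n + 1\<close> long edges. Shorten all edges to
  length about \<open>R\<close> and choose on each of them about \<open>R / s2\<close> points at distances from \<open>a\<close> that are
  spaced by \<open>s2\<close>. The joins of one point from each edge fill a coarse cube: they are distinct, because
  each coordinate can be recovered up to a bounded error, and they lie near the interval from
  \<open>a\<close> to the join \<open>b'\<close> of the edges, whose distance from \<open>a\<close> is of order \<open>R\<close>. Their
  projections to it remain distinct, so it has at least \<open>(R / s2) ^ (n + 1)\<close> points, against the assumed growth.
\<close>

proposition (in coarse_constants) corner_condition_of_slow_growth:
  assumes paths: "coarse_paths TYPE('a) L Q"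
    and lim: "((\<lambda>r. p r / r ^ (n + 1)) \<longlongrightarrow> 0) at_top" and growth: "interval_growth_le \<mu> p"
  shows "corner_condition \<mu> n"
  unfolding corner_condition_def
proof (rule allI, rule ccontr)
  fix s assume no: "\<nexists>C. \<forall>a b (e :: nat \<Rightarrow> 'a). (\<forall>i\<le>n. e i \<in> interval \<mu> a b) \<and>
     (\<forall>i\<le>n. \<forall>j\<le>n. i \<noteq> j \<longrightarrow> dist (\<mu> (e i) a (e j)) a \<le> s) \<longrightarrow> (\<exists>i\<le>n. dist (e i) a \<le> C)"
  define s1 where "s1 = K * (L + Q) + H"
  have s1: "s1 \<ge> 0" using K H paths by (simp add: coarse_paths_def s1_def)
  define t0 where "t0 = max s \<kappa>"
  obtain C0 where C0: "C0 \<ge> 0" "\<And>a b e f i j. (a, b, e, f) \<in> corner_config \<mu> n t0 \<Longrightarrow> i \<le> n \<Longrightarrow> j \<le> n \<Longrightarrow>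
    dist (f i) (\<mu> a (f i) b) \<le> C0 \<and> (i \<noteq> j \<longrightarrow> dist (\<mu> (f i) a (f j)) a \<le> C0) \<and>
    dist (\<mu> a (join_upto \<mu> a b f (Suc n)) (e i)) (f i) \<le> C0 \<and>
    dist (\<mu> a (join_upto \<mu> a b f (Suc n)) (join_upto \<mu> a b e (Suc n))) (join_upto \<mu> a b f (Suc n)) \<le> C0"
    by (rule corner_config_identities[of n t0]) (rule that)
  define t1 where "t1 = max C0 \<kappa>"
  obtain C1 where C1: "C1 \<ge> 0" "\<And>a b e f i j. (a, b, e, f) \<in> corner_config \<mu> n t1 \<Longrightarrow> i \<le> n \<Longrightarrow> j \<le> n \<Longrightarrow>
    dist (f i) (\<mu> a (f i) b) \<le> C1 \<and> (i \<noteq> j \<longrightarrow> dist (\<mu> (f i) a (f j)) a \<le> C1) \<and>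
    dist (\<mu> a (join_upto \<mu> a b f (Suc n)) (e i)) (f i) \<le> C1 \<and>
    dist (\<mu> a (join_upto \<mu> a b f (Suc n)) (join_upto \<mu> a b e (Suc n))) (join_upto \<mu> a b f (Suc n)) \<le> C1"
    by (rule corner_config_identities[of n t1]) (rule that)
  have t1: "t1 \<ge> 0" "C0 \<le> t1" "\<kappa> \<le> t1" using \<kappa> by (auto simp: t1_def)
  \<comment> \<open>A coordinate is recovered from a point of the cube with error \<open>D\<close>; the spacing \<open>s2\<close> exceeds this
    even after the error \<open>s1\<close> in the choice of the points.\<close>
  define D where "D = K * (2 * C1) + H + 2 * C1"
  have D: "D \<ge> 0" using K H C1 by (simp add: D_def)
  define s2 where "s2 = s1 + D + 1"
  have s2: "s2 > 0" "s2 - s1 > D" using s1 D by (auto simp: s2_def)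
  \<comment> \<open>The length of the diagonal of the cube is at most \<open>c * R\<close>, and \<open>\<delta>\<close> turns this into the number of points.\<close>
  define c where "c = (1 + s1 + t1 + H) * real (Suc n) * K ^ Suc n"
  have c: "c > 0" using s1 t1 H K by (simp add: c_def)
  define \<delta> where "\<delta> = 1 / (c * s2) ^ (n + 1)"
  have \<delta>: "\<delta> > 0" using c s2 by (simp add: \<delta>_def)
  have "eventually (\<lambda>r. p r / r ^ (n + 1) < \<delta>) at_top" using order_tendstoD(2)[OF lim \<delta>] .
  then obtain r0 where r0: "\<And>r. r \<ge> r0 \<Longrightarrow> p r / r ^ (n + 1) < \<delta>" by (auto simp: eventually_at_top_linorder)
  define R where "R = max 1 (K * max 1 r0 + C1 + H)"
  have R: "R \<ge> 1" "R \<ge> K * max 1 r0 + C1 + H" by (auto simp: R_def)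
  have "\<not> (\<forall>a b (e :: nat \<Rightarrow> 'a). (\<forall>i\<le>n. e i \<in> interval \<mu> a b) \<and>
     (\<forall>i\<le>n. \<forall>j\<le>n. i \<noteq> j \<longrightarrow> dist (\<mu> (e i) a (e j)) a \<le> s) \<longrightarrow> (\<exists>i\<le>n. dist (e i) a \<le> R))"
    using no by (rule contrapos_nn) (rule exI)
  then obtain a b and e0 :: "nat \<Rightarrow> 'a" where e0: "\<forall>i\<le>n. e0 i \<in> interval \<mu> a b"
     "\<forall>i\<le>n. \<forall>j\<le>n. i \<noteq> j \<longrightarrow> dist (\<mu> (e0 i) a (e0 j)) a \<le> s" "\<not> (\<exists>i\<le>n. dist (e0 i) a \<le> R)"
    unfolding not_all not_imp by (elim exE conjE) (rule that)
  have in_int: "dist x (\<mu> u x v) \<le> \<kappa>" if "x \<in> interval \<mu> u v" for x u v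
    using that interval_idem by (auto simp: interval_def)
  \<comment> \<open>Shorten the edges to length about \<open>R\<close>.\<close>
  have "\<exists>f\<in>interval \<mu> a (e0 i). R \<le> dist a f \<and> dist a f \<le> R + s1" if "i \<le> n" for i
    unfolding s1_def
  proof (rule interval_intermediate[OF paths])
    show "0 \<le> R" using R by simp
    have "\<not> dist (e0 i) a \<le> R" using e0(3) that by blast
    then show "R \<le> dist a (e0 i)" by (simp add: dist_commute)
  qed
  then obtain e where e: "\<And>i. i \<le> n \<Longrightarrow> e i \<in> interval \<mu> a (e0 i)"
    and eR: "\<And>i. i \<le> n \<Longrightarrow> R \<le> dist a (e i)" "\<And>i. i \<le> n \<Longrightarrow> dist a (e i) \<le> R + s1" by metis
  have cfg0: "(a, b, e0, e) \<in> corner_config \<mu> n t0"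
  proof -
    have "dist (e0 i) (\<mu> a (e0 i) b) \<le> t0" "dist (e i) (\<mu> a (e i) (e0 i)) \<le> t0" if "i \<le> n" for i
      using in_int[of "e0 i" a b] in_int[OF e[OF that]] e0(1) that by (auto simp: t0_def)
    moreover have "dist (\<mu> (e0 i) a (e0 j)) a \<le> t0" if "i \<le> n" "j \<le> n" "i \<noteq> j" for i j
    proof -
      have "dist (\<mu> (e0 i) a (e0 j)) a \<le> s" using e0(2) that by blast
      then show ?thesis by (simp add: t0_def)
    qed
    ultimately show ?thesis by (simp add: corner_config_def)
  qed
  have eb: "dist (e i) (\<mu> a (e i) b) \<le> t1" if "i \<le> n" for i
    using C0(2)[OF cfg0 that that] t1 by linarith
  have ee: "dist (\<mu> (e i) a (e j)) a \<le> t1" if "i \<le> n" "j \<le> n" "i \<noteq> j" for i j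
    using C0(2)[OF cfg0 that(1,2)] that(3) t1 by linarith
  have cfg: "(a, b, e, f) \<in> corner_config \<mu> n t1" if "\<And>i. i \<le> n \<Longrightarrow> f i \<in> interval \<mu> a (e i)" for f
  proof -
    have "dist (f i) (\<mu> a (f i) (e i)) \<le> t1" if "i \<le> n" for i
      using in_int[OF \<open>\<And>i. i \<le> n \<Longrightarrow> f i \<in> interval \<mu> a (e i)\<close>[OF that]] t1 by linarith
    then show ?thesis using eb ee by (simp add: corner_config_def)
  qed
  define b' where "b' = join_upto \<mu> a b e (Suc n)"
  have "dist a b' \<le> (R + s1 + t1 + H) * real (Suc n) * K ^ Suc n" unfolding b'_def
  proof (rule dist_join_upto)
    fix i assume "i < Suc n"
    then show "dist (e i) (\<mu> a (e i) b) + dist a (e i) + H \<le> R + s1 + t1 + H"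
      using eb[of i] eR(2)[of i] by simp
  qed (use R s1 t1 H in simp)
  also have "\<dots> \<le> (R * (1 + s1 + t1 + H)) * real (Suc n) * K ^ Suc n"
  proof (intro mult_right_mono)
    have "1 * (s1 + t1 + H) \<le> R * (s1 + t1 + H)" using R s1 t1 H by (intro mult_right_mono) auto
    then show "R + s1 + t1 + H \<le> R * (1 + s1 + t1 + H)" by (simp add: algebra_simps)
  qed (use K in auto)
  also have "\<dots> = c * R" by (simp add: c_def)
  finally have upper: "dist a b' \<le> c * R" .
  have e_self: "e i \<in> interval \<mu> a (e i)" for i
  proof -
    have "e i = \<mu> a (e i) (e i)" by (metis mu12 mu23 mu_idem)
    then show ?thesis unfolding interval_def by blast
  qed
  have lower: "max 1 r0 \<le> dist a b'"
  proof -
    have 1: "dist (\<mu> a b' (e 0)) (e 0) \<le> C1"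
      using C1(2)[OF cfg[OF e_self], of 0 0] by (simp add: b'_def)
    have "dist (\<mu> a a (e 0)) (\<mu> a b' (e 0)) \<le> K * dist a b' + H" using lip mu12 by metis
    then have 2: "dist a (\<mu> a b' (e 0)) \<le> K * dist a b' + H" by (simp add: mu_idem)
    have "dist a (e 0) \<le> dist a (\<mu> a b' (e 0)) + dist (\<mu> a b' (e 0)) (e 0)" by (rule dist_triangle)
    then have "K * max 1 r0 \<le> K * dist a b'" using 1 2 eR(1)[of 0] R by simp
    then show ?thesis using K by simp
  qed
  define q where "q = nat \<lfloor>R / s2\<rfloor>"
  have q: "real q * s2 \<le> R" "R / s2 < real (Suc q)"
  proof -
    have "R / s2 \<ge> 0" using R s2 by simp
    then have "real q \<le> R / s2" "R / s2 < real (Suc q)" unfolding q_def by linarith+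
    then show "real q * s2 \<le> R" "R / s2 < real (Suc q)" using s2 by (auto simp: field_simps)
  qed
  have "\<exists>f\<in>interval \<mu> a (e i). real k * s2 \<le> dist a f \<and> dist a f \<le> real k * s2 + s1" if "i \<le> n" "k \<le> q" for i k
    unfolding s1_def
  proof (rule interval_intermediate[OF paths])
    show "0 \<le> real k * s2" using s2 by simp
    have "real k * s2 \<le> real q * s2" using that s2 by (intro mult_right_mono) auto
    then show "real k * s2 \<le> dist a (e i)" using q eR(1)[OF that(1)] by linarith
  qed
  then obtain f where f: "\<And>i k. i \<le> n \<Longrightarrow> k \<le> q \<Longrightarrow> f i k \<in> interval \<mu> a (e i)"
    and fd: "\<And>i k. i \<le> n \<Longrightarrow> k \<le> q \<Longrightarrow> real k * s2 \<le> dist a (f i k)"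
      "\<And>i k. i \<le> n \<Longrightarrow> k \<le> q \<Longrightarrow> dist a (f i k) \<le> real k * s2 + s1" by metis
  define J where "J \<sigma> = join_upto \<mu> a b (\<lambda>i. f i (\<sigma> i)) (Suc n)" for \<sigma>
  let ?I = "{..n} \<rightarrow>\<^sub>E {..q}"
  have \<sigma>q: "\<sigma> i \<le> q" if "\<sigma> \<in> ?I" "i \<le> n" for \<sigma> i using that by (auto simp: PiE_def Pi_def)
  have J1: "dist (\<mu> a (J \<sigma>) (e i)) (f i (\<sigma> i)) \<le> C1" and J2: "dist (\<mu> a (J \<sigma>) b') (J \<sigma>) \<le> C1"
    if "\<sigma> \<in> ?I" "i \<le> n" for \<sigma> i
    using C1(2)[OF cfg[of "\<lambda>i. f i (\<sigma> i)"], of i i] f \<sigma>q[OF that(1)] that(2) by (simp_all add: J_def b'_def)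
  have inj: "inj_on (\<lambda>\<sigma>. \<mu> a (J \<sigma>) b') ?I"
  proof (rule inj_onI)
    fix \<sigma> \<tau> assume \<sigma>: "\<sigma> \<in> ?I" and \<tau>: "\<tau> \<in> ?I" and eq: "\<mu> a (J \<sigma>) b' = \<mu> a (J \<tau>) b'"
    have JJ: "dist (J \<sigma>) (J \<tau>) \<le> 2 * C1"
      using J2[OF \<sigma> le0] J2[OF \<tau> le0] eq dist_triangle[of "J \<sigma>" "J \<tau>" "\<mu> a (J \<sigma>) b'"]
      by (simp add: dist_commute)
    have near: "dist (f i (\<sigma> i)) (f i (\<tau> i)) \<le> D" if i: "i \<le> n" for i
    proof -
      have "dist (\<mu> a (J \<sigma>) (e i)) (\<mu> a (J \<tau>) (e i)) \<le> K * dist (J \<sigma>) (J \<tau>) + H" using lip mu12 by metis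
      moreover have "K * dist (J \<sigma>) (J \<tau>) \<le> K * (2 * C1)" using JJ K by (intro mult_left_mono) auto
      moreover have "dist (f i (\<sigma> i)) (f i (\<tau> i)) \<le> dist (f i (\<sigma> i)) (\<mu> a (J \<sigma>) (e i)) + dist (\<mu> a (J \<sigma>) (e i)) (f i (\<tau> i))"
        "dist (\<mu> a (J \<sigma>) (e i)) (f i (\<tau> i)) \<le> dist (\<mu> a (J \<sigma>) (e i)) (\<mu> a (J \<tau>) (e i)) + dist (\<mu> a (J \<tau>) (e i)) (f i (\<tau> i))"
        by (rule dist_triangle)+
      ultimately show ?thesis using J1[OF \<sigma> i] J1[OF \<tau> i] by (simp add: D_def dist_commute)
    qed
    have nless: "\<not> \<alpha> i < \<beta> i" if i: "i \<le> n" and ab: "\<alpha> \<in> ?I" "\<beta> \<in> ?I" "dist (f i (\<alpha> i)) (f i (\<beta> i)) \<le> D" for i \<alpha> \<beta>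
    proof
      assume "\<alpha> i < \<beta> i"
      then have "real (\<alpha> i) + 1 \<le> real (\<beta> i)" by simp
      then have "(real (\<alpha> i) + 1) * s2 \<le> real (\<beta> i) * s2" using s2 by (intro mult_right_mono) auto
      moreover have "real (\<beta> i) * s2 \<le> dist a (f i (\<beta> i))" by (rule fd(1)[OF i \<sigma>q[OF ab(2) i]])
      moreover have "dist a (f i (\<alpha> i)) \<le> real (\<alpha> i) * s2 + s1" by (rule fd(2)[OF i \<sigma>q[OF ab(1) i]])
      moreover have "dist a (f i (\<beta> i)) \<le> dist a (f i (\<alpha> i)) + dist (f i (\<alpha> i)) (f i (\<beta> i))" by (rule dist_triangle)
      ultimately have "s2 \<le> s1 + D" using ab(3) by (simp add: distrib_right)
      then show False using s2 by simp
    qed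
    have "\<sigma> i = \<tau> i" if i: "i \<le> n" for i
      using nless[OF i \<sigma> \<tau> near[OF i]] nless[OF i \<tau> \<sigma>] near[OF i] by (simp add: dist_commute)
    then show "\<sigma> = \<tau>" using \<sigma> \<tau> by (intro PiE_ext) auto
  qed
  have fin: "finite (interval \<mu> a b')" and cardp: "real (card (interval \<mu> a b')) \<le> p (dist a b')"
    using growth by (auto simp: interval_growth_le_def)
  have "card ?I \<le> card (interval \<mu> a b')"
    by (rule card_inj_on_le[OF inj _ fin]) (auto simp: interval_def)
  then have "(Suc q) ^ Suc n \<le> card (interval \<mu> a b')" by (simp add: card_PiE)
  then have "real (Suc q) ^ Suc n \<le> real (card (interval \<mu> a b'))"
    by (metis of_nat_le_iff of_nat_power)
  moreover have "(R / s2) ^ Suc n < real (Suc q) ^ Suc n"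
    using q R s2 by (intro power_strict_mono) auto
  moreover have "p (dist a b') < (R / s2) ^ Suc n"
  proof -
    have r: "dist a b' \<ge> 1" "dist a b' \<ge> r0" using lower by auto
    have pos: "dist a b' ^ (n + 1) > 0" using r(1) by (intro zero_less_power) linarith
    have "p (dist a b') < \<delta> * dist a b' ^ (n + 1)"
      using r0[OF r(2)] by (simp only: pos_divide_less_eq[OF pos])
    also have "\<dots> \<le> \<delta> * (c * R) ^ (n + 1)"
      using upper \<delta> by (intro mult_left_mono power_mono) auto
    also have "\<dots> = (R / s2) ^ Suc n" using c s2 by (simp add: \<delta>_def power_mult_distrib power_divide)
    finally show ?thesis .
  qed
  ultimately show False using cardp by linarith
qed

section \<open>Decomposition of orders into chains\<close>

definition antichain :: "'a::order set \<Rightarrow> bool" where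
  "antichain A \<longleftrightarrow> (\<forall>x\<in>A. \<forall>y\<in>A. x \<le> y \<longrightarrow> x = y)"

definition chain_colouring :: "('a::order \<Rightarrow> nat) \<Rightarrow> 'a set \<Rightarrow> nat \<Rightarrow> bool" where
  "chain_colouring c W n \<longleftrightarrow> c ` W \<subseteq> {..<n} \<and> (\<forall>x\<in>W. \<forall>y\<in>W. c x = c y \<longrightarrow> x \<le> y \<or> y \<le> x)"

lemma chain_colouringD:
  assumes "chain_colouring c W n"
  shows "c ` W \<subseteq> {..<n}" and "x \<in> W \<Longrightarrow> y \<in> W \<Longrightarrow> c x = c y \<Longrightarrow> x \<le> y \<or> y \<le> x"
  using assms unfolding chain_colouring_def by auto

text \<open>
  Galvin's proof. Remove a maximal element \<open>a\<close> and colour the rest \<open>V\<close> with as many colours as the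
  largest antichain of \<open>V\<close> has elements. Let \<open>M i\<close> be the top element of colour \<open>i\<close> that lies
  in a largest antichain; the \<open>M i\<close> form an antichain. If no \<open>M i\<close> is below \<open>a\<close>, adding \<open>a\<close> gives a larger
  antichain and \<open>a\<close> may have a new colour. Otherwise \<open>a\<close> and the elements of colour \<open>i\<close> up to \<open>M i\<close>
  form a chain, whose removal leaves only antichains smaller than the largest one.
\<close>

theorem dilworth:
  fixes W :: "'a::order set"
  assumes "finite W" and "\<And>A. A \<subseteq> W \<Longrightarrow> antichain A \<Longrightarrow> card A \<le> n"
  shows "\<exists>c. chain_colouring c W n"
  using assms
proof (induction W arbitrary: n rule: finite_psubset_induct)
  case (psubset W)
  show ?case
  proof (cases "W = {}")
    case True
    then show ?thesis by (auto simp: chain_colouring_def)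
  next
    case False
    obtain a where a: "a \<in> W" and amax: "\<And>x. x \<in> W \<Longrightarrow> a \<le> x \<Longrightarrow> x = a"
      using finite_has_maximal[OF \<open>finite W\<close> False] by metis
    define V where "V = W - {a}"
    have V: "V \<subset> W" "finite V" using a \<open>finite W\<close> by (auto simp: V_def)
    define k where "k = Max (card ` {A. A \<subseteq> V \<and> antichain A})"
    have fin: "finite (card ` {A. A \<subseteq> V \<and> antichain A})" using V(2) by auto
    have ne: "card ` {A. A \<subseteq> V \<and> antichain A} \<noteq> {}" by (auto simp: antichain_def)
    have le_k: "card A \<le> k" if "A \<subseteq> V" "antichain A" for A
      unfolding k_def using fin that by (intro Max_ge) auto
    obtain A0 where A0: "A0 \<subseteq> V" "antichain A0" "card A0 = k"
      using Max_in[OF fin ne] unfolding k_def by auto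
    have kn: "k \<le> n" using psubset.prems[of A0] A0 V by auto
    obtain c where "chain_colouring c V k" using psubset.IH[OF V(1) le_k] by blast
    note c = chain_colouringD(1)[OF this] and cc = chain_colouringD(2)[OF this]
    \<comment> \<open>an antichain of maximal size has exactly one element of each colour\<close>
    have transversal: "c ` A = {..<k}" if A: "A \<subseteq> V" "antichain A" "card A = k" for A
    proof -
      have "inj_on c A"
      proof (rule inj_onI)
        fix x y assume "x \<in> A" "y \<in> A" "c x = c y"
        then show "x = y" using cc[of x y] A unfolding antichain_def by blast
      qed
      then have "card (c ` A) = k" using A by (simp add: card_image)
      moreover have "c ` A \<subseteq> {..<k}" using c A by auto
      ultimately show ?thesis by (intro card_subset_eq) auto
    qed
    define B where "B i = {x \<in> V. c x = i \<and> (\<exists>A. A \<subseteq> V \<and> antichain A \<and> card A = k \<and> x \<in> A)}" for i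
    have "\<exists>x\<in>B i. \<forall>y\<in>B i. x \<le> y \<longrightarrow> x = y" if "i < k" for i
    proof -
      have "i \<in> c ` A0" using transversal[OF A0] that by simp
      then obtain x where "x \<in> A0" "c x = i" by auto
      then have "x \<in> B i" using A0 by (auto simp: B_def)
      moreover have "finite (B i)" using V by (auto simp: B_def)
      ultimately show ?thesis using finite_has_maximal[of "B i"] by fast
    qed
    then have "\<forall>i\<in>{..<k}. \<exists>x. x \<in> B i \<and> (\<forall>y\<in>B i. x \<le> y \<longrightarrow> x = y)" by blast
    from bchoice[OF this] obtain M where "\<forall>i\<in>{..<k}. M i \<in> B i \<and> (\<forall>y\<in>B i. M i \<le> y \<longrightarrow> M i = y)"
      by (rule exE)
    then have M: "\<And>i. i < k \<Longrightarrow> M i \<in> B i" and M0: "\<And>i y. i < k \<Longrightarrow> y \<in> B i \<Longrightarrow> M i \<le> y \<Longrightarrow> M i = y"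
      by simp_all
    have MV: "M i \<in> V" "c (M i) = i" if "i < k" for i using M[OF that] by (auto simp: B_def)
    have Mmax: "y \<le> M i" if "i < k" "y \<in> B i" for i y
      using cc[of "M i" y] MV[OF that(1)] M0[OF that] that(2) by (auto simp: B_def)
    have Minc: "\<not> M j \<le> M i" if ij: "i < k" "j < k" "i \<noteq> j" for i j
    proof
      assume le: "M j \<le> M i"
      obtain A where A: "A \<subseteq> V" "antichain A" "card A = k" "M i \<in> A" using M[OF ij(1)] by (auto simp: B_def)
      have "j \<in> c ` A" using transversal[OF A(1-3)] ij(2) by simp
      then obtain y where y: "y \<in> A" "c y = j" by auto
      have "y \<in> B j" using y A by (auto simp: B_def)
      then have "y \<le> M i" using Mmax[OF ij(2)] le by (meson order_trans)
      then have "y = M i" using A y by (auto simp: antichain_def)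
      then show False using y(2) MV(2)[OF ij(1)] ij by simp
    qed
    show ?thesis
    proof (cases "\<exists>i<k. M i \<le> a")
      case False
      let ?A = "insert a (M ` {..<k})"
      have aM: "M i \<noteq> a" if "i < k" for i using MV[OF that] by (auto simp: V_def)
      have "inj_on M {..<k}" by (rule inj_onI) (use MV in \<open>metis lessThan_iff\<close>)
      then have "card ?A = Suc k" using aM by (subst card_insert_disjoint) (auto simp: card_image)
      moreover have "antichain ?A" unfolding antichain_def
      proof (intro ballI impI)
        fix x y assume "x \<in> ?A" "y \<in> ?A" "x \<le> y"
        then show "x = y" using False amax MV Minc V(1) by (auto simp: image_iff) blast+
      qed
      moreover have "?A \<subseteq> W" using a MV V(1) by auto
      ultimately have "Suc k \<le> n" using psubset.prems[of ?A] by simp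
      then have "(c(a := k)) ` W \<subseteq> {..<n}" using c by (auto simp: V_def)
      moreover have "\<forall>x\<in>W. \<forall>y\<in>W. (c(a := k)) x = (c(a := k)) y \<longrightarrow> x \<le> y \<or> y \<le> x"
        proof (intro ballI impI)
          fix x y assume xy: "x \<in> W" "y \<in> W" "(c(a := k)) x = (c(a := k)) y"
          have lt: "c z < k" if "z \<in> W" "z \<noteq> a" for z using c that by (auto simp: V_def)
          show "x \<le> y \<or> y \<le> x"
          proof (cases "x = a \<or> y = a")
            case True
            then have "x = y" using xy lt[of x] lt[of y] by (auto split: if_splits)
            then show ?thesis by simp
          next
            case False
            then show ?thesis using xy cc[of x y] by (auto simp: V_def)
          qed
        qed
      ultimately show ?thesis unfolding chain_colouring_def by blast
    next
      case True
      then obtain i where i: "i < k" "M i \<le> a" by blast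
      define C where "C = insert a {z \<in> V. c z = i \<and> z \<le> M i}"
      have "z \<le> a" if "z \<in> C" for z using that i(2) order_trans unfolding C_def by blast
      moreover have "x \<le> y \<or> y \<le> x" if "x \<in> C - {a}" "y \<in> C - {a}" for x y
        using that cc[of x y] by (auto simp: C_def)
      ultimately have C: "\<forall>x\<in>C. \<forall>y\<in>C. x \<le> y \<or> y \<le> x" by blast
      have small: "card A \<le> k - 1" if A: "A \<subseteq> W - C" "antichain A" for A
      proof (rule ccontr)
        assume "\<not> card A \<le> k - 1"
        moreover have AV: "A \<subseteq> V" using A by (auto simp: V_def C_def)
        ultimately have cA: "card A = k" using le_k[OF AV A(2)] by simp
        have "i \<in> c ` A" using transversal[OF AV A(2) cA] i by simp
        then obtain y where y: "y \<in> A" "c y = i" by auto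
        then have "y \<in> B i" using A AV cA by (auto simp: B_def)
        then have "y \<in> C" using Mmax[OF i(1)] y AV by (auto simp: C_def)
        then show False using y A by auto
      qed
      have "W - C \<subset> W" using a by (auto simp: C_def)
      from psubset.IH[OF this small] obtain d where "chain_colouring d (W - C) (k - 1)" by blast
      note d = chain_colouringD(1)[OF this] and dd = chain_colouringD(2)[OF this]
      let ?c = "\<lambda>x. if x \<in> C then k - 1 else d x"
      have "?c ` W \<subseteq> {..<n}" using d i kn by fastforce
      moreover have "x \<le> y \<or> y \<le> x" if xy: "x \<in> W" "y \<in> W" "?c x = ?c y" for x y
      proof -
        have lt: "d z < k - 1" if "z \<in> W" "z \<notin> C" for z using d that by auto
        show ?thesis
        proof (cases "x \<in> C")
          case True
          then have "y \<in> C" using xy lt[of y] by (auto split: if_splits)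
          then show ?thesis using True C by blast
        next
          case False
          then have "y \<notin> C" using xy lt[of x] by (auto split: if_splits)
          then show ?thesis using False xy dd by auto
        qed
      qed
      ultimately show ?thesis unfolding chain_colouring_def by (intro exI[of _ ?c]) blast
    qed
  qed
qed

text \<open>
  Take for the height of \<open>x\<close> the size of the longest chain of elements below \<open>x\<close>.
\<close>

lemma height_function:
  fixes R :: "'s \<Rightarrow> 's \<Rightarrow> bool"
  assumes fin: "finite S"
    and trans: "\<And>x y z. R x y \<Longrightarrow> R y z \<Longrightarrow> R x z" and irr: "\<And>x. \<not> R x x"
    and chains: "\<And>C. C \<subseteq> S \<Longrightarrow> (\<And>x y. x \<in> C \<Longrightarrow> y \<in> C \<Longrightarrow> x \<noteq> y \<Longrightarrow> R x y \<or> R y x) \<Longrightarrow> card C \<le> q"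
  shows "\<exists>f::'s \<Rightarrow> nat. (\<forall>x\<in>S. f x < q) \<and> (\<forall>x\<in>S. \<forall>y\<in>S. R x y \<longrightarrow> f x < f y)"
proof -
  define CH where "CH x = {C. C \<subseteq> {y \<in> S. R y x} \<and> (\<forall>u\<in>C. \<forall>v\<in>C. u \<noteq> v \<longrightarrow> R u v \<or> R v u)}" for x
  define f where "f x = Max (card ` CH x)" for x
  have finC: "finite (card ` CH x)" for x using fin by (auto simp: CH_def)
  have ne: "card ` CH x \<noteq> {}" for x by (auto simp: CH_def)
  have att: "\<exists>C\<in>CH x. card C = f x" for x using Max_in[OF finC ne, of x] unfolding f_def by auto
  have le: "card C \<le> f x" if "C \<in> CH x" for C x unfolding f_def using finC that by (intro Max_ge) auto
  have ext: "\<exists>C. C \<subseteq> S \<and> x \<in> C \<and> (\<forall>u\<in>C. u = x \<or> R u x) \<and>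
      (\<forall>u\<in>C. \<forall>v\<in>C. u \<noteq> v \<longrightarrow> R u v \<or> R v u) \<and> card C = Suc (f x)" if "x \<in> S" for x
  proof -
    obtain C where C: "C \<in> CH x" "card C = f x" using att by blast
    then have "x \<notin> C" "finite C" using irr fin by (auto simp: CH_def intro: finite_subset)
    then have "card (insert x C) = Suc (f x)" using C by simp
    then show ?thesis using C that by (intro exI[of _ "insert x C"]) (auto simp: CH_def)
  qed
  have "f x < q" if "x \<in> S" for x
  proof -
    obtain C where C: "C \<subseteq> S" "\<forall>u\<in>C. \<forall>v\<in>C. u \<noteq> v \<longrightarrow> R u v \<or> R v u" "card C = Suc (f x)" using ext[OF \<open>x \<in> S\<close>] by blast
    then have "card C \<le> q" by (intro chains) auto
    then show ?thesis using C by simp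
  qed
  moreover have "f x < f y" if xy: "x \<in> S" "y \<in> S" "R x y" for x y
  proof -
    obtain C where C: "C \<subseteq> S" "\<forall>u\<in>C. u = x \<or> R u x" "\<forall>u\<in>C. \<forall>v\<in>C. u \<noteq> v \<longrightarrow> R u v \<or> R v u" "card C = Suc (f x)"
      using ext[OF xy(1)] by blast
    have "R u y" if "u \<in> C" for u using C(2) xy(3) trans that by metis
    then have "C \<in> CH y" using C by (auto simp: CH_def)
    then show ?thesis using le[of C y] C by simp
  qed
  ultimately show ?thesis by blast
qed

section \<open>Separated sets in an interval of bounded rank\<close>

text \<open>
  Let the half-spaces of a chain \<open>Ch\<close> measure progress. If no close pair crosses all members of \<open>Ch\<close>
  between \<open>x s\<close> and \<open>x t\<close>, call \<open>t\<close> far ahead of \<open>s\<close>. A path of \<open>T\<close> close steps cannot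
  jump between points that are far apart: the first times at which it has passed the
  members of a sequence, each far ahead of the previous, are strictly increasing. So such
  sequences have length at most \<open>T + 1\<close>, and the height \<open>f\<close> in the order of being far ahead takes at most
  \<open>T + 1\<close> values. Of two points with the same height, neither is far ahead of the other.
\<close>

lemma separated_points_along_path:
  fixes close :: "'b \<Rightarrow> 'b \<Rightarrow> bool" and x :: "'s \<Rightarrow> 'b"
  assumes fin: "finite S" and finCh: "finite Ch" and chain: "\<And>U V. U \<in> Ch \<Longrightarrow> V \<in> Ch \<Longrightarrow> U \<subseteq> V \<or> V \<subseteq> U"
    and refl: "\<And>u. u \<in> P \<Longrightarrow> close u u"
    and xP: "x ` S \<subseteq> P"
    and path: "\<And>s t. s \<in> S \<Longrightarrow> t \<in> S \<Longrightarrow> \<exists>w. w 0 = x s \<and> w T = x t \<and> w ` {..T} \<subseteq> P \<and> (\<forall>k<T. close (w k) (w (Suc k)))"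
  shows "\<exists>f::'s \<Rightarrow> nat. f ` S \<subseteq> {..T} \<and> (\<forall>s\<in>S. \<forall>t\<in>S. f s = f t \<longrightarrow>
     (\<exists>u\<in>P. \<exists>v\<in>P. (close u v \<or> close v u) \<and>
        (\<forall>U\<in>Ch. (x s \<in> U) \<noteq> (x t \<in> U) \<longrightarrow> (u \<in> U) = (x s \<in> U) \<and> (v \<in> U) = (x t \<in> U))))"
proof -
  define c where "c p = {U \<in> Ch. p \<in> U}" for p
  have lin: "c p \<subseteq> c q \<or> c q \<subseteq> c p" for p q using chain unfolding c_def by blast
  define R where "R s t \<longleftrightarrow> s \<in> S \<and> t \<in> S \<and> c (x s) \<subseteq> c (x t) \<and>
     \<not> (\<exists>u\<in>P. \<exists>v\<in>P. close u v \<and> (\<forall>U\<in>c (x t) - c (x s). u \<notin> U \<and> v \<in> U))" for s t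
  have Rstrict: "c (x s) \<subset> c (x t)" if "R s t" for s t
  proof -
    have "c (x s) \<noteq> c (x t)"
    proof
      assume eq: "c (x s) = c (x t)"
      have "x s \<in> P" using that xP by (auto simp: R_def)
      then have "\<exists>u\<in>P. \<exists>v\<in>P. close u v \<and> (\<forall>U\<in>c (x t) - c (x s). u \<notin> U \<and> v \<in> U)" using refl eq by blast
      then show False using that by (simp add: R_def)
    qed
    then show ?thesis using that by (auto simp: R_def)
  qed
  have fc: "finite (c p)" for p using finCh by (simp add: c_def)
  have Rcard: "card (c (x s)) < card (c (x t))" if "R s t" for s t
    using Rstrict[OF that] fc by (intro psubset_card_mono)
  have cardC: "card C \<le> Suc T" if CS: "C \<subseteq> S" and CR: "\<And>s t. s \<in> C \<Longrightarrow> t \<in> C \<Longrightarrow> s \<noteq> t \<Longrightarrow> R s t \<or> R t s" for C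
  proof (cases "C = {}")
    case False
    have finC: "finite C" using CS fin finite_subset by blast
    let ?g = "\<lambda>s. card (c (x s))"
    have "\<exists>s0\<in>C. \<forall>s\<in>C. ?g s0 \<le> ?g s"
    proof -
      have "Min (?g ` C) \<in> ?g ` C" using finC False by (intro Min_in) auto
      then obtain s0 where "s0 \<in> C" "?g s0 = Min (?g ` C)" by auto
      then show ?thesis using finC by (intro bexI[of _ s0]) auto
    qed
    then obtain s0 where s0: "s0 \<in> C" "\<And>s. s \<in> C \<Longrightarrow> ?g s0 \<le> ?g s" by blast
    have "\<exists>s1\<in>C. \<forall>s\<in>C. ?g s \<le> ?g s1"
    proof -
      have "Max (?g ` C) \<in> ?g ` C" using finC False by (intro Max_in) auto
      then obtain s1 where "s1 \<in> C" "?g s1 = Max (?g ` C)" by auto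
      then show ?thesis using finC by (intro bexI[of _ s1]) auto
    qed
    then obtain s1 where s1: "s1 \<in> C" "\<And>s. s \<in> C \<Longrightarrow> ?g s \<le> ?g s1" by blast
    have lo: "c (x s0) \<subseteq> c (x s)" if "s \<in> C" for s
      using CR[OF s0(1) that] s0(2)[OF that] Rcard[of s s0] by (cases "s = s0") (auto simp: R_def)
    have hi: "c (x s) \<subseteq> c (x s1)" if "s \<in> C" for s
      using CR[OF s1(1) that] s1(2)[OF that] Rcard[of s1 s] by (cases "s = s1") (auto simp: R_def)
    have "\<exists>w. w 0 = x s0 \<and> w T = x s1 \<and> w ` {..T} \<subseteq> P \<and> (\<forall>k<T. close (w k) (w (Suc k)))"
      using s0(1) s1(1) CS by (intro path) auto
    then obtain w where w: "w 0 = x s0" "w T = x s1" "w ` {..T} \<subseteq> P" "\<forall>k<T. close (w k) (w (Suc k))"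
      by (elim exE conjE) (rule that)
    define \<tau> where "\<tau> s = (LEAST k. c (x s) \<subseteq> c (w k))" for s
    have \<tau>: "c (x s) \<subseteq> c (w (\<tau> s))" "\<tau> s \<le> T" if "s \<in> C" for s
    proof -
      have "c (x s) \<subseteq> c (w T)" using hi[OF that] w(2) by simp
      then show "c (x s) \<subseteq> c (w (\<tau> s))" "\<tau> s \<le> T" unfolding \<tau>_def by (rule LeastI, rule Least_le)
    qed
    have neq: "\<tau> s \<noteq> \<tau> t" if st: "s \<in> C" "t \<in> C" "R s t" for s t
    proof
      assume eq: "\<tau> s = \<tau> t"
      show False
      proof (cases "\<tau> s")
        case 0
        then have "c (x t) \<subseteq> c (x s0)" using \<tau>(1)[OF st(2)] eq w(1) by simp
        then show False using lo[OF st(1)] Rstrict[OF st(3)] by blast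
      next
        case (Suc k)
        then have "\<not> c (x s) \<subseteq> c (w k)" unfolding \<tau>_def by (metis lessI not_less_Least)
        then have below: "c (w k) \<subseteq> c (x s)" using lin by blast
        have above: "c (x t) \<subseteq> c (w (Suc k))" using \<tau>(1)[OF st(2)] eq Suc by simp
        have kT: "k < T" using \<tau>(2)[OF st(1)] Suc by simp
        have "w k \<in> P" "w (Suc k) \<in> P" using w(3) kT by auto
        moreover have "\<forall>U\<in>c (x t) - c (x s). w k \<notin> U \<and> w (Suc k) \<in> U"
          using below above by (auto simp: c_def)
        ultimately have "\<exists>u\<in>P. \<exists>v\<in>P. close u v \<and> (\<forall>U\<in>c (x t) - c (x s). u \<notin> U \<and> v \<in> U)"
          using w(4)[rule_format, OF kT] by (intro bexI[of _ "w k"] bexI[of _ "w (Suc k)"] conjI)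
        then show False using st(3) by (simp add: R_def)
      qed
    qed
    have "inj_on \<tau> C" by (rule inj_onI) (use neq CR in metis)
    moreover have "\<tau> ` C \<subseteq> {..T}" using \<tau>(2) by auto
    ultimately have "card C \<le> card {..T}" by (intro card_inj_on_le) auto
    then show ?thesis by simp
  qed simp
  have "\<exists>f::'s \<Rightarrow> nat. (\<forall>s\<in>S. f s < Suc T) \<and> (\<forall>s\<in>S. \<forall>t\<in>S. R s t \<longrightarrow> f s < f t)"
  proof (rule height_function[OF fin _ _ cardC])
    show "\<not> R s s" for s using Rstrict[of s s] by blast
    show "R s t" if "R s r" "R r t" for s r t
    proof -
      have "c (x s) \<subseteq> c (x r)" "c (x r) \<subseteq> c (x t)" using that by (auto simp: R_def)
      then show ?thesis using that unfolding R_def by blast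
    qed
  qed
  then obtain f where f: "\<And>s. s \<in> S \<Longrightarrow> f s < Suc T" and fR: "\<And>s t. s \<in> S \<Longrightarrow> t \<in> S \<Longrightarrow> R s t \<Longrightarrow> f s < f t" by blast
  have key: "\<exists>u\<in>P. \<exists>v\<in>P. close u v \<and> (\<forall>U\<in>Ch. (x s \<in> U) \<noteq> (x t \<in> U) \<longrightarrow> (u \<in> U) = (x s \<in> U) \<and> (v \<in> U) = (x t \<in> U))"
    if st: "s \<in> S" "t \<in> S" "f s = f t" and sub: "c (x s) \<subseteq> c (x t)" for s t
  proof -
    have "\<not> R s t" using fR st by fastforce
    then obtain u v where uv: "u \<in> P" "v \<in> P" "close u v" "\<forall>U\<in>c (x t) - c (x s). u \<notin> U \<and> v \<in> U"
      using st sub by (auto simp: R_def)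
    have "(u \<in> U) = (x s \<in> U) \<and> (v \<in> U) = (x t \<in> U)" if "U \<in> Ch" "(x s \<in> U) \<noteq> (x t \<in> U)" for U
    proof -
      have "U \<in> c (x t) - c (x s)" using that sub by (auto simp: c_def)
      then show ?thesis using uv(4) by (auto simp: c_def)
    qed
    then show ?thesis using uv by (intro bexI[of _ u] bexI[of _ v] conjI ballI impI) simp_all
  qed
  have "\<exists>u\<in>P. \<exists>v\<in>P. (close u v \<or> close v u) \<and>
        (\<forall>U\<in>Ch. (x s \<in> U) \<noteq> (x t \<in> U) \<longrightarrow> (u \<in> U) = (x s \<in> U) \<and> (v \<in> U) = (x t \<in> U))"
    if st: "s \<in> S" "t \<in> S" "f s = f t" for s t
  proof (cases "c (x s) \<subseteq> c (x t)")
    case True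
    from key[OF st True] show ?thesis by (elim bexE conjE) (intro bexI conjI disjI1)
  next
    case False
    then have "c (x t) \<subseteq> c (x s)" using lin by blast
    from key[OF st(2,1) st(3)[symmetric] this]
    obtain u v where uv: "u \<in> P" "v \<in> P" "close u v"
      and U: "\<forall>U\<in>Ch. (x t \<in> U) \<noteq> (x s \<in> U) \<longrightarrow> (u \<in> U) = (x t \<in> U) \<and> (v \<in> U) = (x s \<in> U)"
      by (elim bexE conjE) (rule that)
    have "(v \<in> U) = (x s \<in> U) \<and> (u \<in> U) = (x t \<in> U)" if "U \<in> Ch" "(x s \<in> U) \<noteq> (x t \<in> U)" for U
      using U[rule_format, OF that(1)] that(2) by simp
    then show ?thesis using uv by (intro bexI[of _ v] bexI[of _ u] conjI ballI impI disjI2) simp_all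
  qed
  then show ?thesis using f by (intro exI[of _ f] conjI ballI impI) (auto simp: less_Suc_eq_le)
qed

lemma halfspace_complement:
  assumes "halfspace P m U" and "\<And>x y z. x \<in> P \<Longrightarrow> y \<in> P \<Longrightarrow> z \<in> P \<Longrightarrow> m x y z \<in> P"
  shows "halfspace P m (P - U)"
  using assms unfolding halfspace_def majority_def by auto

text \<open>
  The half-spaces separating \<open>a\<close> from \<open>b\<close> contain no antichain with more than \<open>n\<close> members, so they
  fall into \<open>n\<close> chains. In each chain the points are sorted into at most \<open>T + 1\<close> levels, and two of
  them share all levels. The walls between their projections to the interval are then
  crossed by one close pair for each chain, and \<open>detour_bound\<close> applies.
\<close>

lemma (in coarse_constants) pigeonhole_in_interval:
  fixes x :: "'s \<Rightarrow> 'b"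
  assumes ma: "median_algebra P m" and finP: "finite P" and rank: "median_rank P m \<le> enat n"
    and l: "quasi_morphism P m \<mu> h l" and ab: "a \<in> P" "b \<in> P"
    and fin: "finite S" and xP: "x ` S \<subseteq> P" and \<theta>: "\<theta> \<ge> 0"
    and path: "\<And>s t. s \<in> S \<Longrightarrow> t \<in> S \<Longrightarrow> \<exists>w. w 0 = x s \<and> w T = x t \<and> w ` {..T} \<subseteq> P \<and>
      (\<forall>k<T. dist (l (w k)) (l (w (Suc k))) \<le> \<theta>)"
    and card: "card S > Suc T ^ n"
  shows "\<exists>s\<in>S. \<exists>t\<in>S. s \<noteq> t \<and>
    dist (l (m a (x s) b)) (l (m a (x t) b)) \<le> (2 ^ n - 1) * (K * \<theta> + H + 2 * h)"
proof -
  interpret median_algebra P m by (rule ma)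
  define W where "W = {U. halfspace P m U \<and> a \<notin> U \<and> b \<in> U}"
  have finW: "finite W" by (rule finite_subset[of _ "Pow P"]) (use finP in \<open>auto simp: W_def halfspace_def\<close>)
  have "card A \<le> n" if A: "A \<subseteq> W" "antichain A" for A
  proof -
    have "finite A" using A finW finite_subset by blast
    then obtain g where g: "bij_betw g {0..<card A} A" using ex_bij_betw_nat_finite by blast
    have gA: "g i \<in> A" if "i < card A" for i using g that by (auto simp: bij_betw_def)
    have "enat (card A) \<le> median_rank P m"
    proof (rule rank_ge_of_crossing[OF ma ab])
      show "halfspace P m (g i) \<and> a \<notin> g i \<and> b \<in> g i" if "i < card A" for i
        using gA[OF that] A by (auto simp: W_def)
      show "\<not> g i \<subseteq> g j" if "i < card A" "j < card A" "i \<noteq> j" for i j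
      proof
        assume "g i \<subseteq> g j"
        then have "g i = g j" using gA that A(2) unfolding antichain_def by blast
        then show False using g that by (auto simp: bij_betw_def dest: inj_onD)
      qed
    qed
    then have "enat (card A) \<le> enat n" using rank by (rule order_trans)
    then show ?thesis by simp
  qed
  from dilworth[OF finW this] obtain c where "chain_colouring c W n" by blast
  note c = chain_colouringD(1)[OF this] and cc = chain_colouringD(2)[OF this]
  define Ch where "Ch k = {U \<in> W. c U = k}" for k
  let ?close = "\<lambda>u v. dist (l u) (l v) \<le> \<theta>"
  \<comment> \<open>For the \<open>k\<close>-th chain, \<open>f\<close> sorts \<open>S\<close> into levels.\<close>
  define good where "good k f \<longleftrightarrow> f ` S \<subseteq> {..T} \<and> (\<forall>s\<in>S. \<forall>t\<in>S. f s = f t \<longrightarrow>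
     (\<exists>u\<in>P. \<exists>v\<in>P. (?close u v \<or> ?close v u) \<and>
        (\<forall>U\<in>Ch k. (x s \<in> U) \<noteq> (x t \<in> U) \<longrightarrow> (u \<in> U) = (x s \<in> U) \<and> (v \<in> U) = (x t \<in> U))))"
    for k and f :: "'s \<Rightarrow> nat"
  have "\<exists>f. good k f" for k
    unfolding good_def
  proof (rule separated_points_along_path[where close = ?close and P = P and T = T])
    show "finite (Ch k)" using finW by (simp add: Ch_def)
    show "U \<subseteq> V \<or> V \<subseteq> U" if "U \<in> Ch k" "V \<in> Ch k" for U V using that cc by (simp add: Ch_def)
  qed (use fin xP \<theta> path in auto)
  then obtain f where good: "\<And>k. good k (f k)" by metis
  have f: "f k ` S \<subseteq> {..T}" for k using good[of k] by (simp add: good_def)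
  have fuv: "\<exists>u\<in>P. \<exists>v\<in>P. (?close u v \<or> ?close v u) \<and>
        (\<forall>U\<in>Ch k. (x s \<in> U) \<noteq> (x t \<in> U) \<longrightarrow> (u \<in> U) = (x s \<in> U) \<and> (v \<in> U) = (x t \<in> U))"
    if "s \<in> S" "t \<in> S" "f k s = f k t" for k s t
    using good[of k, unfolded good_def, THEN conjunct2, rule_format, OF that] .
  define F where "F s = (\<lambda>k\<in>{..<n}. f k s)" for s
  have "F ` S \<subseteq> {..<n} \<rightarrow>\<^sub>E {..T}" using f by (force simp: F_def)
  then have "card (F ` S) \<le> card ({..<n} \<rightarrow>\<^sub>E {..T})" by (intro card_mono finite_PiE) auto
  also have "\<dots> = Suc T ^ n" by (simp add: card_PiE)
  finally have "card (F ` S) < card S" using card by simp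
  then have "\<not> inj_on F S" using card_image by fastforce
  then obtain s t where st: "s \<in> S" "t \<in> S" "s \<noteq> t" "F s = F t" by (auto simp: inj_on_def)
  have "f k s = f k t" if "k < n" for k using fun_cong[OF st(4), of k] that by (simp add: F_def)
  then have "\<exists>u v. u \<in> P \<and> v \<in> P \<and> ?close u v \<and>
     (\<forall>U\<in>Ch k. (x s \<in> U) \<noteq> (x t \<in> U) \<longrightarrow> (u \<in> U) = (x s \<in> U) \<and> (v \<in> U) = (x t \<in> U))" if "k < n" for k
    using fuv[OF st(1,2), of k] that by (auto simp: dist_commute)
  then obtain u v where uv: "\<And>k. k < n \<Longrightarrow> u k \<in> P \<and> v k \<in> P \<and> ?close (u k) (v k)"
    and uvU: "\<And>k U. k < n \<Longrightarrow> U \<in> Ch k \<Longrightarrow> (x s \<in> U) \<noteq> (x t \<in> U) \<Longrightarrow> (u k \<in> U) = (x s \<in> U) \<and> (v k \<in> U) = (x t \<in> U)"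
    by metis
  have P: "x s \<in> P" "x t \<in> P" using xP st by auto
  let ?x = "m a (x s) b" and ?y = "m a (x t) b"
  have "dist (l ?x) (l ?y) \<le> (2 ^ card {..<n} - 1) * (K * \<theta> + H + 2 * h)"
  proof (rule detour_bound[OF ma l, where u = u and v = v])
    show "u j \<in> P \<and> v j \<in> P \<and> dist (l (u j)) (l (v j)) \<le> \<theta>" if "j \<in> {..<n}" for j using uv that by simp
    fix U assume U: "halfspace P m U" and sep: "(?x \<in> U) \<noteq> (?y \<in> U)"
    have x': "?x \<in> U \<longleftrightarrow> majority (a \<in> U) (x s \<in> U) (b \<in> U)" and y': "?y \<in> U \<longleftrightarrow> majority (a \<in> U) (x t \<in> U) (b \<in> U)"
      using halfspaceD[OF U] ab P by auto
    have abU: "(a \<in> U) \<noteq> (b \<in> U)" using sep x' y' by (auto simp: majority_def)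
    have eq: "(?x \<in> U) = (x s \<in> U)" "(?y \<in> U) = (x t \<in> U)" using abU x' y' by (auto simp: majority_def)
    show "\<exists>j\<in>{..<n}. (u j \<in> U) = (?x \<in> U) \<and> (v j \<in> U) = (?y \<in> U)"
    proof (cases "a \<in> U")
      case False
      then have UW: "U \<in> W" using U abU by (simp add: W_def)
      then have "c U < n" "U \<in> Ch (c U)" using c by (auto simp: Ch_def)
      then show ?thesis using uvU[of "c U" U] sep eq by blast
    next
      case True
      have "halfspace P m (P - U)" using U closed by (rule halfspace_complement)
      then have UW: "P - U \<in> W" using True abU ab by (simp add: W_def)
      then have cU: "c (P - U) < n" "P - U \<in> Ch (c (P - U))" using c by (auto simp: Ch_def)
      then show ?thesis using uvU[OF cU] sep eq P uv[OF cU(1)] by blast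
    qed
  qed (use ab P in auto)
  then show ?thesis using st by auto
qed

definition separated :: "real \<Rightarrow> 'a::metric_space set \<Rightarrow> bool" where
  "separated \<delta> S \<longleftrightarrow> (\<forall>x\<in>S. \<forall>y\<in>S. x \<noteq> y \<longrightarrow> dist x y > \<delta>)"

text \<open>
  Suppose that the interval contains more than \<open>(c * s) ^ n\<close> points in a ball of radius \<open>D\<close> with mutual
  distances above \<open>D / s\<close>. Approximate some of them, together with \<open>a\<close>, \<open>b\<close> and coarse paths from the
  centre \<open>z\<close> to each of them, by a median algebra of rank at most \<open>n\<close>. The paths need a number of
  steps proportional to \<open>s\<close>, so the pigeonhole lemma gives two points whose distance is at most
  \<open>D / s\<close>. The number of points that are approximated depends on \<open>s\<close> alone, so for large \<open>D\<close> the
  error of the approximation is negligible; this is how \<open>D0\<close> depends on \<open>s\<close>.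
\<close>

proposition (in coarse_constants) card_separated_le:
  assumes paths: "coarse_paths TYPE('a) L Q" and rank: "coarse_rank_at_most \<mu> n"
  obtains c where "c \<ge> 1" "\<And>s. s \<ge> 1 \<Longrightarrow> \<exists>D0. \<forall>D\<ge>D0. \<forall>a b z S.
    finite S \<and> S \<subseteq> interval \<mu> a b \<inter> cball z D \<and> separated (D / s) S \<longrightarrow> real (card S) \<le> (c * s) ^ n"
proof -
  have LQ: "L > 0" "Q > 0" using paths by (auto simp: coarse_paths_def)
  obtain h :: "nat \<Rightarrow> real" where h: "\<forall>p. 0 \<le> h p" and approx: "\<forall>p. \<forall>A::'a set. finite A \<and> 1 \<le> card A \<and> card A \<le> p \<longrightarrow>
         (\<exists>(P::nat set) m \<pi> l.
            finite P \<and> median_algebra P m \<and> median_rank P m \<le> enat n \<and> \<pi> ` A \<subseteq> P \<and>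
            (\<forall>x\<in>P. \<forall>y\<in>P. \<forall>z\<in>P. dist (l (m x y z)) (\<mu> (l x) (l y) (l z)) \<le> h p) \<and>
            (\<forall>a\<in>A. dist a (l (\<pi> a)) \<le> h p))"
    using rank unfolding coarse_rank_at_most_def by (elim exE conjE) (rule that)
  \<comment> \<open>With steps of length \<open>\<theta> = D / (s * B)\<close> the main term of \<open>detour_bound\<close> is \<open>2 ^ n * K * \<theta> = D / (2 * s)\<close>,
    half of the separation. The number \<open>N\<close> of steps is chosen so that a step takes up half of \<open>\<theta>\<close>.\<close>
  define B where "B = 2 ^ n * 2 * K"
  have B: "B > 0" using K by (simp add: B_def)
  define c where "c = 4 * L * B + 3"
  have c: "c \<ge> 1" using LQ B by (simp add: c_def)
  show thesis
  proof (rule that[OF c])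
    fix s :: real assume s: "s \<ge> 1"
    define N where "N = nat \<lceil>2 * L * s * B\<rceil>"
    have pos: "2 * L * s * B > 0" using LQ s B by simp
    have N: "2 * L * s * B \<le> real N" "real N \<le> 2 * L * s * B + 1" "N \<ge> 1"
      using pos unfolding N_def by linarith+
    have T: "real (Suc (2 * N)) \<le> c * s"
    proof -
      have "real (Suc (2 * N)) \<le> 4 * L * s * B + 3" using N(2) by simp
      also have "\<dots> \<le> c * s" using s by (simp add: c_def algebra_simps)
      finally show ?thesis .
    qed
    define M where "M = nat \<lfloor>(c * s) ^ n\<rfloor>"
    have M: "(c * s) ^ n < real (Suc M)" unfolding M_def by linarith
    \<comment> \<open>A bound for the number of points to be approximated: one more than \<open>M\<close> separated points, the ends
      \<open>a\<close> and \<open>b\<close>, and \<open>N + 1\<close> points on each path.\<close>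
    define p where "p = Suc M + 2 + Suc M * Suc N"
    \<comment> \<open>The distance in \<open>X\<close> between a point of the interval and its approximation after projection to the
      interval from \<open>\<pi> a\<close> to \<open>\<pi> b\<close>.\<close>
    define e where "e = h p + K * (3 * h p) + 3 * H + \<kappa>"
    have hp: "h p \<ge> 0" using h by simp
    define D0 where "D0 = max 1 (max (2 * s * B * (Q + 2 * h p)) (2 * s * (2 * e + 2 ^ n * (H + 2 * h p))))"
    show "\<exists>D0. \<forall>D\<ge>D0. \<forall>a b z S. finite S \<and> S \<subseteq> interval \<mu> a b \<inter> cball z D \<and> separated (D / s) S \<longrightarrow>
       real (card S) \<le> (c * s) ^ n"
    proof (intro exI[of _ D0] allI impI, rule ccontr)
      fix D a b z S
      assume D: "D0 \<le> D" and S: "finite S \<and> S \<subseteq> interval \<mu> a b \<inter> cball z D \<and> separated (D / s) S"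
        and big: "\<not> real (card S) \<le> (c * s) ^ n"
      have D1: "D \<ge> 1" and D2: "Q + 2 * h p \<le> D / (2 * s * B)"
        and D3: "2 * e + 2 ^ n * (H + 2 * h p) \<le> D / (2 * s)"
        using D s B by (auto simp: D0_def field_simps)
      have "M \<le> card S" using big unfolding M_def by linarith
      moreover have "M \<noteq> card S"
      proof
        assume "M = card S"
        moreover have "0 \<le> (c * s) ^ n" using c s by simp
        then have "real M \<le> (c * s) ^ n" unfolding M_def by (rule of_nat_floor)
        ultimately show False using big by simp
      qed
      ultimately obtain R where R: "R \<subseteq> S" "card R = Suc M" "finite R"
        using obtain_subset_with_card_n[of "Suc M" S] by (metis Suc_leI le_neq_implies_less)
      have "\<exists>y. y 0 = z \<and> y N = x \<and> (\<forall>k<N. dist (y k) (y (Suc k)) \<le> L * dist z x / real N + Q)" for x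
        using paths N(3) unfolding coarse_paths_def by blast
      then obtain y where y: "\<And>x. y x 0 = z" "\<And>x. y x N = x"
        and ystep: "\<And>x k. k < N \<Longrightarrow> dist (y x k) (y x (Suc k)) \<le> L * dist z x / real N + Q" by metis
      define A where "A = R \<union> {a, b} \<union> (\<lambda>(x, k). y x k) ` (R \<times> {..N})"
      have finA: "finite A" using R by (simp add: A_def)
      have "card A \<le> card (R \<union> {a, b}) + card ((\<lambda>(x, k). y x k) ` (R \<times> {..N}))" unfolding A_def by (rule card_Un_le)
      moreover have "card (R \<union> {a, b}) \<le> card R + card {a, b}" by (rule card_Un_le)
      moreover have "card {a, b} \<le> 2" by (simp add: card_insert_if)
      moreover have "card ((\<lambda>(x, k). y x k) ` (R \<times> {..N})) \<le> card (R \<times> {..N})" using R by (intro card_image_le) simp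
      ultimately have cardA: "card A \<le> p" using R by (simp add: p_def card_cartesian_product)
      have "card A \<noteq> 0" using finA by (auto simp: A_def)
      then have "1 \<le> card A" by linarith
      then have "finite A \<and> 1 \<le> card A \<and> card A \<le> p" using finA cardA by blast
      from approx[rule_format, OF this] obtain P :: "nat set" and m \<pi> l where
        finP: "finite P" and ma: "median_algebra P m" and rk: "median_rank P m \<le> enat n" and \<pi>: "\<pi> ` A \<subseteq> P"
        and qm: "\<forall>x\<in>P. \<forall>y\<in>P. \<forall>z\<in>P. dist (l (m x y z)) (\<mu> (l x) (l y) (l z)) \<le> h p"
        and l\<pi>: "\<forall>a\<in>A. dist a (l (\<pi> a)) \<le> h p"
        by (elim exE conjE) (rule that)
      have l: "quasi_morphism P m \<mu> (h p) l" using qm by (simp add: quasi_morphism_def)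
      have inA: "a \<in> A" "b \<in> A" "\<And>x. x \<in> R \<Longrightarrow> x \<in> A" by (auto simp: A_def)
      have yA: "y x k \<in> A" if "x \<in> R" "k \<le> N" for x k
        unfolding A_def by (rule UnI2, rule image_eqI[of _ _ "(x, k)"]) (use that in auto)
      define \<theta> where "\<theta> = D / (s * B)"
      have step: "dist (l (\<pi> (y x k))) (l (\<pi> (y x (Suc k)))) \<le> \<theta>" if x: "x \<in> R" and k: "k < N" for x k
      proof -
        have "dist z x \<le> D" using x R S by auto
        then have "L * dist z x / real N \<le> L * D / real N" using LQ by (intro divide_right_mono mult_left_mono) auto
        also have "\<dots> \<le> L * D / (2 * L * s * B)" by (rule frac_le) (use N(1) pos LQ D1 in auto)
        also have "\<dots> = D / (2 * s * B)" using LQ by (simp add: field_simps)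
        finally have "dist (y x k) (y x (Suc k)) \<le> D / (2 * s * B) + Q" using ystep[OF k, of x] by linarith
        moreover have "dist (y x k) (l (\<pi> (y x k))) \<le> h p" "dist (y x (Suc k)) (l (\<pi> (y x (Suc k)))) \<le> h p"
          using l\<pi> yA[OF x] k by auto
        moreover have "dist (l (\<pi> (y x k))) (l (\<pi> (y x (Suc k)))) \<le>
          dist (l (\<pi> (y x k))) (y x k) + dist (y x k) (l (\<pi> (y x (Suc k))))"
          "dist (y x k) (l (\<pi> (y x (Suc k)))) \<le> dist (y x k) (y x (Suc k)) + dist (y x (Suc k)) (l (\<pi> (y x (Suc k))))"
          by (rule dist_triangle)+
        moreover have "\<theta> = D / (2 * s * B) + D / (2 * s * B)" using s B by (simp add: \<theta>_def field_simps)
        ultimately show ?thesis using D2 dist_commute[of "l (\<pi> (y x k))" "y x k"] by linarith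
      qed
      have path: "\<exists>w. w 0 = \<pi> u \<and> w (2 * N) = \<pi> v \<and> w ` {..2 * N} \<subseteq> P \<and>
        (\<forall>k<2 * N. dist (l (w k)) (l (w (Suc k))) \<le> \<theta>)" if uv: "u \<in> R" "v \<in> R" for u v
      proof -
        \<comment> \<open>Go back from \<open>u\<close> to the centre and from there to \<open>v\<close>.\<close>
        let ?w = "\<lambda>j. if j \<le> N then \<pi> (y u (N - j)) else \<pi> (y v (j - N))"
        have "dist (l (?w k)) (l (?w (Suc k))) \<le> \<theta>" if k: "k < 2 * N" for k
        proof (cases "k < N")
          case True
          then have "Suc (N - Suc k) = N - k" by simp
          then show ?thesis using step[OF uv(1), of "N - Suc k"] True by (simp add: dist_commute)
        next
          case False
          have "?w k = \<pi> (y v (k - N))" using False y(1) by (cases "k = N") auto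
          moreover have "?w (Suc k) = \<pi> (y v (Suc (k - N)))" using False by (simp add: Suc_diff_le)
          ultimately show ?thesis using step[OF uv(2), of "k - N"] k False by simp
        qed
        moreover have "?w ` {..2 * N} \<subseteq> P"
        proof (rule image_subsetI)
          fix j assume j: "j \<in> {..2 * N}"
          have "y u (N - j) \<in> A" by (rule yA[OF uv(1)]) simp
          moreover have "y v (j - N) \<in> A" by (rule yA[OF uv(2)]) (use j in simp)
          ultimately show "?w j \<in> P" using \<pi> by auto
        qed
        ultimately show ?thesis using y(2) N(3) by (intro exI[of _ ?w]) auto
      qed
      have "\<exists>u\<in>R. \<exists>v\<in>R. u \<noteq> v \<and>
        dist (l (m (\<pi> a) (\<pi> u) (\<pi> b))) (l (m (\<pi> a) (\<pi> v) (\<pi> b))) \<le> (2 ^ n - 1) * (K * \<theta> + H + 2 * h p)"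
      proof (rule pigeonhole_in_interval[OF ma finP rk l _ _ R(3) _ _ path])
        show "\<pi> a \<in> P" "\<pi> b \<in> P" "\<pi> ` R \<subseteq> P" using \<pi> inA by auto
        show "0 \<le> \<theta>" using D1 s B by (simp add: \<theta>_def)
        have "real (Suc (2 * N)) ^ n \<le> (c * s) ^ n" using T by (intro power_mono) auto
        then have "real (Suc (2 * N) ^ n) < real (card R)" using M R(2) by simp
        then show "Suc (2 * N) ^ n < card R" by (simp only: of_nat_less_iff)
      qed
      then obtain u v where uv: "u \<in> R" "v \<in> R" "u \<noteq> v"
        and close: "dist (l (m (\<pi> a) (\<pi> u) (\<pi> b))) (l (m (\<pi> a) (\<pi> v) (\<pi> b))) \<le> (2 ^ n - 1) * (K * \<theta> + H + 2 * h p)"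
        by (elim bexE conjE) (rule that)
      have err: "dist x (l (m (\<pi> a) (\<pi> x) (\<pi> b))) \<le> e" if x: "x \<in> R" for x
      proof -
        have "x \<in> interval \<mu> a b" using x R S by auto
        then have 1: "dist x (\<mu> a x b) \<le> \<kappa>" using interval_idem by (auto simp: interval_def)
        have P: "\<pi> a \<in> P" "\<pi> x \<in> P" "\<pi> b \<in> P" using \<pi> inA x by auto
        have 2: "dist (l (m (\<pi> a) (\<pi> x) (\<pi> b))) (\<mu> (l (\<pi> a)) (l (\<pi> x)) (l (\<pi> b))) \<le> h p"
          using quasi_morphismD[OF l P] .
        have "dist (\<mu> a x b) (\<mu> (l (\<pi> a)) (l (\<pi> x)) (l (\<pi> b))) \<le>
          K * (dist a (l (\<pi> a)) + dist x (l (\<pi> x)) + dist b (l (\<pi> b))) + 3 * H" by (rule lip3)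
        also have "\<dots> \<le> K * (3 * h p) + 3 * H"
        proof (intro add_right_mono mult_left_mono)
          have "dist a (l (\<pi> a)) \<le> h p" "dist x (l (\<pi> x)) \<le> h p" "dist b (l (\<pi> b)) \<le> h p"
            using l\<pi> inA x by auto
          then show "dist a (l (\<pi> a)) + dist x (l (\<pi> x)) + dist b (l (\<pi> b)) \<le> 3 * h p" by simp
        qed (use K in simp)
        finally have 3: "dist (\<mu> a x b) (\<mu> (l (\<pi> a)) (l (\<pi> x)) (l (\<pi> b))) \<le> K * (3 * h p) + 3 * H" .
        have "dist x (l (m (\<pi> a) (\<pi> x) (\<pi> b))) \<le> dist x (\<mu> a x b) + dist (\<mu> a x b) (l (m (\<pi> a) (\<pi> x) (\<pi> b)))"
          "dist (\<mu> a x b) (l (m (\<pi> a) (\<pi> x) (\<pi> b))) \<le>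
            dist (\<mu> a x b) (\<mu> (l (\<pi> a)) (l (\<pi> x)) (l (\<pi> b))) + dist (\<mu> (l (\<pi> a)) (l (\<pi> x)) (l (\<pi> b))) (l (m (\<pi> a) (\<pi> x) (\<pi> b)))"
          by (rule dist_triangle)+
        then show ?thesis using 1 2 3 by (simp add: e_def dist_commute)
      qed
      let ?lu = "l (m (\<pi> a) (\<pi> u) (\<pi> b))" and ?lv = "l (m (\<pi> a) (\<pi> v) (\<pi> b))"
      have "dist u v \<le> dist u ?lu + dist ?lu v" "dist ?lu v \<le> dist ?lu ?lv + dist ?lv v" by (rule dist_triangle)+
      then have "dist u v \<le> 2 * e + (2 ^ n - 1) * (K * \<theta> + H + 2 * h p)"
        using err[OF uv(1)] err[OF uv(2)] close by (simp add: dist_commute)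
      also have "\<dots> \<le> 2 * e + 2 ^ n * (K * \<theta> + H + 2 * h p)"
      proof (intro add_left_mono mult_right_mono)
        show "0 \<le> K * \<theta> + H + 2 * h p" using K H hp D1 s B by (simp add: \<theta>_def)
      qed simp
      also have "\<dots> = 2 ^ n * K * \<theta> + (2 * e + 2 ^ n * (H + 2 * h p))" by (simp add: algebra_simps)
      also have "2 ^ n * K * \<theta> = D / (2 * s)" using K s by (simp add: \<theta>_def B_def field_simps)
      also have "D / (2 * s) + (2 * e + 2 ^ n * (H + 2 * h p)) \<le> D / (2 * s) + D / (2 * s)" using D3 by simp
      also have "\<dots> = D / s" using s by (simp add: field_simps)
      finally have "dist u v \<le> D / s" .
      moreover have "dist u v > D / s" using S R uv unfolding separated_def by blast
      ultimately show False by simp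
    qed
  qed
qed

section \<open>Growth of intervals\<close>

lemma maximal_separated_subset:
  assumes fin: "finite X" and \<delta>: "\<delta> \<ge> 0"
  obtains Z where "Z \<subseteq> X" "separated \<delta> Z" "\<And>x. x \<in> X \<Longrightarrow> \<exists>z\<in>Z. dist z x \<le> \<delta>"
proof -
  let ?F = "{Z. Z \<subseteq> X \<and> separated \<delta> Z}"
  have "finite ?F" using fin by simp
  moreover have "{} \<in> ?F" by (simp add: separated_def)
  then have "?F \<noteq> {}" by blast
  ultimately have "\<exists>Z\<in>?F. \<forall>Y\<in>?F. Z \<subseteq> Y \<longrightarrow> Z = Y" by (rule finite_has_maximal)
  then obtain Z where Z: "Z \<in> ?F" and max: "\<forall>Y\<in>?F. Z \<subseteq> Y \<longrightarrow> Z = Y" by (elim bexE) (rule that)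
  have "\<exists>z\<in>Z. dist z x \<le> \<delta>" if x: "x \<in> X" for x
  proof (rule ccontr)
    assume no: "\<not> ?thesis"
    then have "insert x Z \<in> ?F" using Z x by (auto simp: separated_def not_le dist_commute)
    then have "x \<in> Z" using max by blast
    then show False using no \<delta> by auto
  qed
  then show thesis using Z that by blast
qed

text \<open>
  Iterating the inequality for a fixed \<open>s\<close> gives growth with exponent \<open>n\<close> plus
  \<open>n * log s c\<close>, which tends to \<open>n\<close> as \<open>s\<close> grows; \<open>s\<close> is taken so large that \<open>(c * s) ^ n \<le> s powr \<alpha>\<close>.
\<close>

lemma growth_bound_by_rescaling:
  fixes F :: "real \<Rightarrow> real"
  assumes mono: "\<And>x y. x \<le> y \<Longrightarrow> F x \<le> F y" and nonneg: "\<And>x. 0 \<le> F x" and c: "c \<ge> 1"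
    and step: "\<And>s. s \<ge> 1 \<Longrightarrow> \<exists>D0. \<forall>D\<ge>D0. F D \<le> (c * s) ^ n * F (D / s)"
    and \<alpha>: "\<alpha> > real n"
  shows "\<exists>B\<ge>0. \<forall>D\<ge>1. F D \<le> B * D powr \<alpha>"
proof -
  define s where "s = max 2 (c powr (real n / (\<alpha> - real n)))"
  have s: "s \<ge> 2" by (simp add: s_def)
  have "c powr real n = (c powr (real n / (\<alpha> - real n))) powr (\<alpha> - real n)" using \<alpha> by (simp add: powr_powr)
  also have "\<dots> \<le> s powr (\<alpha> - real n)" using \<alpha> by (intro powr_mono2) (auto simp: s_def)
  finally have "c powr real n * s powr real n \<le> s powr (\<alpha> - real n) * s powr real n" by (intro mult_right_mono) auto
  also have "\<dots> = s powr \<alpha>" by (simp add: powr_add[symmetric])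
  finally have cs: "(c * s) ^ n \<le> s powr \<alpha>"
    using c s by (simp add: powr_realpow power_mult_distrib)
  obtain D0 where D0: "\<And>D. D \<ge> D0 \<Longrightarrow> F D \<le> (c * s) ^ n * F (D / s)" using step[of s] s by auto
  define D1 where "D1 = max D0 s"
  have main: "F D \<le> F D1 * D powr \<alpha>" if "D \<ge> 1" "D \<le> D1 * s ^ k" for D k
    using that
  proof (induction k arbitrary: D)
    case 0
    have "F D1 * 1 \<le> F D1 * D powr \<alpha>" using 0 nonneg \<alpha> by (intro mult_left_mono ge_one_powr_ge_zero) auto
    then show ?case using mono[of D D1] 0 by simp
  next
    case (Suc k)
    show ?case
    proof (cases "D \<le> D1")
      case True
      have "F D1 * 1 \<le> F D1 * D powr \<alpha>" using Suc nonneg \<alpha> by (intro mult_left_mono ge_one_powr_ge_zero) auto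
      then show ?thesis using mono[of D D1] True by simp
    next
      case False
      then have D: "D \<ge> D0" "D \<ge> s" by (auto simp: D1_def)
      have "F (D / s) \<le> F D1 * (D / s) powr \<alpha>"
        using Suc.prems D s by (intro Suc.IH) (auto simp: field_simps)
      then have "(c * s) ^ n * F (D / s) \<le> s powr \<alpha> * (F D1 * (D / s) powr \<alpha>)"
        using cs nonneg c s by (intro mult_mono) auto
      also have "\<dots> = F D1 * D powr \<alpha>" using D s by (simp add: powr_divide)
      finally show ?thesis using D0[OF D(1)] by linarith
    qed
  qed
  have "F D \<le> F D1 * D powr \<alpha>" if D: "D \<ge> 1" for D
  proof -
    have D1: "D1 \<ge> 2" using s by (simp add: D1_def)
    obtain k where "D < s ^ k" using real_arch_pow[of s D] s by auto
    moreover have "s ^ k \<le> D1 * s ^ k" using D1 s by simp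
    ultimately show ?thesis using main[OF D, of k] by linarith
  qed
  then show ?thesis using nonneg by (intro exI[of _ "F D1"]) auto
qed

lemma smallo_powr_of_bound:
  fixes F :: "real \<Rightarrow> real"
  assumes B: "\<And>\<alpha>. \<alpha> > real n \<Longrightarrow> \<exists>B\<ge>0. \<forall>D\<ge>1. F D \<le> B * D powr \<alpha>" and nonneg: "\<And>x. 0 \<le> F x"
    and K: "K \<ge> 1" and H: "H \<ge> 0" and \<epsilon>: "\<epsilon> > 0"
  shows "(\<lambda>r. F (K * r + H)) \<in> o[at_top](\<lambda>r. r powr (real n + \<epsilon>))"
proof -
  define \<alpha> where "\<alpha> = real n + \<epsilon> / 2"
  obtain B where B: "B \<ge> 0" "\<And>D. D \<ge> 1 \<Longrightarrow> F D \<le> B * D powr \<alpha>" using B[of \<alpha>] \<epsilon> by (auto simp: \<alpha>_def)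
  have "(\<lambda>r. F (K * r + H)) \<in> O[at_top](\<lambda>r. r powr \<alpha>)"
  proof (rule bigoI[of _ "B * (K + H) powr \<alpha>"])
    show "eventually (\<lambda>r. norm (F (K * r + H)) \<le> B * (K + H) powr \<alpha> * norm (r powr \<alpha>)) at_top"
      using eventually_ge_at_top[of 1]
    proof eventually_elim
      case (elim r)
      have "1 * 1 \<le> K * r" using elim K by (intro mult_mono) auto
      then have 1: "K * r + H \<ge> 1" using H by linarith
      have "H * 1 \<le> H * r" using elim H by (intro mult_left_mono) auto
      then have 2: "K * r + H \<le> (K + H) * r" by (simp add: algebra_simps)
      have "F (K * r + H) \<le> B * (K * r + H) powr \<alpha>" using B(2)[OF 1] .
      also have "\<dots> \<le> B * ((K + H) * r) powr \<alpha>"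
        using B(1) 1 2 \<epsilon> by (intro mult_left_mono powr_mono2) (auto simp: \<alpha>_def)
      also have "\<dots> = B * (K + H) powr \<alpha> * r powr \<alpha>" using K H elim by (simp add: powr_mult)
      finally show ?case using nonneg by simp
    qed
  qed
  also have "(\<lambda>r::real. r powr \<alpha>) \<in> o[at_top](\<lambda>r. r powr (real n + \<epsilon>))"
    using \<epsilon> by (subst powr_smallo_iff[OF filterlim_ident]) (auto simp: \<alpha>_def)
  finally show ?thesis .
qed

text \<open>
  Let \<open>F D\<close> be the largest number of points in the intersection of an interval with a ball of radius
  \<open>D\<close>. A maximal separated subset of such an intersection covers it by smaller balls, so the bound on
  separated sets becomes the recursive inequality for \<open>F\<close>. Counting in balls, with the ends
  of the interval arbitrarily far apart, is what makes the recursion close: a small ball in an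
  interval need not lie in a small interval.
\<close>

proposition (in coarse_constants) growth_of_bounded_rank:
  assumes paths: "coarse_paths TYPE('a) L Q" and rank: "coarse_rank_at_most \<mu> n"
    and bg: "bounded_geometry (UNIV :: 'a set)"
  shows "\<exists>p. (\<forall>\<epsilon>>0. p \<in> o[at_top](\<lambda>r. r powr (real n + \<epsilon>))) \<and> interval_growth_le \<mu> p"
proof -
  have ball: "\<exists>N. \<forall>x::'a. finite (cball x r) \<and> card (cball x r) \<le> N" for r
  proof -
    have "\<exists>N. \<forall>x\<in>(UNIV :: 'a set). finite (cball x (max r 1) \<inter> UNIV) \<and> card (cball x (max r 1) \<inter> UNIV) \<le> N"
      using bg[unfolded bounded_geometry_def, THEN spec, of "max r 1"] by simp
    then obtain N where N: "\<And>x::'a. finite (cball x (max r 1)) \<and> card (cball x (max r 1)) \<le> N" by auto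
    have "cball x r \<subseteq> cball x (max r 1)" for x :: 'a by auto
    then show ?thesis using N by (meson card_mono finite_subset order_trans)
  qed
  define X where "X = (\<lambda>(a, b, z, D). interval \<mu> a b \<inter> cball z D)"
  have finX: "finite (X (a, b, z, D))" for a b z D using ball[of D] by (auto simp: X_def)
  define F where "F D = (SUP (a, b, z)\<in>UNIV. real (card (X (a, b, z, D))))" for D
  have bdd: "bdd_above ((\<lambda>(a, b, z). real (card (X (a, b, z, D)))) ` UNIV)" for D
  proof -
    obtain N where N: "\<And>x::'a. finite (cball x D) \<and> card (cball x D) \<le> N" using ball by blast
    have "card (X (a, b, z, D)) \<le> N" for a b z
      using card_mono[of "cball z D" "X (a, b, z, D)"] N[of z] by (auto simp: X_def)
    then show ?thesis by (intro bdd_aboveI[of _ "real N"]) auto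
  qed
  have F_upper: "real (card (X (a, b, z, D))) \<le> F D" for a b z D
    unfolding F_def using cSUP_upper[OF UNIV_I bdd[of D], of "(a, b, z)"] by simp
  have F_least: "F D \<le> M" if "\<And>a b z. real (card (X (a, b, z, D))) \<le> M" for D M
    unfolding F_def using that by (intro cSUP_least) auto
  have F0: "0 \<le> F D" for D using F_upper[of undefined undefined undefined D] by linarith
  have Fmono: "F D \<le> F E" if "D \<le> E" for D E
  proof (rule F_least)
    fix a b z
    have "card (X (a, b, z, D)) \<le> card (X (a, b, z, E))"
      using that finX by (intro card_mono) (auto simp: X_def)
    then show "real (card (X (a, b, z, D))) \<le> F E" using F_upper[of a b z E] by linarith
  qed
  obtain c where c: "c \<ge> 1" and sep: "\<And>s. s \<ge> 1 \<Longrightarrow> \<exists>D0. \<forall>D\<ge>D0. \<forall>a b z S.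
    finite S \<and> S \<subseteq> interval \<mu> a b \<inter> cball z D \<and> separated (D / s) S \<longrightarrow> real (card S) \<le> (c * s) ^ n"
    by (rule card_separated_le[OF paths rank]) (rule that)
  have step: "\<exists>D0. \<forall>D\<ge>D0. F D \<le> (c * s) ^ n * F (D / s)" if s: "s \<ge> 1" for s
  proof -
    obtain D0 where D0: "\<forall>D\<ge>D0. \<forall>a b z S.
      finite S \<and> S \<subseteq> interval \<mu> a b \<inter> cball z D \<and> separated (D / s) S \<longrightarrow> real (card S) \<le> (c * s) ^ n"
      using sep[OF s] by (rule exE)
    have "F D \<le> (c * s) ^ n * F (D / s)" if D: "D \<ge> max D0 0" for D
    proof (rule F_least)
      fix a b z
      obtain Z where Z: "Z \<subseteq> X (a, b, z, D)" "separated (D / s) Z"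
        and cover: "\<And>x. x \<in> X (a, b, z, D) \<Longrightarrow> \<exists>v\<in>Z. dist v x \<le> D / s"
        using maximal_separated_subset[OF finX[of a b z D], of "D / s"] D s by auto
      have finZ: "finite Z" using Z(1) finX finite_subset by blast
      have cardZ: "real (card Z) \<le> (c * s) ^ n"
        using D0[rule_format, of D Z a b z] D finZ Z by (auto simp: X_def)
      have "X (a, b, z, D) \<subseteq> (\<Union>v\<in>Z. X (a, b, v, D / s))"
        using cover by (fastforce simp: X_def)
      then have "card (X (a, b, z, D)) \<le> card (\<Union>v\<in>Z. X (a, b, v, D / s))"
        using finZ finX by (intro card_mono) auto
      also have "\<dots> \<le> (\<Sum>v\<in>Z. card (X (a, b, v, D / s)))" by (rule card_UN_le[OF finZ])
      finally have "real (card (X (a, b, z, D))) \<le> (\<Sum>v\<in>Z. real (card (X (a, b, v, D / s))))"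
        by (metis of_nat_le_iff of_nat_sum)
      also have "\<dots> \<le> (\<Sum>v\<in>Z. F (D / s))" by (intro sum_mono F_upper)
      also have "\<dots> = real (card Z) * F (D / s)" by simp
      also have "\<dots> \<le> (c * s) ^ n * F (D / s)" using cardZ F0 by (intro mult_right_mono)
      finally show "real (card (X (a, b, z, D))) \<le> (c * s) ^ n * F (D / s)" .
    qed
    then show ?thesis by blast
  qed
  have bound: "\<exists>B\<ge>0. \<forall>D\<ge>1. F D \<le> B * D powr \<alpha>" if "\<alpha> > real n" for \<alpha>
    using growth_bound_by_rescaling[OF Fmono F0 c step that] .
  have sub: "interval \<mu> a b \<subseteq> cball a (K * dist a b + H)" for a b
  proof
    fix x assume "x \<in> interval \<mu> a b"
    then obtain y where x: "x = \<mu> a y b" by (auto simp: interval_def)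
    have "\<mu> a y a = a" by (metis mu23 mu_idem)
    moreover have "dist (\<mu> a y a) (\<mu> a y b) \<le> K * dist a b + H"
      using lip[of a a y b] by (metis mu12 mu23)
    ultimately show "x \<in> cball a (K * dist a b + H)" by (simp add: x)
  qed
  show ?thesis
  proof (intro exI[of _ "\<lambda>r. F (K * r + H)"] conjI allI impI)
    show "(\<lambda>r. F (K * r + H)) \<in> o[at_top](\<lambda>r. r powr (real n + \<epsilon>))" if "\<epsilon> > 0" for \<epsilon>
      by (rule smallo_powr_of_bound[OF bound F0 K H that])
    show "interval_growth_le \<mu> (\<lambda>r. F (K * r + H))"
      unfolding interval_growth_le_def
    proof (intro conjI allI impI F0)
      fix a b
      \<comment> \<open>An interval lies in a ball whose radius is linear in the distance of its ends.\<close>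
      have eq: "X (a, b, a, K * dist a b + H) = interval \<mu> a b" using sub by (auto simp: X_def)
      show "finite (interval \<mu> a b)" using finX[of a b a "K * dist a b + H"] eq by simp
      show "real (card (interval \<mu> a b)) \<le> F (K * dist a b + H)"
        using F_upper[of a b a "K * dist a b + H"] eq by simp
    qed
  qed
qed

section \<open>The equivalence\<close>

lemma power_limit_of_smallo:
  fixes p :: "real \<Rightarrow> real"
  assumes "\<forall>\<epsilon>>0. p \<in> o[at_top](\<lambda>r. r powr (real n + \<epsilon>))"
  shows "((\<lambda>r. p r / r ^ (n + 1)) \<longlongrightarrow> 0) at_top"
proof -
  have "((\<lambda>r. p r / r powr (real n + 1)) \<longlongrightarrow> 0) at_top"
    using assms by (intro smalloD_tendsto) simp
  moreover have "eventually (\<lambda>r. p r / r powr (real n + 1) = p r / r ^ (n + 1)) at_top"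
    using eventually_gt_at_top[of "0::real"]
  proof eventually_elim
    case (elim r)
    have "r powr (real n + 1) = r powr real (n + 1)" by (simp add: add.commute)
    then show ?case using elim by (simp only: powr_realpow)
  qed
  ultimately show ?thesis by (rule Lim_transform_eventually)
qed

theorem theorem4p15:
  fixes \<mu> :: "'a::metric_space \<Rightarrow> 'a \<Rightarrow> 'a \<Rightarrow> 'a" and n :: nat
  assumes "coarse_median_space \<mu>"
    and "uniform_discrete (UNIV :: 'a set)"
    and "quasi_geodesic (UNIV :: 'a set)"
    and "bounded_geometry (UNIV :: 'a set)"
  shows
    "(coarse_rank_at_most \<mu> n \<longleftrightarrow>
       (\<exists>p::real \<Rightarrow> real.
          (\<forall>\<epsilon>>0. p \<in> o[at_top](\<lambda>r. r powr (real n + \<epsilon>))) \<and> interval_growth_le \<mu> p)) \<and>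
     ((\<exists>p::real \<Rightarrow> real.
          (\<forall>\<epsilon>>0. p \<in> o[at_top](\<lambda>r. r powr (real n + \<epsilon>))) \<and> interval_growth_le \<mu> p) \<longleftrightarrow>
       (\<exists>p::real \<Rightarrow> real.
          ((\<lambda>r. p r / r ^ (n + 1)) \<longlongrightarrow> 0) at_top \<and> interval_growth_le \<mu> p))"
proof -
  obtain K H \<kappa> where "coarse_constants \<mu> K H \<kappa>" by (rule coarse_median_space_constants[OF assms(1)])
  then interpret coarse_constants \<mu> K H \<kappa> .
  obtain L Q where paths: "coarse_paths TYPE('a) L Q" by (rule quasi_geodesic_coarse_paths[OF assms(3)])
  let ?two = "\<exists>p::real \<Rightarrow> real. (\<forall>\<epsilon>>0. p \<in> o[at_top](\<lambda>r. r powr (real n + \<epsilon>))) \<and> interval_growth_le \<mu> p"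
  let ?three = "\<exists>p::real \<Rightarrow> real. ((\<lambda>r. p r / r ^ (n + 1)) \<longlongrightarrow> 0) at_top \<and> interval_growth_le \<mu> p"
  have "?two" if "coarse_rank_at_most \<mu> n" by (rule growth_of_bounded_rank[OF paths that assms(4)])
  moreover have "?three" if "?two" using that power_limit_of_smallo by blast
  moreover have "coarse_rank_at_most \<mu> n" if "?three"
    using that corner_condition_of_slow_growth[OF paths] rank_at_most_of_corner_condition by blast
  ultimately show ?thesis by blast
qed

end
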